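(* Let $X_1,X_2,\dots$ be i.i.d. random variables whose distribution function is Pareto, $F(x)=1-x^{-\lambda}$ for $x\ge 1$, for some $\lambda>0$ (the null hypothesis $H_0$). Then for $a>0$ $$\lim_{n\to\infty} n^{-1}\ln P\bigl(D_n^{(4)}>a\bigr)=-f_D^{(4)}(a),$$ where the function $f_D^{(4)}$ is continuous for sufficiently small $a>0$, and moreover $$f_D^{(4)}(a)=(32\,\delta_4^2)^{-1}a^2(1+o(1))\approx 1.211\,a^2\qquad\text{as } a\to 0,$$ where $\delta_4^2=\sup_{t\ge 1}\delta_4^2(t)$ and $\delta_4^2(t)=\frac{1}{560t^5}(45t^4+45t^3-252t^2+224t-62)$.
   Context: For $n\ge 4$ and $t\ge 1$, let $$H_n(t)=\binom{n}{4}^{-1}\sum_{1\le i_1<i_2<i_3<i_4\le n}\mathbf 1\{X_{(4,\{i_1,\dots,i_4\})}/X_{(3,\{i_1,\dots,i_4\})}<t\},$$ where $X_{(s,\{i_1,\dots,i_4\})}$ is the $s$-th order statistic (in increasing order) of the subsample $X_{i_1},\dots,X_{i_4}$. Let $F_n(t)=n^{-1}\sum_{i=1}^n\mathbf 1(X_i<t)$ be the empirical distribution function. The statistic is $$D_n^{(4)}=\sup_{t\ge 1}|H_n(t)-F_n(t)|.$$ The function $\delta_4^2(t)$ is the variance $\int_1^\infty \xi_4^2(s;t)s^{-2}\,ds$ of $\xi_4(s;t)=\frac1t\left(\left(1-\frac1s\right)^3-\frac14\right)-\mathbf 1\{s\ge t\}\left(\left(1-\frac ts\right)^3-\frac14\right)$.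 Numerically $\delta_4^2\approx 0.0258$, and the decimal $1.211$ is the resulting approximate value of $(32\delta_4^2)^{-1}$. *)

theory Defs
  imports "HOL-Probability.Probability" "HOL-Library.Landau_Symbols"
begin

text \<open>Random variables are numbered from 1; only the components \<open>X i\<close> with \<open>i \<ge> 1\<close> matter.\<close>

definition iid_pareto :: "'a measure \<Rightarrow> (nat \<Rightarrow> 'a \<Rightarrow> real) \<Rightarrow> real \<Rightarrow> bool" where
  "iid_pareto M X lam \<longleftrightarrow>
     prob_space M \<and>
     prob_space.indep_vars M (\<lambda>_. borel) X {1..} \<and>
     (\<forall>i\<ge>1. \<forall>x\<ge>1. cdf (distr M borel (X i)) x = 1 - x powr (- lam))"

definition order_stat :: "nat \<Rightarrow> nat set \<Rightarrow> (nat \<Rightarrow> real) \<Rightarrow> real" where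
  "order_stat s S x = sorted_list_of_multiset (image_mset x (mset_set S)) ! (s - 1)"

definition H_emp :: "nat \<Rightarrow> (nat \<Rightarrow> real) \<Rightarrow> real \<Rightarrow> real" where
  "H_emp n x t =
     (\<Sum>S | S \<subseteq> {1..n} \<and> card S = 4. of_bool (order_stat 4 S x / order_stat 3 S x < t))
       / real (n choose 4)"

definition F_emp :: "nat \<Rightarrow> (nat \<Rightarrow> real) \<Rightarrow> real \<Rightarrow> real" where
  "F_emp n x t = (\<Sum>i = 1..n. of_bool (x i < t)) / real n"

definition D_stat :: "nat \<Rightarrow> (nat \<Rightarrow> real) \<Rightarrow> real" where
  "D_stat n x = (SUP t\<in>{1..}. \<bar>H_emp n x t - F_emp n x t\<bar>)"

text \<open>For real \<open>ln\<close> the library has \<open>ln 0 = 0\<close>. The logarithm of a probability is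
  taken in the extended reals, with value \<open>-\<infinity>\<close> at \<open>0\<close>; this matters for
  \<open>a \<ge> 1\<close>, where the event \<open>D_stat > a\<close> is impossible.\<close>

definition ln_prob :: "real \<Rightarrow> ereal" where
  "ln_prob p = (if p = 0 then - \<infinity> else ereal (ln p))"

definition xi4 :: "real \<Rightarrow> real \<Rightarrow> real" where
  "xi4 s t = 1 / t * ((1 - 1 / s) ^ 3 - 1 / 4)
              - of_bool (s \<ge> t) * ((1 - t / s) ^ 3 - 1 / 4)"

text \<open>The variance of \<open>xi4\<close>, which is centred under the Pareto density \<open>1 / s\<^sup>2\<close> on \<open>[1, \<infinity>)\<close>.\<close>

definition delta4_sq_at :: "real \<Rightarrow> real" where
  "delta4_sq_at t = (LINT s:{1..}|lborel. (xi4 s t)\<^sup>2 / s\<^sup>2)"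

definition delta4_sq :: real where
  "delta4_sq = (SUP t\<in>{1..}. delta4_sq_at t)"

end

theory Submission
  imports Defs
begin

text \<open>
  Write \<open>v = lam ln x\<close>; under the null hypothesis the logarithms are standard exponential, so
  \<open>lam\<close> disappears. With \<open>T = lam ln t\<close>, the statistic \<open>H\<close> is the fraction of 4-subsets whose two
  largest logarithms differ by less than \<open>T\<close>. Sampling four points with or without replacement
  differs by \<open>O(1 / n)\<close>, and so \<open>D > a\<close> is, up to such errors, an event about the empirical
  distribution \<open>q\<close> alone: for some \<open>T\<close> the number
  \<open>1 - 4 \<integral> q((-\<infinity>, y - T])\<^sup>3 dq(y) - q((-\<infinity>, T))\<close> exceeds \<open>a\<close> in absolute value. Sanov's principle then gives
  the rate: the infimum of the relative entropy of \<open>q\<close> over all such \<open>q\<close>.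

  To stay with finite sums, the half-line is cut into \<open>m\<^sup>2\<close> cells of width \<open>1 / m\<close> and a tail cell
  (\<open>gp\<close> is the binned exponential distribution, \<open>kap\<close> the binned gap probability). On a fixed
  grid the upper bound is the method of types (\<open>prob_types_upper\<close>) and the lower bound exponential
  tilting (\<open>prob_tilting_lower\<close>). The price is an error in the level \<open>a\<close>: binning confuses gaps of
  \<open>k\<close> and \<open>k + 1\<close> cells. This error is governed by the largest cell mass, which bounded entropy
  forces to 0 as \<open>m\<close> grows. It is harmless because the optimal cost depends continuously on the
  level, uniformly in the grid (\<open>perturb_level\<close>): from any admissible \<open>q\<close> the level can be raised by
  a fixed amount at arbitrarily small cost, by a reweighting close to 1 or by a mixture with
  small weight. The same fact makes the rate function \<open>grate\<close> continuous on \<open>(0, 1)\<close>; from level 1 on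
  the event is impossible and the rate is infinite.

  For small \<open>a\<close> the quartic form \<open>kap\<close> is linearized at the exponential distribution; the derivative
  of \<open>kap + cum\<close> is there, up to constants, \<open>- 4 xi4\<close> (\<open>excess_linearization\<close>). So the problem becomes to minimize the
  entropy subject to \<open>4 \<integral> xi4 dq = a\<close>. The Gibbs variational inequality with test function
  \<open>4 \<theta> xi4\<close> bounds the cost from below (\<open>grate_lower\<close>), the density \<open>1 + 4 \<theta> (xi4 - \<mu>)\<close> from above
  (\<open>grate_upper\<close>), and both give \<open>a\<^sup>2 / (32 \<delta>\<^sup>2)\<close> with \<open>\<delta>\<^sup>2\<close> the largest variance of \<open>xi4(\<cdot>; t)\<close>, up to
  \<open>O(a\<^sup>3)\<close>. That variance is an explicit polynomial in \<open>1 / t\<close>, whose maximum is bracketed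
  rigorously.
\<close>

section \<open>Relative entropy on finite sets\<close>

text \<open>Distributions on \<open>{0..J}\<close> are extended by 0, so that sums over larger
  index sets do not change.\<close>

definition pvec :: "nat \<Rightarrow> (nat \<Rightarrow> real) \<Rightarrow> bool" where
  "pvec J q \<longleftrightarrow> (\<forall>j. 0 \<le> q j) \<and> (\<forall>j>J. q j = 0) \<and> (\<Sum>j\<le>J. q j) = 1"

definition ref_pvec :: "nat \<Rightarrow> (nat \<Rightarrow> real) \<Rightarrow> bool" where
  "ref_pvec J p \<longleftrightarrow> pvec J p \<and> (\<forall>j\<le>J. 0 < p j)"

definition KL :: "nat \<Rightarrow> (nat \<Rightarrow> real) \<Rightarrow> (nat \<Rightarrow> real) \<Rightarrow> real" where
  "KL J p q = (\<Sum>j\<le>J. q j * ln (q j / p j))"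

lemma pvec_nonneg: "pvec J q \<Longrightarrow> 0 \<le> q j"
  by (simp add: pvec_def)

lemma pvec_sum: "pvec J q \<Longrightarrow> (\<Sum>j\<le>J. q j) = 1"
  by (simp add: pvec_def)

lemma pvec_le_1: assumes "pvec J q" shows "q j \<le> 1"
proof (cases "j \<le> J")
  case True
  then have "q j \<le> (\<Sum>j\<le>J. q j)"
    by (intro member_le_sum) (use assms in \<open>auto simp: pvec_def\<close>)
  then show ?thesis using assms by (simp add: pvec_def)
next
  case False then show ?thesis using assms by (auto simp: pvec_def)
qed

lemma pvec_sum_superset:
  assumes "pvec J q" "finite A" "{..J} \<subseteq> A"
  shows "sum q A = 1"
proof -
  have "sum q A = sum q {..J}"
    by (rule sum.mono_neutral_right) (use assms in \<open>auto simp: pvec_def\<close>)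
  then show ?thesis using assms by (simp add: pvec_def)
qed

lemma pvec_sum_le_1:
  assumes "pvec J q" "finite A" shows "sum q A \<le> 1"
proof -
  have "sum q A \<le> sum q (A \<union> {..J})"
    by (rule sum_mono2) (use assms in \<open>auto simp: pvec_def\<close>)
  also have "\<dots> = 1" by (rule pvec_sum_superset) (use assms in auto)
  finally show ?thesis .
qed

lemma ref_pvecD: "ref_pvec J p \<Longrightarrow> pvec J p" "ref_pvec J p \<Longrightarrow> j \<le> J \<Longrightarrow> 0 < p j"
  by (auto simp: ref_pvec_def)

text \<open>Convexity of \<open>u ln u\<close>: its Legendre transform is the exponential.\<close>

lemma mult_le_entropy_plus_exp:
  fixes u p y :: real
  assumes "u \<ge> 0" "p > 0"
  shows "u * y \<le> u * ln (u / p) - u + p * exp y"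
proof (cases "u = 0")
  case True then show ?thesis using assms by simp
next
  case False
  then have u: "u > 0" using assms by simp
  have "1 + (y - ln (u/p)) \<le> exp (y - ln (u/p))" by (rule exp_ge_add_one_self)
  also have "\<dots> = exp y * p / u" using u assms by (simp add: exp_diff)
  finally have "u * (1 + (y - ln (u/p))) \<le> u * (exp y * p / u)" using u by (intro mult_left_mono) auto
  then show ?thesis using u by (simp add: algebra_simps)
qed

text \<open>The variational principle for relative entropy, in the form without a logarithm on
  the right; the test function \<open>y\<close> is chosen afresh in each use.\<close>

lemma Gibbs_inequality:
  assumes "ref_pvec J p" "pvec J q"
  shows "(\<Sum>j\<le>J. q j * y j) \<le> KL J p q - 1 + (\<Sum>j\<le>J. p j * exp (y j))"
proof -
  have "(\<Sum>j\<le>J. q j * y j) \<le> (\<Sum>j\<le>J. q j * ln (q j / p j) - q j + p j * exp (y j))"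
    by (intro sum_mono mult_le_entropy_plus_exp) (use assms in \<open>auto simp: ref_pvec_def pvec_def\<close>)
  also have "\<dots> = KL J p q - 1 + (\<Sum>j\<le>J. p j * exp (y j))"
    using assms by (simp add: KL_def sum.distrib sum_subtractf pvec_def)
  finally show ?thesis .
qed

lemma KL_nonneg:
  assumes "ref_pvec J p" "pvec J q" shows "0 \<le> KL J p q"
  using Gibbs_inequality[OF assms, of "\<lambda>_. 0"] assms by (simp add: ref_pvec_def pvec_def)

text \<open>A vector of bounded relative entropy charges a set of small reference mass only little.\<close>

lemma KL_small_set:
  assumes p: "ref_pvec J p" and q: "pvec J q" and A: "A \<subseteq> {..J}" and b: "sum p A \<le> b" and b0: "0 < b"
  shows "sum q A * ln (1 / b) \<le> KL J p q + 1"
proof -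
  let ?c = "ln (1/b)"
  let ?y = "\<lambda>j. if j \<in> A then ?c else 0"
  have fin: "finite A" using A finite_subset by blast
  have "sum q A * ?c = (\<Sum>j\<le>J. q j * ?y j)"
  proof -
    have "(\<Sum>j\<le>J. q j * ?y j) = (\<Sum>j\<in>A. q j * ?y j)"
      by (rule sum.mono_neutral_right) (use A in auto)
    then show ?thesis by (simp add: sum_distrib_right)
  qed
  also have "\<dots> \<le> KL J p q - 1 + (\<Sum>j\<le>J. p j * exp (?y j))" by (rule Gibbs_inequality[OF p q])
  also have "(\<Sum>j\<le>J. p j * exp (?y j)) \<le> (\<Sum>j\<le>J. p j + (if j \<in> A then p j * (1/b) else 0))"
    by (intro sum_mono) (use b0 p in \<open>auto simp: ref_pvec_def exp_minus ln_div less_imp_le inverse_eq_divide\<close>)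
  also have "\<dots> = 1 + (\<Sum>j\<in>A. p j * (1/b))"
  proof -
    have "(\<Sum>j\<le>J. (if j \<in> A then p j * (1/b) else 0)) = (\<Sum>j\<in>A. p j * (1/b))"
      by (rule sum.mono_neutral_cong_right) (use A in auto)
    then show ?thesis using p by (simp add: sum.distrib ref_pvec_def pvec_def)
  qed
  also have "(\<Sum>j\<in>A. p j * (1/b)) = sum p A / b" by (simp add: sum_divide_distrib)
  also have "sum p A / b \<le> 1" using b b0 by simp
  finally show ?thesis by simp
qed

text \<open>The negative part of \<open>u ln (u / p)\<close> is at most \<open>p / e\<close>, so
  the absolute integral of the log density is controlled by the entropy.\<close>

lemma neg_part_entropy_le:
  fixes u p :: real
  assumes "u \<ge> 0" "p > 0"
  shows "u * \<bar>ln (u / p)\<bar> \<le> u * ln (u / p) + 2 * p"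
proof (cases "u = 0 \<or> ln (u/p) \<ge> 0")
  case True then show ?thesis using assms by auto
next
  case False
  then have u: "u > 0" "ln (u/p) < 0" using assms by auto
  have "- ln (u/p) = ln (p/u)" using u assms by (simp add: ln_div)
  also have "\<dots> \<le> p/u - 1" using u assms by (intro ln_le_minus_one) auto
  also have "\<dots> \<le> p/u" by simp
  finally have "u * (- ln (u/p)) \<le> p" using u by (simp add: field_simps)
  moreover have "u * \<bar>ln (u/p)\<bar> = u * ln (u/p) + 2 * (u * (- ln (u/p)))" using u by simp
  ultimately show ?thesis by linarith
qed

text \<open>Changing every weight by at most the relative amount \<open>v\<close> changes the relative entropy
  little, because \<open>q ln (q / p)\<close> has an integrable modulus controlled by the entropy itself.\<close>

lemma KL_reweight:
  assumes p: "ref_pvec J p" and q: "pvec J q" and q': "pvec J (\<lambda>j. w j * q j)"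
    and w: "\<And>j. \<bar>w j - 1\<bar> \<le> v" and v: "v < 1"
  shows "KL J p (\<lambda>j. w j * q j) \<le> KL J p q + v * (KL J p q + 3)"
proof -
  have v0: "0 \<le> v" using w[of 0] by linarith
  have wpos: "w j > 0" for j using w[of j] v by linarith
  have 1: "w j * q j * ln (w j * q j / p j) \<le> q j * ln (q j / p j) + v * (q j * ln (q j / p j) + 2 * p j) + (w j * q j) * v"
    if "j \<le> J" for j
  proof (cases "q j = 0")
    case True then show ?thesis using p that v0 by (simp add: ref_pvec_def less_imp_le)
  next
    case False
    then have qp: "q j > 0" "p j > 0" using p q that by (auto simp: pvec_def ref_pvec_def less_le)
    have "ln (w j) \<le> v" using ln_le_minus_one[OF wpos[of j]] w[of j] by linarith
    then have a: "w j * q j * ln (w j) \<le> (w j * q j) * v"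
      using qp wpos[of j] by (intro mult_left_mono) auto
    have b: "(w j - 1) * (q j * ln (q j / p j)) \<le> v * (q j * \<bar>ln (q j / p j)\<bar>)"
    proof -
      have "(w j - 1) * (q j * ln (q j / p j)) \<le> \<bar>w j - 1\<bar> * \<bar>q j * ln (q j / p j)\<bar>"
        by (metis abs_ge_self abs_mult)
      also have "\<dots> \<le> v * \<bar>q j * ln (q j / p j)\<bar>" by (intro mult_right_mono w) auto
      finally show ?thesis using qp by (simp add: abs_mult)
    qed
    have c: "v * (q j * \<bar>ln (q j / p j)\<bar>) \<le> v * (q j * ln (q j / p j) + 2 * p j)"
      by (intro mult_left_mono neg_part_entropy_le) (use qp v0 in auto)
    have "w j * q j * ln (w j * q j / p j) = w j * q j * ln (w j) + (w j - 1) * (q j * ln (q j / p j)) + q j * ln (q j / p j)"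
      using qp wpos[of j] by (simp add: ln_div ln_mult algebra_simps)
    then show ?thesis using a b c by linarith
  qed
  have "KL J p (\<lambda>j. w j * q j) \<le> (\<Sum>j\<le>J. q j * ln (q j / p j) + v * (q j * ln (q j / p j) + 2 * p j) + (w j * q j) * v)"
    unfolding KL_def by (intro sum_mono 1) auto
  also have "\<dots> = KL J p q + v * (KL J p q + 2 * (\<Sum>j\<le>J. p j)) + (\<Sum>j\<le>J. w j * q j) * v"
    by (simp add: KL_def sum.distrib sum_distrib_left sum_distrib_right algebra_simps)
  also have "\<dots> = KL J p q + v * (KL J p q + 3)"
    using p q' by (simp add: ref_pvec_def pvec_def algebra_simps)
  finally show ?thesis .
qed

lemma pvec_mix:
  assumes "pvec J q" "pvec J r" "0 \<le> e" "e \<le> 1"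
  shows "pvec J (\<lambda>j. (1-e) * q j + e * r j)"
  using assms by (simp add: pvec_def sum.distrib flip: sum_distrib_left)

lemma entropy_tangent:
  fixes a c p :: real
  assumes "a \<ge> 0" "c > 0" "p > 0"
  shows "a * ln (c / p) + a - c \<le> a * ln (a / p)"
proof (cases "a = 0")
  case True then show ?thesis using assms by simp
next
  case False
  then have a: "a > 0" using assms by simp
  have "ln (c/a) \<le> c/a - 1" using a assms by (intro ln_le_minus_one) auto
  then have "a * ln (c/a) \<le> c - a" using a by (simp add: field_simps)
  then show ?thesis using a assms by (simp add: ln_div algebra_simps)
qed

lemma KL_convex:
  assumes p: "ref_pvec J p" and q: "pvec J q" and r: "pvec J r" and e: "0 \<le> e" "e \<le> 1"
  shows "KL J p (\<lambda>j. (1-e) * q j + e * r j) \<le> (1-e) * KL J p q + e * KL J p r"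
proof -
  have 1: "((1-e) * q j + e * r j) * ln (((1-e) * q j + e * r j) / p j)
      \<le> (1-e) * (q j * ln (q j / p j)) + e * (r j * ln (r j / p j))" if j: "j \<le> J" for j
  proof -
    let ?c = "(1-e) * q j + e * r j"
    have nn: "0 \<le> q j" "0 \<le> r j" "0 < p j" using p q r j by (auto simp: pvec_def ref_pvec_def)
    have e1: "0 \<le> 1 - e" using e by simp
    have cn: "0 \<le> ?c" using nn e e1 by (meson add_nonneg_nonneg mult_nonneg_nonneg)
    show ?thesis
    proof (cases "?c = 0")
      case True
      have "0 \<le> (1-e) * q j" "0 \<le> e * r j" using nn e e1 by auto
      with True have z: "(1-e) * q j = 0" "e * r j = 0" by linarith+
      have s: "(1-e) * (q j * ln (q j / p j)) = 0" and t: "e * (r j * ln (r j / p j)) = 0"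
        using z by auto
      show ?thesis unfolding s t True by simp
    next
      case False
      then have c: "?c > 0" using cn by linarith
      have "(1-e) * (q j * ln (?c / p j) + q j - ?c) \<le> (1-e) * (q j * ln (q j / p j))"
        using nn c e by (intro mult_left_mono entropy_tangent) auto
      moreover have "e * (r j * ln (?c / p j) + r j - ?c) \<le> e * (r j * ln (r j / p j))"
        using nn c e by (intro mult_left_mono entropy_tangent) auto
      moreover have "(1-e) * (q j * L + q j - ?c) + e * (r j * L + r j - ?c) = ?c * L" for L
        by (simp add: algebra_simps)
      ultimately show ?thesis by (metis (no_types, lifting) add_mono)
    qed
  qed
  have "KL J p (\<lambda>j. (1-e) * q j + e * r j) \<le> (\<Sum>j\<le>J. (1-e) * (q j * ln (q j / p j)) + e * (r j * ln (r j / p j)))"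
    unfolding KL_def by (intro sum_mono 1) auto
  then show ?thesis by (simp add: KL_def sum.distrib sum_distrib_left)
qed

section \<open>The gap probability as a quartic form\<close>

definition cum :: "(nat \<Rightarrow> real) \<Rightarrow> nat \<Rightarrow> real" where
  "cum q y = sum q {..<y}"

text \<open>The probability that the largest of four independent points lies at least
  \<open>k\<close> cells above the other three: 4 choices for the largest, and \<open>Suc y -
  k\<close> truncates to 0 where there is no room for a gap. On a grid this is the outer
  approximation of a gap of length \<open>k / m\<close>, and \<open>k + 1\<close> gives the inner
  one.\<close>

definition kap :: "nat \<Rightarrow> nat \<Rightarrow> (nat \<Rightarrow> real) \<Rightarrow> real" where
  "kap J k q = 4 * (\<Sum>y\<le>J. q y * cum q (Suc y - k) ^ 3)"

text \<open>The directional derivative of \<open>kap\<close> at \<open>q\<close> in direction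
  \<open>r\<close>.\<close>

definition dkap :: "nat \<Rightarrow> nat \<Rightarrow> (nat \<Rightarrow> real) \<Rightarrow> (nat \<Rightarrow> real) \<Rightarrow> real" where
  "dkap J k q r = 4 * (\<Sum>y\<le>J. r y * cum q (Suc y - k) ^ 3)
     + 12 * (\<Sum>y\<le>J. q y * cum q (Suc y - k) ^ 2 * cum r (Suc y - k))"

lemma cum_0 [simp]: "cum q 0 = 0" by (simp add: cum_def)

lemma cum_Suc: "cum q (Suc y) = cum q y + q y" by (simp add: cum_def)

lemma cum_nonneg: "(\<And>j. 0 \<le> q j) \<Longrightarrow> 0 \<le> cum q y" by (simp add: cum_def sum_nonneg)

lemma cum_mono: "(\<And>j. 0 \<le> q j) \<Longrightarrow> x \<le> y \<Longrightarrow> cum q x \<le> cum q y"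
  unfolding cum_def by (rule sum_mono2) auto

lemma pvec_cum:
  assumes "pvec J q"
  shows "0 \<le> cum q y" "cum q y \<le> 1" "x \<le> y \<Longrightarrow> cum q x \<le> cum q y" "J < y \<Longrightarrow> cum q y = 1"
proof -
  show "0 \<le> cum q y" by (rule cum_nonneg) (use assms in \<open>auto simp: pvec_def\<close>)
  show "cum q y \<le> 1" unfolding cum_def by (rule pvec_sum_le_1[OF assms]) auto
  show "x \<le> y \<Longrightarrow> cum q x \<le> cum q y" by (rule cum_mono) (use assms in \<open>auto simp: pvec_def\<close>)
  show "J < y \<Longrightarrow> cum q y = 1" unfolding cum_def by (rule pvec_sum_superset[OF assms]) auto
qed

lemma cum_eq_sum_if:
  assumes "pvec J q"
  shows "cum q i = (\<Sum>y\<le>J. if y < i then q y else 0)"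
proof -
  have "(\<Sum>y\<le>J. if y < i then q y else 0) = sum q {y\<in>{..J}. y < i}"
    by (simp only: sum.inter_filter[OF finite_atMost])
  also have "\<dots> = sum q {..<i}"
    by (rule sum.mono_neutral_left) (use assms not_le_imp_less in \<open>auto simp: pvec_def\<close>)
  finally show ?thesis by (simp add: cum_def)
qed

lemma tail_eq_sum_if:
  assumes "pvec J q"
  shows "(\<Sum>y\<le>J. if i \<le> y then q y else 0) = 1 - cum q i"
proof -
  have "(\<Sum>y\<le>J. if i \<le> y then q y else 0) + (\<Sum>y\<le>J. if y < i then q y else 0) = (\<Sum>y\<le>J. q y)"
    unfolding sum.distrib[symmetric] by (intro sum.cong) auto
  then show ?thesis using cum_eq_sum_if[OF assms, of i] pvec_sum[OF assms] by simp
qed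

lemma cum_mix: "cum (\<lambda>j. a * q j + b * r j) y = a * cum q y + b * cum r y"
  by (simp add: cum_def sum.distrib sum_distrib_left)

text \<open>A Riemann sum for \<open>\<integral> 4 u\<^sup>3 du\<close> from the left.\<close>

lemma sum_cube_telescope:
  assumes "\<And>j. 0 \<le> q j"
  shows "(\<Sum>y<n. 4 * q y * cum q y ^ 3) \<le> cum q n ^ 4"
proof (induction n)
  case (Suc n)
  have c: "0 \<le> cum q n" "0 \<le> q n" using assms cum_nonneg by auto
  have "cum q n ^ 4 + 4 * q n * cum q n ^ 3 \<le> cum q n ^ 4 + 4 * q n * cum q n ^ 3 + (6 * q n ^ 2 * cum q n ^ 2 + 4 * q n ^ 3 * cum q n + q n ^ 4)"
    using c by simp
  also have "\<dots> = cum q (Suc n) ^ 4" by (simp add: cum_Suc algebra_simps power4_eq_xxxx power3_eq_cube power2_eq_square)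
  finally show ?case using Suc by simp
qed simp

lemma kap_nonneg: "pvec J q \<Longrightarrow> 0 \<le> kap J k q"
  unfolding kap_def by (auto intro!: mult_nonneg_nonneg sum_nonneg simp: pvec_cum pvec_nonneg)

lemma kap_le_1:
  assumes "pvec J q" "1 \<le> k" shows "kap J k q \<le> 1"
proof -
  have "kap J k q \<le> (\<Sum>y\<le>J. 4 * q y * cum q y ^ 3)"
    unfolding kap_def sum_distrib_left
    using assms pvec_nonneg[OF assms(1)] pvec_cum[OF assms(1)]
    by (intro sum_mono) (auto simp: mult.assoc intro!: mult_left_mono power_mono)
  also have "\<dots> = (\<Sum>y<Suc J. 4 * q y * cum q y ^ 3)" by (simp only: lessThan_Suc_atMost)
  also have "\<dots> \<le> cum q (Suc J) ^ 4" by (rule sum_cube_telescope) (use assms in \<open>auto simp: pvec_def\<close>)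
  also have "\<dots> = 1" using pvec_cum(4)[OF assms(1)] by simp
  finally show ?thesis .
qed

lemma kap_le_tail:
  assumes "pvec J q" shows "kap J k q \<le> 4 * (1 - cum q k)"
proof -
  have "q y * cum q (Suc y - k) ^ 3 \<le> (if k \<le> y then q y else 0)" for y
  proof (cases "k \<le> y")
    case True then show ?thesis
      using pvec_nonneg[OF assms, of y] pvec_cum(1,2)[OF assms, of "Suc y - k"]
      by (simp add: mult_left_le power_le_one)
  next
    case False then show ?thesis by simp
  qed
  then have "(\<Sum>y\<le>J. q y * cum q (Suc y - k) ^ 3) \<le> (\<Sum>y\<le>J. if k \<le> y then q y else 0)"
    by (intro sum_mono) auto
  then show ?thesis unfolding kap_def tail_eq_sum_if[OF assms] by simp
qed

lemma quartic_mixture_ge: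
  fixes a b G R e :: real
  assumes "0 \<le> a" "0 \<le> b" "0 \<le> G" "0 \<le> R" "0 \<le> e" "e \<le> 1"
  shows "(1-e)^4 * (a * G^3) + e * (1-e)^3 * (b * G^3 + 3 * (a * G^2 * R))
      \<le> ((1-e) * a + e * b) * ((1-e) * G + e * R) ^ 3"
proof -
  have *: "A * X^3 + B * X^3 + 3 * (A * X^2 * Y) \<le> (A + B) * (X + Y) ^ 3"
    if "0 \<le> A" "0 \<le> B" "0 \<le> X" "0 \<le> Y" for A B X Y :: real
  proof -
    have "(A + B) * (X + Y) ^ 3 - (A * X^3 + B * X^3 + 3 * (A * X^2 * Y))
      = 3 * A * X * Y^2 + A * Y^3 + 3 * B * X^2 * Y + 3 * B * X * Y^2 + B * Y^3"
      by (simp add: algebra_simps power3_eq_cube power2_eq_square)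
    moreover have "0 \<le> \<dots>" using that by simp
    ultimately show ?thesis by linarith
  qed
  have "(1-e)^4 * (a * G^3) + e * (1-e)^3 * (b * G^3 + 3 * (a * G^2 * R))
    = ((1-e) * a) * ((1-e) * G)^3 + (e * b) * ((1-e) * G)^3 + 3 * (((1-e) * a) * ((1-e) * G)^2 * (e * R))"
    by (simp add: algebra_simps power_mult_distrib power4_eq_xxxx power3_eq_cube power2_eq_square)
  also have "\<dots> \<le> ((1-e) * a + e * b) * ((1-e) * G + e * R) ^ 3"
    by (rule *) (use assms in auto)
  finally show ?thesis .
qed

text \<open>All coefficients of \<open>kap\<close> as a quartic form are nonnegative, so along a mixture it stays
  above its constant and linear Bernstein terms.\<close>

lemma kap_mix_ge:
  assumes q: "\<And>j. 0 \<le> q j" and r: "\<And>j. 0 \<le> r j" and e: "0 \<le> e" "e \<le> 1"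
  shows "(1-e)^4 * kap J k q + e * (1-e)^3 * dkap J k q r \<le> kap J k (\<lambda>j. (1-e) * q j + e * r j)"
proof -
  have "(\<Sum>y\<le>J. (1-e)^4 * (q y * cum q (Suc y - k)^3) + e * (1-e)^3 * (r y * cum q (Suc y - k)^3
        + 3 * (q y * cum q (Suc y - k)^2 * cum r (Suc y - k))))
     \<le> (\<Sum>y\<le>J. ((1-e) * q y + e * r y) * ((1-e) * cum q (Suc y - k) + e * cum r (Suc y - k)) ^ 3)"
    by (intro sum_mono quartic_mixture_ge cum_nonneg q r e)
  moreover have "(\<Sum>y\<le>J. (1-e)^4 * (q y * cum q (Suc y - k)^3) + e * (1-e)^3 * (r y * cum q (Suc y - k)^3
        + 3 * (q y * cum q (Suc y - k)^2 * cum r (Suc y - k))))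
     = ((1-e)^4 * kap J k q + e * (1-e)^3 * dkap J k q r) / 4"
    by (simp add: kap_def dkap_def sum.distrib flip: sum_distrib_left)
  ultimately show ?thesis by (simp add: kap_def cum_mix)
qed

text \<open>The function \<open>h\<close> of the mass transferred between two parts of a distribution cannot have a
  local minimum: either its second difference is negative, or adding mass to the upper part
  decreases it.\<close>

lemma transfer_polynomial_decreases:
  fixes E C F m u K :: real
  defines "h \<equiv> \<lambda>x. (1 - m*x)^4 * E + (1 + x) * (1 - m*x)^3 * C + (1 - m*x) * F"
  assumes nn: "0 \<le> E" "0 \<le> C" "0 \<le> F" and m: "0 < m" "m \<le> 1/8" and u: "0 < u" "u \<le> 1/4"
    and K: "0 \<le> K" "K \<le> E + C + F"
  shows "h u \<le> h 0 - m^2 * u^2 / 4 * K \<or> h (-u) \<le> h 0 - m^2 * u^2 / 4 * K"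
proof -
  have mu: "m * u \<le> 1/32" using mult_mono[OF m(2) u(2)] m u by simp
  have mu0: "0 < m * u" using m u by simp
  have small: "m^2 * u^2 / 4 * K \<le> m * u * K / 100"
  proof -
    have "m^2 * u^2 / 4 * K = (m * u) * (m * u * K) / 4" by (simp add: power2_eq_square)
    also have "\<dots> \<le> (1/32) * (m * u * K) / 4"
      using mu mu0 K by (intro divide_right_mono mult_right_mono) auto
    finally have "m^2 * u^2 / 4 * K \<le> (m * u * K) / 128" by simp
    moreover have "0 \<le> m * u * K" using mu0 K by simp
    ultimately show ?thesis by linarith
  qed
  have up: "h u - h 0 \<le> E * (-4*(m*u) + 6*(m*u)^2) + C * (u - 3*(m*u)) - m*u*F"
  proof -
    have a: "(1 - m*u)^4 - 1 \<le> -4*(m*u) + 6*(m*u)^2"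
    proof -
      have "(1 - m*u)^4 - 1 = -4*(m*u) + 6*(m*u)^2 - (m*u)^3 * (4 - m*u)"
        by (simp add: algebra_simps power4_eq_xxxx power3_eq_cube power2_eq_square)
      moreover have "0 \<le> (m*u)^3 * (4 - m*u)" using mu mu0 by simp
      ultimately show ?thesis by linarith
    qed
    have b: "(1 + u) * (1 - m*u)^3 - 1 \<le> u - 3*(m*u)"
    proof -
      have "u - 3*(m*u) - ((1 + u) * (1 - m*u)^3 - 1) = 3*(m*u)*u*(1 - m*(1+u)) + (1+u)*(m*u)^3"
        by (simp add: algebra_simps power3_eq_cube power2_eq_square)
      moreover have "m * (1+u) \<le> 1/8 * 2" using m u by (intro mult_mono) auto
      moreover have "0 \<le> 3*(m*u)*u*(1 - m*(1+u))" using calculation(2) mu0 u by simp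
      moreover have "0 \<le> (1+u)*(m*u)^3" using mu0 u by simp
      ultimately show ?thesis by linarith
    qed
    have "h u - h 0 = E * ((1 - m*u)^4 - 1) + C * ((1 + u) * (1 - m*u)^3 - 1) - m*u*F"
      by (simp add: h_def algebra_simps)
    also have "\<dots> \<le> E * (-4*(m*u) + 6*(m*u)^2) + C * (u - 3*(m*u)) - m*u*F"
      using a b nn by (intro diff_right_mono add_mono mult_left_mono) auto
    finally show ?thesis .
  qed
  show ?thesis
  proof (cases "4*m*E \<le> C")
    case True
    show ?thesis
    proof (cases "m * K / 4 \<le> C")
      case Cbig: True
      have id: "h u + h (-u) - 2 * h 0 = E * (12*(m*u)^2 + 2*(m*u)^4) + C * (6*(m*u)^2 - 6*m*u^2 - 2*(m*u)^3*u)"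
        by (simp add: h_def algebra_simps power4_eq_xxxx power3_eq_cube power2_eq_square)
      have q4: "2*(m*u)^4 \<le> (m*u)^2"
      proof -
        have "(m*u)^4 = (m*u)^2 * (m*u)^2" by (simp add: power4_eq_xxxx power2_eq_square)
        also have "\<dots> \<le> (m*u)^2 * (1/32)^2" using mu mu0 by (intro mult_left_mono power_mono) auto
        finally show ?thesis using zero_le_power2[of "m*u"] unfolding power2_eq_square by linarith
      qed
      have e1: "E * (12*(m*u)^2 + 2*(m*u)^4) \<le> E * (13*(m*u)^2)" using q4 nn by (intro mult_left_mono) auto
      have e2: "E * (13*(m*u)^2) \<le> 13/4 * m * u^2 * C"
      proof -
        have "E * (13*(m*u)^2) = 13/4 * m * u^2 * (4*m*E)" by (simp add: power2_eq_square)
        also have "\<dots> \<le> 13/4 * m * u^2 * C" using True m by (intro mult_left_mono) auto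
        finally show ?thesis .
      qed
      have e3: "C * (6*(m*u)^2 - 6*m*u^2 - 2*(m*u)^3*u) \<le> C * (-(42/8)*m*u^2)"
      proof (intro mult_left_mono nn)
        have "6*(m*u)^2 = 6*m*(m*u^2)" by (simp add: power2_eq_square)
        also have "\<dots> \<le> 6*(1/8)*(m*u^2)" using m by (intro mult_right_mono) auto
        finally have "6*(m*u)^2 \<le> 6*(1/8)*(m*u^2)" .
        moreover have "0 \<le> 2*(m*u)^3*u" using mu0 u by simp
        moreover have "6*m*u^2 = 6*(m*u^2)" "-(42/8)*m*u^2 = -(42/8)*(m*u^2)" by simp_all
        ultimately show "6*(m*u)^2 - 6*m*u^2 - 2*(m*u)^3*u \<le> -(42/8)*m*u^2"
          by linarith
      qed
      have "h u + h (-u) - 2 * h 0 \<le> - 2 * (m * u^2 * C)" 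
      proof -
        have "C * (-(42/8)*m*u^2) = -(42/8) * (m * u^2 * C)" "13/4 * m * u^2 * C = 13/4 * (m * u^2 * C)"
          by (simp_all add: algebra_simps)
        then show ?thesis using id e1 e2 e3 by linarith
      qed
      moreover have "m * u^2 * (m * K / 4) \<le> m * u^2 * C" using Cbig m by (intro mult_left_mono) auto
      moreover have "m * u^2 * (m * K / 4) = m^2 * u^2 / 4 * K" by (simp add: power2_eq_square)
      ultimately show ?thesis by linarith
    next
      case False
      have "E \<le> C / (4*m)" using True m by (simp add: field_simps)
      also have "\<dots> \<le> (m * K / 4) / (4*m)" using False m by (intro divide_right_mono) auto
      also have "\<dots> = K/16" using m by simp
      finally have E: "E \<le> K/16" .
      have "m * K \<le> (1/8) * K" using m K by (intro mult_right_mono) auto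
      then have F: "F \<ge> K * (7/8)" using E False K by linarith
      have "(m*u)^2 = (m*u)*(m*u)" by (simp add: power2_eq_square)
      also have "\<dots> \<le> 1/32*(m*u)" using mu mu0 by (intro mult_right_mono) auto
      finally have "-4*(m*u) + 6*(m*u)^2 \<le> 0" using mu0 by linarith
      then have "E * (-4*(m*u) + 6*(m*u)^2) \<le> 0" using nn by (simp add: mult_nonneg_nonpos)
      moreover have "C * (u - 3*(m*u)) \<le> (m * K / 4) * u"
      proof -
        have "C * (u - 3*(m*u)) \<le> C * u" using nn mu0 by (intro mult_left_mono) auto
        also have "\<dots> \<le> (m * K / 4) * u" using False u by (intro mult_right_mono) auto
        finally show ?thesis .
      qed
      moreover have "m*u*(K * (7/8)) \<le> m*u*F" using F mu0 by (intro mult_left_mono) auto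
      moreover have "0 \<le> m*u*K" using mu0 K by simp
      ultimately have "h u - h 0 \<le> - (m*u*K) / 2" using up by (simp add: algebra_simps)
      then show ?thesis using small \<open>0 \<le> m*u*K\<close> by linarith
    qed
  next
    case False
    have mm: "m * (m * u) \<le> 1/8 * (m*u)" using m mu0 by (intro mult_right_mono) auto
    have "3*(m*u) \<le> u" using m u mult_right_mono[of m "1/8" u] by linarith
    then have "C * (u - 3*(m*u)) \<le> 4*m*E * (u - 3*(m*u))" using False by (intro mult_right_mono) auto
    then have "h u - h 0 \<le> E * (6*(m*u)^2 - 12*m*(m*u)) - m*u*F"
      using up by (simp add: algebra_simps power2_eq_square)
    also have "6*(m*u)^2 - 12*m*(m*u) = m*(m*u)*(6*u-12)" by (simp add: algebra_simps power2_eq_square)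
    also have "E * (m*(m*u)*(6*u-12)) \<le> E * (m*(m*u)*(-6))"
      using m mu0 u nn by (intro mult_left_mono) auto
    finally have 1: "h u - h 0 \<le> - (6*m*(m*u)*E) - m*u*F" by (simp add: algebra_simps)
    have "m*(m*u)*F \<le> (1/8)*(m*u)*F" by (rule mult_right_mono[OF mm nn(3)])
    moreover have "0 \<le> m*u*F" "0 \<le> m*(m*u)*E" using m mu0 nn by simp_all
    ultimately have 2: "h u - h 0 \<le> - (6*(m*(m*u)*(E+F)))" using 1 by (simp add: algebra_simps)
    have "m * E \<le> (1/8) * E" using m nn by (intro mult_right_mono) auto
    then have "4*m*E \<le> E/2" by simp
    then have "C \<le> E/2" using less_le_trans[of C "4*m*E" "E/2"] False by simp
    then have "K \<le> 3/2*(E + F)" using K nn by (simp add: field_simps)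
    then have "m*(m*u)*(K*(2/3)) \<le> m*(m*u)*(E+F)" using m mu0 by (intro mult_left_mono) auto
    moreover have "m*(m*u)*(K*(2/3)) = 2/3 * (m*(m*u)*K)" by simp
    ultimately have 3: "h u - h 0 \<le> - (4 * (m*(m*u)*K))" using 2 by linarith
    have "m^2 * u^2 / 4 * K = u/4 * (m*(m*u)*K)" by (simp add: power2_eq_square)
    also have "\<dots> \<le> 1 * (m*(m*u)*K)" using u m mu0 K by (intro mult_right_mono) auto
    finally have "m^2 * u^2 / 4 * K \<le> m*(m*u)*K" by simp
    moreover have "0 \<le> m*(m*u)*K" using m mu0 K by simp
    ultimately show ?thesis using 3 by linarith
  qed
qed

section \<open>Reweightings that lower the gap probability\<close>

text \<open>Grid versions of \<open>H - F\<close> and \<open>F - H\<close>, rounded so that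
  either exceeding \<open>a\<close> forces the deviation to exceed \<open>a\<close> up to
  \<open>O(1 / n)\<close>. Gaps between points of the tail cell \<open>J\<close> are invisible,
  hence the term \<open>4 q J\<close>.\<close>

definition up_excess :: "nat \<Rightarrow> nat \<Rightarrow> (nat \<Rightarrow> real) \<Rightarrow> real" where
  "up_excess J k q = 1 - kap J k q - 4 * q J - cum q k"

definition down_excess :: "nat \<Rightarrow> nat \<Rightarrow> (nat \<Rightarrow> real) \<Rightarrow> real" where
  "down_excess J k q = kap J (k + 1) q + cum q k - 1"

lemma power4_ge_linear: "1 - 4 * e \<le> (1 - e) ^ 4" for e :: real
  using Bernoulli_inequality_even[of 4 "-e"] by simp

lemma power3_ge_linear: "0 \<le> e \<Longrightarrow> e \<le> 1 \<Longrightarrow> 1 - 3 * e \<le> (1 - e) ^ 3" for e :: real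
  using Bernoulli_inequality[of "-e" 3] by simp

text \<open>Points far above almost all of the mass create gaps more often than average, so taking
  mass away from them lowers the gap probability.\<close>

lemma remove_upper_part:
  fixes e e0 th :: real
  assumes q: "pvec J q" and k: "1 \<le> k" "k \<le> z"
    and e0: "1 - e0 \<le> cum q (Suc z)" "0 \<le> e0" "e0 \<le> 1"
    and th: "th = 1 - cum q (z + k)" and e: "0 < e" "e \<le> th" "e < 1/4"
    and X: "kap J k q + cum q k \<le> 1 - 3 * e - 3 * e0"
  defines "w \<equiv> \<lambda>j. if z + k \<le> j then (1 - e / th) / (1 - e) else 1 / (1 - e)"
  shows "pvec J (\<lambda>j. w j * q j)"
    and "kap J k (\<lambda>j. w j * q j) + cum (\<lambda>j. w j * q j) k
      \<le> kap J k q + cum q k - 4 * e * (1 - 3 * e - 3 * e0 - (kap J k q + cum q k))"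
proof -
  define q' where "q' = (\<lambda>j. w j * q j)"
  define r where "r = (\<lambda>j. if z + k \<le> j then q j / th else 0)"
  have th0: "0 < th" using e by simp
  have qn: "0 \<le> q j" for j using q by (simp add: pvec_def)
  have q'n: "0 \<le> q' j" for j using qn e th0 by (simp add: q'_def w_def)
  have rn: "0 \<le> r j" for j using qn th0 by (simp add: r_def)
  have mix: "(\<lambda>j. (1 - e) * q' j + e * r j) = q"
    using e th0 by (auto simp: q'_def r_def w_def field_simps)
  have sr: "(\<Sum>y\<le>J. r y) = 1"
  proof -
    have "(\<Sum>y\<le>J. r y) = (\<Sum>y\<le>J. if z + k \<le> y then q y else 0) / th"
      unfolding sum_divide_distrib by (intro sum.cong) (auto simp: r_def)
    then show ?thesis using tail_eq_sum_if[OF q, of "z+k"] th th0 by simp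
  qed
  have cumq': "cum q' i = cum q i / (1 - e)" if "i \<le> z + k" for i
  proof -
    have "cum q' i = (\<Sum>j<i. q j / (1 - e))"
      unfolding cum_def by (intro sum.cong) (use that in \<open>auto simp: q'_def w_def\<close>)
    then show ?thesis by (simp add: cum_def sum_divide_distrib)
  qed
  have "(\<Sum>y\<le>J. (1 - e) * q' y + e * r y) = 1" using mix q by (metis (no_types, lifting) pvec_sum sum.cong)
  then have "(1 - e) * (\<Sum>y\<le>J. q' y) + e = 1" using sr by (simp add: sum.distrib flip: sum_distrib_left)
  then have "(1 - e) * ((\<Sum>y\<le>J. q' y) - 1) = 0" by (simp add: algebra_simps)
  then have "(\<Sum>y\<le>J. q' y) = 1" using e by simp
  then have pv: "pvec J q'" using q'n q by (simp add: pvec_def) (simp add: q'_def)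
  then show "pvec J (\<lambda>j. w j * q j)" by (simp add: q'_def)
  have dk: "4 * (1 - 3 * e0) \<le> dkap J k q' r"
  proof -
    have "(1 - 3 * e0) * r y \<le> r y * cum q' (Suc y - k) ^ 3" for y
    proof (cases "z + k \<le> y")
      case True
      then have "cum q' (Suc z) \<le> cum q' (Suc y - k)" by (intro pvec_cum[OF pv]) auto
      moreover have "cum q' (Suc z) = cum q (Suc z) / (1 - e)" using k by (intro cumq') auto
      moreover have "cum q (Suc z) \<le> cum q (Suc z) / (1 - e)"
        using e pvec_cum(1)[OF q, of "Suc z"] by (simp add: field_simps mult_left_le)
      ultimately have "1 - e0 \<le> cum q' (Suc y - k)" using e0 by linarith
      then have "(1 - e0)^3 \<le> cum q' (Suc y - k) ^ 3" using e0 by (intro power_mono) auto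
      then have "1 - 3 * e0 \<le> cum q' (Suc y - k) ^ 3" using power3_ge_linear[of e0] e0 by linarith
      then have "r y * (1 - 3 * e0) \<le> r y * cum q' (Suc y - k) ^ 3"
        using rn by (intro mult_left_mono) auto
      then show ?thesis by (simp add: mult.commute)
    next
      case False then show ?thesis by (simp add: r_def)
    qed
    then have 1: "(\<Sum>y\<le>J. (1 - 3 * e0) * r y) \<le> (\<Sum>y\<le>J. r y * cum q' (Suc y - k) ^ 3)" by (intro sum_mono) auto
    have 2: "(\<Sum>y\<le>J. (1 - 3 * e0) * r y) = 1 - 3 * e0" using sr by (simp flip: sum_distrib_left)
    have 3: "0 \<le> (\<Sum>y\<le>J. q' y * cum q' (Suc y - k) ^ 2 * cum r (Suc y - k))"
      by (intro sum_nonneg mult_nonneg_nonneg q'n cum_nonneg rn) auto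
    have "4 * c \<le> 4 * A + 12 * B'" if "X \<le> A" "X = c" "0 \<le> B'" for X A B' c :: real
      using that by linarith
    from this[OF 1 2 3] show ?thesis unfolding dkap_def .
  qed
  let ?P = "kap J k q + cum q k" and ?P' = "kap J k q' + cum q' k"
  have e3: "e0 \<le> 1/3"
    using X kap_nonneg[OF q, of k] pvec_cum(1)[OF q, of k] e by linarith
  have "(1-e)^4 * kap J k q' + e * (1-e)^3 * dkap J k q' r \<le> kap J k q"
    using kap_mix_ge[where q=q' and r=r and e=e and J=J and k=k] q'n rn e unfolding mix by simp
  moreover have "(1 - 4 * e) * kap J k q' \<le> (1-e)^4 * kap J k q'"
    using power4_ge_linear[of e] kap_nonneg[OF pv] by (intro mult_right_mono) auto
  moreover have "e * (1 - 3 * e) * (4 * (1 - 3 * e0)) \<le> e * (1-e)^3 * dkap J k q' r"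
    using power3_ge_linear[of e] dk e e3 by (intro mult_mono) auto
  moreover have "cum q k = (1 - e) * cum q' k" using cumq'[of k] k e by simp
  moreover have "(1 - 4 * e) * cum q' k \<le> (1 - e) * cum q' k"
    using e pvec_cum(1)[OF pv] by (intro mult_right_mono) auto
  moreover have "4 * e * (1 - 3 * e - 3 * e0) \<le> e * (1 - 3 * e) * (4 * (1 - 3 * e0))"
    using e e0 by (simp add: algebra_simps)
  ultimately have m: "(1 - 4 * e) * ?P' \<le> ?P - 4 * e * (1 - 3 * e - 3 * e0)" by (simp add: algebra_simps)
  let ?Y = "4 * e * (1 - 3 * e - 3 * e0 - ?P)"
  have Y: "0 \<le> ?Y" using X e by simp
  have "(1 - 4 * e) * ?P' \<le> (1 - 4 * e) * ?P - ?Y" using m by (simp add: algebra_simps)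
  also have "\<dots> \<le> (1 - 4 * e) * ?P - (1 - 4 * e) * ?Y"
    using Y e mult_right_mono[of "1 - 4*e" 1 ?Y] by simp
  also have "\<dots> = (1 - 4 * e) * (?P - ?Y)" by (simp add: algebra_simps)
  finally have "?P' \<le> ?P - ?Y" using e by simp
  then show "kap J k (\<lambda>j. w j * q j) + cum (\<lambda>j. w j * q j) k
      \<le> kap J k q + cum q k - 4 * e * (1 - 3 * e - 3 * e0 - (kap J k q + cum q k))"
    by (simp add: q'_def)
qed

text \<open>The part \<open>[z, z + k)\<close> is too narrow to contain a gap, so rescaling it against \<open>[0, z)\<close>
  gives a polynomial with only two coefficients, up to the mass above \<open>z + k\<close>.\<close>

lemma rescale_window:
  fixes x m :: real
  assumes q: "pvec J q" and k: "1 \<le> k" "k \<le> z"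
    and m: "m * cum q z = cum q (z + k) - cum q z" and x: "-1 \<le> x" "m * x \<le> 1"
  defines "w \<equiv> \<lambda>j. if j < z then 1 - m * x else if j < z + k then 1 + x else 1"
    and "E \<equiv> 4 * (\<Sum>y\<le>J. if y < z then q y * cum q (Suc y - k) ^ 3 else 0)"
    and "C \<equiv> 4 * (\<Sum>y\<le>J. if z \<le> y \<and> y < z + k then q y * cum q (Suc y - k) ^ 3 else 0)"
  shows "pvec J (\<lambda>j. w j * q j)"
    and "kap J k (\<lambda>j. w j * q j) + cum (\<lambda>j. w j * q j) k
      \<le> (1 - m*x)^4 * E + (1 + x) * (1 - m*x)^3 * C + (1 - m*x) * cum q k + 4 * (1 - cum q (z + k))"
    and "E + C \<le> kap J k q" "kap J k q \<le> E + C + 4 * (1 - cum q (z + k))" "0 \<le> E" "0 \<le> C"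
proof -
  define q' where "q' = (\<lambda>j. w j * q j)"
  have qn: "0 \<le> q j" for j using q by (simp add: pvec_def)
  have q'n: "0 \<le> q' j" for j using qn x by (simp add: q'_def w_def)
  have cn: "0 \<le> cum q i" for i by (rule pvec_cum[OF q])
  have "(\<Sum>y\<le>J. q' y) = (\<Sum>y\<le>J. (1 - m*x) * (if y < z then q y else 0)
     + (1 + x) * ((if y < z + k then q y else 0) - (if y < z then q y else 0)) + (if z + k \<le> y then q y else 0))"
    by (intro sum.cong) (auto simp: q'_def w_def)
  also have "\<dots> = (1 - m*x) * cum q z + (1 + x) * (cum q (z+k) - cum q z) + (1 - cum q (z+k))"
    unfolding cum_eq_sum_if[OF q, symmetric] sum.distrib tail_eq_sum_if[OF q] sum_distrib_left[symmetric] sum_subtractf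
    by simp
  also have "\<dots> = 1 + x * (cum q (z+k) - cum q z - m * cum q z)" by (simp add: algebra_simps)
  also have "\<dots> = 1" using m by simp
  finally have pv: "pvec J q'" using q'n q by (simp add: pvec_def) (simp add: q'_def)
  then show "pvec J (\<lambda>j. w j * q j)" by (simp add: q'_def)
  have cumq': "cum q' i = (1 - m*x) * cum q i" if "i \<le> z" for i
  proof -
    have "cum q' i = (\<Sum>j<i. (1 - m*x) * q j)"
      unfolding cum_def by (intro sum.cong) (use that in \<open>auto simp: q'_def w_def\<close>)
    then show ?thesis by (simp add: cum_def sum_distrib_left)
  qed
  let ?e = "\<lambda>y. if y < z then q y * cum q (Suc y - k) ^ 3 else 0"
  let ?c = "\<lambda>y. if z \<le> y \<and> y < z + k then q y * cum q (Suc y - k) ^ 3 else 0"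
  let ?t = "\<lambda>y. if z + k \<le> y then q y else 0"
  have pw: "q' y * cum q' (Suc y - k) ^ 3 \<le> (1 - m*x)^4 * ?e y + (1 + x) * (1 - m*x)^3 * ?c y + ?t y" for y
  proof (cases "y < z + k")
    case True
    then have c: "cum q' (Suc y - k) = (1 - m*x) * cum q (Suc y - k)" using k by (intro cumq') auto
    show ?thesis unfolding c using True
      by (auto simp: q'_def w_def power_mult_distrib power4_eq_xxxx power3_eq_cube mult_ac)
  next
    case False
    then show ?thesis using pvec_cum(1,2)[OF pv] qn by (simp add: q'_def w_def mult_left_le power_le_one)
  qed
  have "(\<Sum>y\<le>J. q' y * cum q' (Suc y - k) ^ 3)
      \<le> (\<Sum>y\<le>J. (1 - m*x)^4 * ?e y + (1 + x) * (1 - m*x)^3 * ?c y + ?t y)" by (intro sum_mono pw)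
  also have "\<dots> = (1 - m*x)^4 * (\<Sum>y\<le>J. ?e y) + (1 + x) * (1 - m*x)^3 * (\<Sum>y\<le>J. ?c y) + (\<Sum>y\<le>J. ?t y)"
    by (simp only: sum.distrib sum_distrib_left)
  finally have "kap J k q' \<le> (1 - m*x)^4 * E + (1 + x) * (1 - m*x)^3 * C + 4 * (1 - cum q (z + k))"
    unfolding kap_def E_def C_def tail_eq_sum_if[OF q] by (simp add: algebra_simps)
  moreover have "cum q' k = (1 - m*x) * cum q k" using k by (intro cumq') auto
  ultimately show "kap J k (\<lambda>j. w j * q j) + cum (\<lambda>j. w j * q j) k
      \<le> (1 - m*x)^4 * E + (1 + x) * (1 - m*x)^3 * C + (1 - m*x) * cum q k + 4 * (1 - cum q (z + k))"
    by (simp add: q'_def)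
  have t0: "0 \<le> q y * cum q (Suc y - k) ^ 3" "q y * cum q (Suc y - k) ^ 3 \<le> q y" for y
    using pvec_cum(1,2)[OF q] qn by (simp_all add: mult_left_le power_le_one)
  show "0 \<le> E" "0 \<le> C" unfolding E_def C_def using t0(1) by (auto intro!: sum_nonneg)
  have "(\<Sum>y\<le>J. ?e y) + (\<Sum>y\<le>J. ?c y) \<le> (\<Sum>y\<le>J. q y * cum q (Suc y - k) ^ 3)"
    unfolding sum.distrib[symmetric] by (intro sum_mono) (use t0 in auto)
  then show "E + C \<le> kap J k q" by (simp add: E_def C_def kap_def)
  have "(\<Sum>y\<le>J. q y * cum q (Suc y - k) ^ 3) \<le> (\<Sum>y\<le>J. ?e y) + (\<Sum>y\<le>J. ?c y) + (\<Sum>y\<le>J. ?t y)"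
    unfolding sum.distrib[symmetric] by (intro sum_mono) (use t0 in auto)
  then show "kap J k q \<le> E + C + 4 * (1 - cum q (z + k))"
    unfolding kap_def E_def C_def tail_eq_sum_if[OF q] by simp
qed

text \<open>Let \<open>z\<close> be the cell at which the mass of \<open>q\<close> reaches almost
  1. If \<open>kap + cum\<close> is small, there is room already. If visible mass lies above
  \<open>z + k\<close>, removing some of it helps. Otherwise the mass near the top lies in a
  window of width \<open>k\<close>, and moving mass into or out of this window helps. In both
  cases the weights stay within \<open>v\<close> of 1, so the entropy hardly changes.\<close>

lemma perturb_up:
  fixes a1 a2 B om :: real
  assumes a: "0 < a1" "a1 \<le> a2" "a2 < 1" and om: "0 < om" and B: "0 \<le> B"
  shows "\<exists>\<eta>>0. \<exists>\<delta>>0. \<forall>J p q k a. ref_pvec J p \<longrightarrow> pvec J q \<longrightarrow> KL J p q \<le> B \<longrightarrow> (\<forall>j. q j \<le> \<delta>) \<longrightarrow>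
     1 \<le> k \<longrightarrow> k \<le> J \<longrightarrow> a1 \<le> a \<longrightarrow> a \<le> a2 \<longrightarrow> a < up_excess J k q \<longrightarrow>
     (\<exists>q'. pvec J q' \<and> KL J p q' \<le> KL J p q + om \<and> a + \<eta> < up_excess J k q')"
proof -
  define v where "v = min (1/4) (om / (B + 3))"
  define e0 where "e0 = a1 / 32"
  define K0 where "K0 = (1 - a2) / 2"
  define gB where "gB = (e0/2)^2 * v^2 / 4 * (K0/2)"
  define \<sigma> where "\<sigma> = min (e0/2) (min (K0/8) (gB/16))"
  define e where "e = v * \<sigma> / 4"
  define gA where "gA = 2 * e * a1"
  define \<delta> where "\<delta> = min e0 (min (K0/16) (min (gA/32) (gB/32)))"
  define \<eta> where "\<eta> = min (K0/2) (min (gA/4) (gB/4))"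
  have v: "0 < v" "v \<le> 1/4" "v * (B + 3) \<le> om"
  proof -
    show "0 < v" using om B by (simp add: v_def)
    show "v \<le> 1/4" unfolding v_def by linarith
    have "v \<le> om / (B + 3)" unfolding v_def by linarith
    then show "v * (B + 3) \<le> om" using B by (simp add: pos_le_divide_eq)
  qed
  have e0: "0 < e0" "e0 \<le> 1/32" using a by (auto simp: e0_def)
  have K0: "0 < K0" "a2 = 1 - 2 * K0" using a by (simp_all add: K0_def field_simps)
  have gB: "0 < gB" using e0 v K0 by (simp add: gB_def)
  have \<sigma>: "0 < \<sigma>" "\<sigma> \<le> e0/2" "\<sigma> \<le> K0/8" "\<sigma> \<le> gB/16" using e0 K0 gB unfolding \<sigma>_def by linarith+
  have e: "0 < e" "e \<le> \<sigma> / 16" using v \<sigma> mult_right_mono[OF v(2), of \<sigma>] by (simp_all add: e_def)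
  have gA: "0 < gA" using e a by (simp add: gA_def)
  have \<delta>: "0 < \<delta>" "\<delta> \<le> e0" "\<delta> \<le> K0/16" "\<delta> \<le> gA/32" "\<delta> \<le> gB/32" using e0 K0 gA gB unfolding \<delta>_def by linarith+
  have \<eta>: "0 < \<eta>" "\<eta> \<le> K0/2" "\<eta> \<le> gA/4" "\<eta> \<le> gB/4" using K0 gA gB unfolding \<eta>_def by linarith+
  have main: "\<exists>q'. pvec J q' \<and> KL J p q' \<le> KL J p q + om \<and> t + \<eta> < up_excess J k q'"
    if p: "ref_pvec J p" and q: "pvec J q" and KLB: "KL J p q \<le> B" and small: "\<And>j. q j \<le> \<delta>"
      and k: "1 \<le> k" "k \<le> J" and t: "a1 \<le> t" "t \<le> a2" "t < up_excess J k q" for J p q k t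
  proof -
    let ?P = "\<lambda>q. kap J k q + cum q k"
    have qJ: "0 \<le> q J" "q J \<le> \<delta>" using q small by (auto simp: pvec_def)
    have P: "?P q < 1 - t" using t(3) qJ by (simp add: up_excess_def)
    \<comment> \<open>A reweighting by factors within \<open>v\<close> of 1 that lowers the value by \<open>g\<close> suffices.\<close>
    have reweight: ?thesis if w: "\<And>j. \<bar>w j - 1\<bar> \<le> v" and pv: "pvec J (\<lambda>j. w j * q j)"
      and g: "?P (\<lambda>j. w j * q j) \<le> ?P q - g" "2 * \<eta> \<le> g" "16 * \<delta> \<le> g" "0 < g" for w g
    proof (intro exI conjI)
      let ?q = "\<lambda>j. w j * q j"
      show "pvec J ?q" by (rule pv)
      have "KL J p ?q \<le> KL J p q + v * (KL J p q + 3)" by (rule KL_reweight[OF p q pv w]) (use v in auto)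
      also have "v * (KL J p q + 3) \<le> v * (B + 3)" using v KLB by (intro mult_left_mono) auto
      finally show "KL J p ?q \<le> KL J p q + om" using v by linarith
      have "w J * q J \<le> 2 * \<delta>" using w[of J] v qJ by (intro mult_mono) auto
      then have "1 - ?P q + g - 8 * \<delta> \<le> up_excess J k ?q" using g(1) by (simp add: up_excess_def)
      then show "t + \<eta> < up_excess J k ?q" using g P \<delta> by linarith
    qed
    show ?thesis
    proof (cases "?P q \<le> K0")
      case True
      have "t + \<eta> < up_excess J k q" using True qJ \<delta> \<eta> K0 t unfolding up_excess_def by linarith
      then show ?thesis using q om by auto
    next
      case False
      define Z where "Z = {z. z \<le> J \<and> cum q z \<le> 1 - e0}"
      define z where "z = Max Z"
      have Z: "finite Z" "0 \<in> Z" using e0 by (auto simp: Z_def)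
      then have "z \<in> Z" unfolding z_def by (intro Max_in) auto
      then have z: "z \<le> J" "cum q z \<le> 1 - e0" by (auto simp: Z_def)
      have z1: "1 - e0 < cum q (Suc z)"
      proof (rule ccontr)
        assume "\<not> ?thesis"
        then have c: "cum q (Suc z) \<le> 1 - e0" by simp
        then have "Suc z \<le> J" using pvec_cum(4)[OF q, of "Suc z"] e0 by (cases "J < Suc z") auto
        then have "Suc z \<in> Z" using c by (simp add: Z_def)
        then have "Suc z \<le> z" unfolding z_def using Z by (intro Max_ge) auto
        then show False by simp
      qed
      have z2: "1 - e0 - \<delta> < cum q z" using z1 small[of z] by (simp add: cum_Suc)
      have kz: "k \<le> z"
      proof (rule ccontr)
        assume "\<not> k \<le> z"
        then have "cum q (Suc z) \<le> cum q k" by (intro pvec_cum[OF q]) auto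
        then have "1 - e0 < ?P q" using z1 kap_nonneg[OF q, of k] by linarith
        then show False using P t e0 a e0_def by linarith
      qed
      define th where "th = 1 - cum q (z + k)"
      have th0: "0 \<le> th" using pvec_cum(2)[OF q] by (simp add: th_def)
      have "cum q (Suc z) \<le> cum q (z + k)" using k by (intro pvec_cum[OF q]) auto
      then have th1: "th \<le> e0" using z1 by (simp add: th_def)
      show ?thesis
      proof (cases "\<sigma> \<le> th")
        case True
        define w where "w = (\<lambda>j. if z + k \<le> j then (1 - e / th) / (1 - e) else 1 / (1 - e))"
        have eth: "e \<le> th" using e True \<sigma> by linarith
        have e14: "e < 1/4" using e \<sigma> e0 by linarith
        have X: "?P q \<le> 1 - 3 * e - 3 * e0" using P t e \<sigma> e0 a unfolding e0_def by linarith
        have "e0 \<le> 1" using e0 by simp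
        note R' = remove_upper_part[OF q k(1) kz less_imp_le[OF z1] less_imp_le[OF e0(1)] this th_def e(1) eth e14 X]
        have R: "pvec J (\<lambda>j. w j * q j)"
          "?P (\<lambda>j. w j * q j) \<le> ?P q - 4 * e * (1 - 3 * e - 3 * e0 - ?P q)"
          unfolding w_def by (rule R')+
        have "e / th \<le> v / 4"
        proof -
          have "e \<le> v / 4 * th" using True v by (simp add: e_def mult_left_mono)
          then show ?thesis using e eth by (simp add: field_simps)
        qed
        have wv: "\<bar>w j - 1\<bar> \<le> v" for j
        proof (cases "z + k \<le> j")
          case True
          have a: "1 - v / 4 \<le> 1 - e / th" "1 - e / th \<le> 1 - e" "0 < 1 - e"
            using \<open>e / th \<le> v / 4\<close> e eth th1 e0 by (auto simp: field_simps mult_left_le)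
          have "1 - v \<le> (1 - e / th) / (1 - e)"
          proof -
            have "(1 - v) * (1 - e) \<le> 1 - v" using v e a by (simp add: mult_left_le)
            then have "(1 - v) * (1 - e) \<le> 1 - e / th" using a v by linarith
            then show ?thesis using a by (simp add: pos_le_divide_eq)
          qed
          moreover have "(1 - e / th) / (1 - e) \<le> 1" using a by simp
          ultimately show ?thesis using True v by (simp add: w_def)
        next
          case False
          have "e \<le> v / 4 * (1/64)" unfolding e_def using v \<sigma> e0 mult_left_mono[of \<sigma> "1/64" "v/4"] by simp
          moreover have "e * v \<le> e" using v e by (simp add: mult_left_le)
          ultimately have "e + e * v \<le> v" using v by linarith
          then have "1 \<le> (1 + v) * (1 - e)" by (simp add: algebra_simps)
          then have "1 / (1 - e) \<le> 1 + v" using e14 by (simp add: pos_divide_le_eq)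
          moreover have "1 \<le> 1 / (1 - e)" using e14 e by simp
          ultimately show ?thesis using False by (simp add: w_def)
        qed
        have "a1 / 2 \<le> 1 - 3 * e - 3 * e0 - ?P q"
          using P t e \<sigma> e0 a unfolding e0_def by linarith
        then have "4 * e * (a1 / 2) \<le> 4 * e * (1 - 3 * e - 3 * e0 - ?P q)" using e by (intro mult_left_mono) auto
        then have "gA \<le> 4 * e * (1 - 3 * e - 3 * e0 - ?P q)" by (simp add: gA_def)
        with R(2) e0 have g: "?P (\<lambda>j. w j * q j) \<le> ?P q - gA" by simp
        show ?thesis
          by (rule reweight[OF wv _ g]) (use R(1) e0 \<eta> \<delta> gA in auto)
      next
        case False
        define m where "m = (cum q (z + k) - cum q z) / cum q z"
        have cz: "15/16 \<le> cum q z" "cum q z \<le> 1" using z2 \<delta> e0 pvec_cum(2)[OF q] by auto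
        have mid: "e0 / 2 \<le> cum q (z+k) - cum q z" "cum q (z+k) - cum q z \<le> 1/16"
          using False \<sigma> z z2 \<delta> e0 th0 unfolding th_def by linarith+
        have m: "e0 / 2 \<le> m" "m \<le> 1/8" "0 < m"
        proof -
          show "m \<le> 1/8" using cz mid by (simp add: m_def field_simps)
          have "e0/2 * cum q z \<le> cum q (z+k) - cum q z" using mid(1) mult_left_le[of "cum q z" "e0/2"] cz e0 by linarith
          then show "e0/2 \<le> m" using cz by (simp add: m_def field_simps)
          then show "0 < m" using e0 by linarith
        qed
        have mc: "m * cum q z = cum q (z + k) - cum q z" using cz by (simp add: m_def)
        define E where "E = 4 * (\<Sum>y\<le>J. if y < z then q y * cum q (Suc y - k) ^ 3 else 0)"
        define C where "C = 4 * (\<Sum>y\<le>J. if z \<le> y \<and> y < z + k then q y * cum q (Suc y - k) ^ 3 else 0)"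
        define w where "w = (\<lambda>x j. if j < z then 1 - m * x else if j < z + k then 1 + x else 1)"
        define h where "h = (\<lambda>x. (1 - m*x)^4 * E + (1 + x) * (1 - m*x)^3 * C + (1 - m*x) * cum q k)"
        have mx: "\<bar>m * x\<bar> \<le> v" if "\<bar>x\<bar> \<le> v" for x
          using that m mult_mono[of m 1 "\<bar>x\<bar>" v] by (simp add: abs_mult)
        have W: "pvec J (\<lambda>j. w x j * q j)" "?P (\<lambda>j. w x j * q j) \<le> h x + 4 * th"
          "E + C \<le> kap J k q" "kap J k q \<le> E + C + 4 * th" "0 \<le> E" "0 \<le> C" if "\<bar>x\<bar> \<le> v" for x
        proof -
          have xx: "-1 \<le> x" "m * x \<le> 1" using that mx[OF that] v by auto
          note W = rescale_window[OF q k(1) kz mc xx]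
          show "pvec J (\<lambda>j. w x j * q j)" unfolding w_def by (rule W(1))
          show "?P (\<lambda>j. w x j * q j) \<le> h x + 4 * th"
            unfolding w_def h_def th_def E_def C_def by (rule W(2))
          show "E + C \<le> kap J k q" unfolding E_def C_def by (rule W(3))
          show "kap J k q \<le> E + C + 4 * th" unfolding E_def C_def th_def by (rule W(4))
          show "0 \<le> E" unfolding E_def by (rule W(5))
          show "0 \<le> C" unfolding C_def by (rule W(6))
        qed
        have vv: "\<bar>v\<bar> \<le> v" "\<bar>-v\<bar> \<le> v" using v by auto
        have EC: "K0/2 \<le> E + C + cum q k"
          using W(4)[OF vv(1)] \<open>\<not> ?P q \<le> K0\<close> False \<sigma> by linarith
        have "h v \<le> h 0 - m^2 * v^2 / 4 * (K0/2) \<or> h (-v) \<le> h 0 - m^2 * v^2 / 4 * (K0/2)"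
          unfolding h_def
          using transfer_polynomial_decreases[OF W(5)[OF vv(1)] W(6)[OF vv(1)] pvec_cum(1)[OF q] m(3) m(2) v(1) v(2) _ EC]
            K0 by simp
        then obtain x where x: "\<bar>x\<bar> \<le> v" "h x \<le> h 0 - m^2 * v^2 / 4 * (K0/2)" using vv by blast
        have "(e0/2)^2 \<le> m^2" using m e0 by (intro power_mono) auto
        then have "gB \<le> m^2 * v^2 / 4 * (K0/2)" unfolding gB_def using K0
          by (intro mult_right_mono divide_right_mono) auto
        then have hx: "h x \<le> h 0 - gB" using x by linarith
        have "h 0 \<le> ?P q" using W(3)[OF vv(1)] by (simp add: h_def)
        then have g: "?P (\<lambda>j. w x j * q j) \<le> ?P q - gB * (3/4)"
          using W(2)[OF x(1)] hx False \<sigma> by linarith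
        have wv: "\<bar>w x j - 1\<bar> \<le> v" for j using x mx[OF x(1)] v by (auto simp: w_def)
        show ?thesis
          by (rule reweight[OF wv W(1)[OF x(1)] g]) (use \<eta> \<delta> gB in auto)
      qed
    qed
  qed
  show ?thesis
  proof (rule exI[of _ \<eta>], rule conjI[OF \<eta>(1)], rule exI[of _ \<delta>], rule conjI[OF \<delta>(1)], intro allI impI)
    fix J p q k t
    assume "ref_pvec J p" "pvec J q" "KL J p q \<le> B" "\<forall>j. q j \<le> \<delta>" "1 \<le> k" "k \<le> J"
      "a1 \<le> t" "t \<le> a2" "t < up_excess J k q"
    then show "\<exists>q'. pvec J q' \<and> KL J p q' \<le> KL J p q + om \<and> t + \<eta> < up_excess J k q'"
      by (intro main) simp_all
  qed
qed

section \<open>The binned exponential distribution\<close>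

definition gp :: "nat \<Rightarrow> nat \<Rightarrow> real" where
  "gp m j = (if j < m * m then exp (- (real j / real m)) - exp (- (real (Suc j) / real m))
             else if j = m * m then exp (- real m) else 0)"

lemma cum_gp:
  assumes "0 < m" "i \<le> m * m" shows "cum (gp m) i = 1 - exp (- (real i / real m))"
  using assms(2) by (induction i) (auto simp: cum_Suc gp_def)

lemma gp_pos:
  assumes "0 < m" "j \<le> m * m" shows "0 < gp m j"
proof (cases "j < m * m")
  case True
  have "- (real (Suc j) / real m) < - (real j / real m)" using assms by (simp add: field_simps)
  then show ?thesis using True by (simp add: gp_def)
next
  case False then show ?thesis using assms by (simp add: gp_def)
qed

lemma ref_pvec_gp: assumes "0 < m" shows "ref_pvec (m * m) (gp m)"
proof -
  have "(\<Sum>j\<le>m*m. gp m j) = cum (gp m) (m*m) + gp m (m*m)"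
    by (simp add: cum_def flip: lessThan_Suc_atMost)
  also have "\<dots> = 1" using assms by (simp add: cum_gp) (simp add: gp_def)
  finally have "(\<Sum>j\<le>m*m. gp m j) = 1" .
  moreover have "0 \<le> gp m j" for j
    using gp_pos[OF assms, of j] by (cases "j \<le> m * m") (auto simp: gp_def)
  ultimately show ?thesis using gp_pos[OF assms] by (simp add: ref_pvec_def pvec_def) (simp add: gp_def)
qed

lemma gp_le: assumes "0 < m" shows "gp m j \<le> 1 / real m"
proof -
  consider "j < m * m" | "j = m * m" | "j > m * m" by linarith
  then show ?thesis
  proof cases
    case 1
    have "exp (- (real (Suc j) / real m)) = exp (- (real j / real m)) * exp (- (1 / real m))"
      unfolding exp_add[symmetric] by (simp add: add_divide_distrib)
    then have "gp m j = exp (- (real j / real m)) * (1 - exp (- (1 / real m)))"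
      using 1 by (simp add: gp_def algebra_simps)
    also have "\<dots> \<le> 1 * (1 / real m)"
      using exp_ge_add_one_self[of "- (1 / real m)"] by (intro mult_mono) auto
    finally show ?thesis by simp
  next
    case 2
    have "real m \<le> exp (real m)" using exp_ge_add_one_self[of "real m"] by linarith
    then have "exp (- real m) \<le> 1 / real m" using assms by (simp add: exp_minus field_simps)
    then show ?thesis using 2 by (simp add: gp_def)
  next
    case 3 then show ?thesis by (simp add: gp_def)
  qed
qed

text \<open>All cells have small reference mass, so bounded entropy leaves no atoms in the limit
  of fine grids.\<close>

lemma KL_bound_cell:
  assumes "0 < m" "pvec (m*m) q" "KL (m*m) (gp m) q \<le> B"
  shows "q j * ln (real m) \<le> B + 1"
proof (cases "j \<le> m * m")
  case True
  have "sum q {j} * ln (1 / (1 / real m)) \<le> KL (m*m) (gp m) q + 1"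
    by (rule KL_small_set[OF ref_pvec_gp]) (use assms True gp_le in auto)
  then show ?thesis using assms by simp
next
  case False
  then have "q j = 0" using assms by (simp add: pvec_def)
  moreover have "0 \<le> KL (m*m) (gp m) q" by (rule KL_nonneg[OF ref_pvec_gp]) (use assms in auto)
  ultimately show ?thesis using assms by simp
qed

text \<open>Bounded entropy makes the tails uniformly light.\<close>

lemma KL_bound_tail:
  assumes m: "0 < m" and q: "pvec (m*m) q" and B: "KL (m*m) (gp m) q \<le> B"
  shows "(1 - cum q i) * (real i / real m) \<le> B + 1"
proof (cases "i \<le> m * m")
  case True
  have split: "1 - cum f i = sum f {i..m*m}" if "pvec (m*m) f" for f
  proof -
    have "(\<Sum>j\<le>m*m. f j) = sum f {..<i} + sum f {i..m*m}"
      using True by (subst sum.union_disjoint[symmetric]) (auto intro!: sum.cong)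
    then show ?thesis using that by (simp add: cum_def pvec_def)
  qed
  have "sum q {i..m*m} * ln (1 / exp (- (real i / real m))) \<le> KL (m*m) (gp m) q + 1"
  proof (rule KL_small_set[OF ref_pvec_gp[OF m] q])
    show "sum (gp m) {i..m*m} \<le> exp (- (real i / real m))"
      using split[of "gp m"] ref_pvec_gp[OF m] cum_gp[OF m True] by (simp add: ref_pvec_def)
  qed auto
  moreover have "ln (1 / exp (- (real i / real m))) = real i / real m" by (simp add: ln_div)
  ultimately show ?thesis using split[OF q] B by simp
next
  case False
  moreover have "0 \<le> KL (m*m) (gp m) q" by (rule KL_nonneg[OF ref_pvec_gp[OF m] q])
  ultimately show ?thesis using B pvec_cum(4)[OF q, of i] by simp
qed

text \<open>Cells near 0 have reference mass about \<open>k / m\<close>: a large initial mass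
  forces the gap length \<open>k / m\<close> to be bounded below.\<close>

lemma KL_bound_initial:
  assumes m: "0 < m" and q: "pvec (m*m) q" and B: "KL (m*m) (gp m) q \<le> B" and k: "1 \<le> k" "k \<le> m * m"
  shows "cum q k * ln (real m / real k) \<le> B + 1"
proof -
  have "sum q {..<k} * ln (1 / (real k / real m)) \<le> KL (m*m) (gp m) q + 1"
  proof (rule KL_small_set[OF ref_pvec_gp[OF m] q])
    show "sum (gp m) {..<k} \<le> real k / real m"
      using cum_gp[OF m k(2)] exp_ge_add_one_self[of "- (real k / real m)"] by (simp add: cum_def)
  qed (use k m in auto)
  then show ?thesis using B by (simp add: cum_def)
qed

lemma sum_square_telescope:
  assumes "\<And>j. 0 \<le> q j" "a \<le> b"
  shows "(\<Sum>y=a..<b. 3 * (q y * cum q y ^ 2)) \<le> cum q b ^ 3 - cum q a ^ 3"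
  using assms(2)
proof (induction b rule: dec_induct)
  case (step n)
  have c: "0 \<le> cum q n" "0 \<le> q n" using assms cum_nonneg by auto
  have "cum q (Suc n) ^ 3 = cum q n ^ 3 + 3 * (q n * cum q n ^ 2) + (3 * q n ^ 2 * cum q n + q n ^ 3)"
    by (simp add: cum_Suc algebra_simps power3_eq_cube power2_eq_square)
  moreover have "0 \<le> 3 * q n ^ 2 * cum q n + q n ^ 3" using c by simp
  ultimately show ?case using step by simp
qed simp

text \<open>Given that one sampled point lies in cell \<open>x\<close>, no gap arises if the other three fall
  among the cells within distance \<open>k\<close> of \<open>x\<close> but are not all low; the loss is at least the cube of
  the mass of this neighbourhood. A block of \<open>k\<close> cells is contained in the neighbourhood of each of
  its members.\<close>

lemma dkap_upper_part_le:
  assumes q: "pvec J q" and k: "1 \<le> k" and s: "l \<le> s"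
  defines "u \<equiv> \<lambda>j. if l \<le> j then q j else 0"
  shows "dkap J k q u \<le> 4 * (1 - cum q l) - 4 * (cum q (s + k) - cum q s) ^ 4"
proof -
  let ?b = "cum q (s + k) - cum q s"
  have qn: "0 \<le> q j" for j using q by (simp add: pvec_def)
  have un: "0 \<le> u j" for j using qn by (simp add: u_def)
  have b0: "0 \<le> ?b" using pvec_cum(3)[OF q, of s "s+k"] by simp
  have cumu: "cum u i = (\<Sum>x\<le>J. if x < i then u x else 0)" for i
  proof -
    have "(\<Sum>x\<le>J. if x < i then u x else 0) = sum u {x\<in>{..J}. x < i}"
      by (simp only: sum.inter_filter[OF finite_atMost])
    also have "\<dots> = sum u {..<i}"
      by (rule sum.mono_neutral_left) (use q not_le_imp_less in \<open>auto simp: pvec_def u_def split: if_splits\<close>)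
    finally show ?thesis by (simp add: cum_def)
  qed
  have "(\<Sum>y\<le>J. q y * cum q (Suc y - k) ^ 2 * cum u (Suc y - k))
     = (\<Sum>y\<le>J. \<Sum>x\<le>J. (if x < Suc y - k then u x * (q y * cum q (Suc y - k) ^ 2) else 0))"
    unfolding cumu sum_distrib_left by (intro sum.cong) auto
  also have "\<dots> = (\<Sum>x\<le>J. \<Sum>y\<le>J. (if x < Suc y - k then u x * (q y * cum q (Suc y - k) ^ 2) else 0))"
    by (rule sum.swap)
  also have "\<dots> = (\<Sum>x\<le>J. u x * (\<Sum>y\<le>J. (if x + k \<le> y then q y * cum q (Suc y - k) ^ 2 else 0)))"
    unfolding sum_distrib_left by (intro sum.cong) (auto)
  finally have swap: "(\<Sum>y\<le>J. q y * cum q (Suc y - k) ^ 2 * cum u (Suc y - k))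
     = (\<Sum>x\<le>J. u x * (\<Sum>y\<le>J. (if x + k \<le> y then q y * cum q (Suc y - k) ^ 2 else 0)))" .
  have inner: "3 * (\<Sum>y\<le>J. (if x + k \<le> y then q y * cum q (Suc y - k) ^ 2 else 0)) \<le> 1 - cum q (x + k) ^ 3" for x
  proof -
    have "3 * (\<Sum>y\<le>J. (if x + k \<le> y then q y * cum q (Suc y - k) ^ 2 else 0))
        \<le> (\<Sum>y\<le>J. (if x + k \<le> y then 3 * (q y * cum q y ^ 2) else 0))"
      unfolding sum_distrib_left
      by (intro sum_mono) (use k qn pvec_cum[OF q] in \<open>auto intro!: mult_left_mono power_mono\<close>)
    also have "\<dots> = (\<Sum>y\<in>{y\<in>{..J}. x + k \<le> y}. 3 * (q y * cum q y ^ 2))"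
      by (simp only: sum.inter_filter[OF finite_atMost])
    also have "{y\<in>{..J}. x + k \<le> y} = {x+k..<Suc J}" by auto
    also have "(\<Sum>y\<in>{x+k..<Suc J}. 3 * (q y * cum q y ^ 2)) \<le> 1 - cum q (x + k) ^ 3"
    proof (cases "x + k \<le> Suc J")
      case True
      then show ?thesis using sum_square_telescope[of q "x+k" "Suc J"] qn pvec_cum(4)[OF q, of "Suc J"] by simp
    next
      case False
      then show ?thesis using pvec_cum(4)[OF q, of "x+k"] by simp
    qed
    finally show ?thesis .
  qed
  have win: "u x * (cum q (Suc x - k) ^ 3 + (1 - cum q (x + k) ^ 3))
     \<le> u x - (if s \<le> x \<and> x < s + k then q x * ?b ^ 3 else 0)" for x
  proof -
    have c: "cum q (Suc x - k) \<le> cum q (x + k)" using k by (intro pvec_cum[OF q]) auto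
    show ?thesis
    proof (cases "s \<le> x \<and> x < s + k")
      case True
      have "cum q (Suc x - k) \<le> cum q s" "cum q (s + k) \<le> cum q (x + k)"
        using True by (auto intro!: pvec_cum[OF q])
      then have "?b \<le> cum q (x + k) - cum q (Suc x - k)" by simp
      then have "?b ^ 3 \<le> (cum q (x + k) - cum q (Suc x - k)) ^ 3" using b0 by (intro power_mono) auto
      also have "\<dots> \<le> cum q (x + k) ^ 3 - cum q (Suc x - k) ^ 3"
      proof -
        have "cum q (x+k) ^ 3 - cum q (Suc x - k) ^ 3 - (cum q (x + k) - cum q (Suc x - k)) ^ 3
            = 3 * cum q (Suc x - k) * cum q (x + k) * (cum q (x + k) - cum q (Suc x - k))"
          by (simp add: algebra_simps power3_eq_cube)
        moreover have "0 \<le> \<dots>" using c pvec_cum(1)[OF q] by simp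
        ultimately show ?thesis by linarith
      qed
      finally have "q x * ?b ^ 3 \<le> q x * (cum q (x + k) ^ 3 - cum q (Suc x - k) ^ 3)"
        using qn by (intro mult_left_mono) auto
      moreover have "u x = q x" using True s by (simp add: u_def)
      ultimately show ?thesis using True by (simp add: algebra_simps)
    next
      case False
      have "cum q (Suc x - k) ^ 3 \<le> cum q (x + k) ^ 3" using c pvec_cum(1)[OF q] by (intro power_mono) auto
      then have "u x * (cum q (Suc x - k) ^ 3 + (1 - cum q (x + k) ^ 3)) \<le> u x * 1"
        using un by (intro mult_left_mono) auto
      then show ?thesis by (subst if_not_P[OF False]) simp
    qed
  qed
  have "dkap J k q u = 4 * (\<Sum>x\<le>J. u x * (cum q (Suc x - k) ^ 3 + 3 * (\<Sum>y\<le>J. (if x + k \<le> y then q y * cum q (Suc y - k) ^ 2 else 0))))"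
    unfolding dkap_def swap by (simp add: distrib_left sum.distrib sum_distrib_left mult_ac)
  also have "\<dots> \<le> 4 * (\<Sum>x\<le>J. u x * (cum q (Suc x - k) ^ 3 + (1 - cum q (x + k) ^ 3)))"
    using inner un by (intro mult_left_mono sum_mono add_left_mono) auto
  also have "\<dots> \<le> 4 * (\<Sum>x\<le>J. u x - (if s \<le> x \<and> x < s + k then q x * ?b ^ 3 else 0))"
    by (intro mult_left_mono sum_mono win) auto
  also have "\<dots> = 4 * ((\<Sum>x\<le>J. u x) - (\<Sum>x\<le>J. (if x < s + k then q x else 0) - (if x < s then q x else 0)) * ?b ^ 3)"
    unfolding sum_subtractf[symmetric] sum_distrib_right
    by (intro arg_cong[where f="\<lambda>x. 4 * x"] sum.cong) (auto simp: algebra_simps)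
  also have "(\<Sum>x\<le>J. u x) = 1 - cum q l" unfolding u_def by (rule tail_eq_sum_if[OF q])
  also have "(\<Sum>x\<le>J. (if x < s + k then q x else 0) - (if x < s then q x else 0)) = ?b"
    unfolding sum_subtractf cum_eq_sum_if[OF q, symmetric] ..
  also have "4 * ((1 - cum q l) - ?b * ?b ^ 3) = 4 * (1 - cum q l) - 4 * ?b ^ 4"
    by (simp add: power4_eq_xxxx power3_eq_cube)
  finally show ?thesis .
qed

text \<open>Pigeonhole: one of \<open>N\<close> consecutive blocks carries an average share of
  the mass.\<close>

lemma exists_heavy_block:
  fixes q :: "nat \<Rightarrow> real"
  assumes "0 < N"
  shows "\<exists>i<N. (cum q (l + N * k) - cum q l) / N \<le> cum q (l + i * k + k) - cum q (l + i * k)"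
proof (rule ccontr)
  assume "\<not> ?thesis"
  then have c: "\<And>i. i < N \<Longrightarrow> cum q (l + i * k + k) - cum q (l + i * k) < (cum q (l + N * k) - cum q l) / N"
    by (meson not_le)
  have "(\<Sum>i<N. cum q (l + i * k + k) - cum q (l + i * k)) < (\<Sum>i<N. (cum q (l + N * k) - cum q l) / N)"
    using assms c by (intro sum_strict_mono) auto
  moreover have "(\<Sum>i<N. cum q (l + Suc i * k) - cum q (l + i * k)) = cum q (l + N * k) - cum q (l + 0 * k)"
    by (rule sum_lessThan_telescope[of "\<lambda>i. cum q (l + i * k)"])
  ultimately show False using assms by (simp add: add_ac)
qed

section \<open>Raising the level at small cost\<close>

lemma dkap_add:
  "dkap J k q (\<lambda>j. a * r j + b * u j) = a * dkap J k q r + b * dkap J k q u"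
  unfolding dkap_def cum_mix by (simp add: sum.distrib sum_distrib_left algebra_simps)

lemma dkap_self: "dkap J k q q = 4 * kap J k q"
proof -
  have "(\<Sum>y\<le>J. q y * cum q (Suc y - k) ^ 2 * cum q (Suc y - k)) = (\<Sum>y\<le>J. q y * cum q (Suc y - k) ^ 3)"
    by (intro sum.cong) (auto simp: power3_eq_cube power2_eq_square)
  then show ?thesis by (simp add: dkap_def kap_def)
qed

text \<open>A point far above nearly all the mass is nearly always the maximum and creates a gap.\<close>

lemma dkap_ge_concentrated:
  assumes q: "pvec J q" and r: "pvec J r" and c: "\<And>y. r y \<noteq> 0 \<Longrightarrow> 1 - e \<le> cum q (Suc y - k)" and e: "0 \<le> e" "e \<le> 1"
  shows "4 * (1 - 3 * e) \<le> dkap J k q r"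
proof -
  have "(1 - 3 * e) * r y \<le> r y * cum q (Suc y - k) ^ 3" for y
  proof (cases "r y = 0")
    case False
    have "(1 - e)^3 \<le> cum q (Suc y - k) ^ 3" using c[OF False] e by (intro power_mono) auto
    then have "1 - 3 * e \<le> cum q (Suc y - k) ^ 3" using power3_ge_linear[of e] e by linarith
    then have "r y * (1 - 3 * e) \<le> r y * cum q (Suc y - k) ^ 3"
      using r by (intro mult_left_mono) (auto simp: pvec_def)
    then show ?thesis by (simp add: mult.commute)
  qed simp
  then have 1: "(\<Sum>y\<le>J. (1 - 3 * e) * r y) \<le> (\<Sum>y\<le>J. r y * cum q (Suc y - k) ^ 3)" by (intro sum_mono) auto
  have 2: "(\<Sum>y\<le>J. (1 - 3 * e) * r y) = 1 - 3 * e" using pvec_sum[OF r] by (simp flip: sum_distrib_left)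
  have 3: "0 \<le> (\<Sum>y\<le>J. q y * cum q (Suc y - k) ^ 2 * cum r (Suc y - k))"
    using q r by (intro sum_nonneg mult_nonneg_nonneg cum_nonneg) (auto simp: pvec_def)
  have "4 * c \<le> 4 * A + 12 * B'" if "X \<le> A" "X = c" "0 \<le> B'" for X A B' c :: real
    using that by linarith
  from this[OF 1 2 3] show ?thesis unfolding dkap_def .
qed

lemma dkap_le_16:
  assumes q: "pvec J q" and r: "pvec J r"
  shows "dkap J k q r \<le> 16"
proof -
  have t: "r y * cum q (Suc y - k) ^ 3 \<le> r y" "q y * cum q (Suc y - k) ^ 2 * cum r (Suc y - k) \<le> q y" for y
  proof -
    note c = pvec_cum(1,2)[OF q, of "Suc y - k"] pvec_cum(1,2)[OF r, of "Suc y - k"]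
    show "r y * cum q (Suc y - k) ^ 3 \<le> r y" using c r by (simp add: pvec_def mult_left_le power_le_one)
    have "cum q (Suc y - k) ^ 2 * cum r (Suc y - k) \<le> 1" using c by (simp add: mult_le_one power_le_one)
    then show "q y * cum q (Suc y - k) ^ 2 * cum r (Suc y - k) \<le> q y"
      using q by (simp add: pvec_def mult.assoc mult_left_le)
  qed
  have "(\<Sum>y\<le>J. r y * cum q (Suc y - k) ^ 3) \<le> 1"
    unfolding pvec_sum[OF r, symmetric] by (intro sum_mono t)
  moreover have "(\<Sum>y\<le>J. q y * cum q (Suc y - k) ^ 2 * cum r (Suc y - k)) \<le> 1"
    unfolding pvec_sum[OF q, symmetric] by (intro sum_mono t)
  ultimately show ?thesis unfolding dkap_def by linarith
qed

text \<open>First-order effect of a mixture on the lower excess.\<close>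

lemma mix_gain:
  assumes q: "pvec J q" and r: "pvec J r" and e: "0 \<le> e" "e \<le> 1"
    and d: "g \<le> dkap J k' q r - 4 * kap J k' q + cum r k - cum q k"
  shows "kap J k' q + cum q k + e * g - 48 * e^2
     \<le> kap J k' (\<lambda>j. (1-e) * q j + e * r j) + cum (\<lambda>j. (1-e) * q j + e * r j) k"
proof -
  have nn: "0 \<le> q j" "0 \<le> r j" for j using q r by (auto simp: pvec_def)
  have d0: "0 \<le> dkap J k' q r"
    unfolding dkap_def using nn by (intro add_nonneg_nonneg mult_nonneg_nonneg sum_nonneg zero_le_power cum_nonneg) auto
  have "(1-e)^4 * kap J k' q + e * (1-e)^3 * dkap J k' q r \<le> kap J k' (\<lambda>j. (1-e) * q j + e * r j)"
    by (rule kap_mix_ge) (use nn e in auto)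
  moreover have "(1 - 4 * e) * kap J k' q \<le> (1-e)^4 * kap J k' q"
    using power4_ge_linear[of e] kap_nonneg[OF q] by (intro mult_right_mono) auto
  moreover have "e * (1 - 3 * e) * dkap J k' q r \<le> e * (1-e)^3 * dkap J k' q r"
    using power3_ge_linear[of e] e d0 by (intro mult_right_mono mult_left_mono) auto
  moreover have "3 * e^2 * dkap J k' q r \<le> 3 * e^2 * 16"
    using dkap_le_16[OF q r] by (intro mult_left_mono) auto
  moreover have "e * g \<le> e * (dkap J k' q r - 4 * kap J k' q + cum r k - cum q k)"
    using d e by (intro mult_left_mono) auto
  ultimately show ?thesis unfolding cum_mix by (simp add: algebra_simps power2_eq_square)
qed

text \<open>A distribution far in the upper tail of the reference distribution.\<close>

lemma far_distribution:
  assumes m: "0 < m" and j0: "j0 \<le> m * m"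
  defines "r \<equiv> \<lambda>j. if j0 \<le> j then gp m j * exp (real j0 / real m) else 0"
  shows "pvec (m*m) r" "KL (m*m) (gp m) r = real j0 / real m"
proof -
  have p: "pvec (m*m) (gp m)" using ref_pvec_gp[OF m] by (simp add: ref_pvec_def)
  have "(\<Sum>j\<le>m*m. r j) = (\<Sum>j\<le>m*m. if j0 \<le> j then gp m j else 0) * exp (real j0 / real m)"
    unfolding sum_distrib_right by (intro sum.cong) (auto simp: r_def)
  also have "\<dots> = 1" unfolding tail_eq_sum_if[OF p] cum_gp[OF m j0] by (simp flip: exp_add)
  finally have s: "(\<Sum>j\<le>m*m. r j) = 1" .
  then show "pvec (m*m) r" using p by (auto simp: pvec_def r_def)
  have "KL (m*m) (gp m) r = (\<Sum>j\<le>m*m. r j * (real j0 / real m))"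
    unfolding KL_def
    by (intro sum.cong) (use gp_pos[OF m] in \<open>auto simp: r_def less_imp_neq[symmetric]\<close>)
  then show "KL (m*m) (gp m) r = real j0 / real m" by (simp only: sum_distrib_right[symmetric] s mult_1)
qed

text \<open>Mix in a little of a second distribution. If a far away point creates more gaps than
  an average one, use the far tail of the reference. Otherwise \<open>4 kap + cum\<close> is
  nearly 4, and mixing in the normalized part of \<open>q\<close> below the gap length gains at
  least a multiple of the fourth power of the mass of a heavy block, which is bounded below
  because the tails are light.\<close>

lemma perturb_down:
  fixes a1 B om :: real
  assumes a: "0 < a1" and om: "0 < om" and B: "0 \<le> B"
  shows "\<exists>\<eta>>0. \<exists>m0. \<forall>m\<ge>m0. \<forall>q k a. pvec (m*m) q \<longrightarrow> KL (m*m) (gp m) q \<le> B \<longrightarrow>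
     1 \<le> k \<longrightarrow> k \<le> m * m \<longrightarrow> a1 \<le> a \<longrightarrow> a < down_excess (m*m) k q \<longrightarrow>
     (\<exists>q'. pvec (m*m) q' \<and> KL (m*m) (gp m) q' \<le> KL (m*m) (gp m) q + om \<and> a + \<eta> < down_excess (m*m) k q')"
proof -
  define T0 where "T0 = exp (- ((B + 1) / a1))"
  define L1 where "L1 = 6 * (B + 1) / a1"
  define N where "N = nat \<lceil>L1 / T0\<rceil> + 1"
  define \<beta> where "\<beta> = a1 / (6 * real N)"
  define c where "c = 2 * \<beta>^4"
  define e0 where "e0 = min 1 (c / 48)"
  define L where "L = (B + 1) / e0 + 4 * (B + 1) / a1"
  define e1 where "e1 = min 1 (min (c / 192) (om / (L + 1)))"
  define e2 where "e2 = min (a1 / 2) (min (\<beta>^4 / 48) (a1 * om / (B + 3)))"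
  define m0 where "m0 = nat \<lceil>L\<rceil> + 2"
  define \<eta> where "\<eta> = min (e1 * c / 4) (e2 * \<beta>^4 / 2)"
  have N: "0 < N" "L1 / T0 \<le> real N" unfolding N_def by linarith+
  have T0: "0 < T0" by (simp add: T0_def)
  have \<beta>: "0 < \<beta>" using a N by (simp add: \<beta>_def)
  have c: "0 < c" using \<beta> by (simp add: c_def)
  have e0: "0 < e0" "e0 \<le> 1" "e0 \<le> c/48" using c unfolding e0_def by linarith+
  have L: "0 < L" using B e0 a by (simp add: L_def add_pos_pos)
  have "0 < om / (L + 1)" using om L by simp
  then have e1: "0 < e1" "e1 \<le> 1" "e1 \<le> c / 192" "e1 \<le> om / (L + 1)" using c unfolding e1_def by linarith+
  have e1L: "e1 * (L + 1) \<le> om" using e1(4) L by (simp add: pos_le_divide_eq)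
  have "0 < a1 * om / (B + 3)" "0 < \<beta>^4" using a om B \<beta> by simp_all
  then have e2: "0 < e2" "e2 \<le> a1/2" "e2 \<le> \<beta>^4/48" "e2 \<le> a1 * om / (B + 3)" using a unfolding e2_def by linarith+
  have \<eta>: "0 < \<eta>" "\<eta> \<le> e1 * c / 4" "\<eta> \<le> e2 * \<beta>^4 / 2"
    using e1 e2 c \<beta> by (simp_all add: \<eta>_def)
  have main: "\<exists>q'. pvec (m*m) q' \<and> KL (m*m) (gp m) q' \<le> KL (m*m) (gp m) q + om \<and> t + \<eta> < down_excess (m*m) k q'"
    if mm: "m0 \<le> m" and q: "pvec (m*m) q" and KLB: "KL (m*m) (gp m) q \<le> B"
      and k: "1 \<le> k" "k \<le> m * m" and t: "a1 \<le> t" "t < down_excess (m*m) k q" for m q k t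
  proof -
    let ?J = "m * m" and ?F = "cum q k"
    define k1 where "k1 = k + 1"
    have k1: "1 \<le> k1" "k \<le> k1" "real k \<le> real k1" by (auto simp: k1_def)
    have mL: "L + 1 \<le> real m" "0 < m" using mm L unfolding m0_def by linarith+
    have p: "ref_pvec ?J (gp m)" by (rule ref_pvec_gp[OF mL(2)])
    define K where "K = kap ?J k1 q"
    have K: "K \<le> 1" "K \<le> 4 * (1 - cum q k1)" "K \<le> 4 * (1 - ?F)"
    proof -
      show "K \<le> 1" unfolding K_def by (rule kap_le_1[OF q k1(1)])
      show 1: "K \<le> 4 * (1 - cum q k1)" unfolding K_def by (rule kap_le_tail[OF q])
      have "?F \<le> cum q k1" by (rule pvec_cum(3)[OF q k1(2)])
      then show "K \<le> 4 * (1 - ?F)" using 1 by (simp add: algebra_simps)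
    qed
    have F: "?F \<le> 1" "a1 < ?F" "a1 / 3 < 1 - ?F" "a1 < K" "t < K + ?F - 1"
      using pvec_cum(2)[OF q, of k] t K by (simp_all add: down_excess_def K_def k1_def)
    show ?thesis
    proof (cases "c \<le> 4 - 4 * K - ?F")
      case True
      \<comment> \<open>Points far above everything else create a gap almost surely.\<close>
      define j0 where "j0 = nat \<lceil>real m * L\<rceil>"
      have j0: "real m * L \<le> real j0" "real j0 \<le> real m * L + 1" unfolding j0_def using mL L by auto
      have "real j0 \<le> real m * (L + 1)" using j0 mL by (simp add: algebra_simps)
      also have "\<dots> \<le> real m * real m" using mL by (intro mult_left_mono) auto
      finally have j0J: "j0 \<le> ?J" by (metis of_nat_le_iff of_nat_mult)
      define r where "r = (\<lambda>j. if j0 \<le> j then gp m j * exp (real j0 / real m) else 0)"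
      note r = far_distribution[OF mL(2) j0J, folded r_def]
      have kt: "real k1 / real m \<le> 4 * (B + 1) / a1"
      proof -
        have "a1 / 4 * (real k1 / real m) \<le> (1 - cum q k1) * (real k1 / real m)"
          using K F by (intro mult_right_mono) auto
        also have "\<dots> \<le> B + 1" by (rule KL_bound_tail[OF mL(2) q KLB])
        finally show ?thesis using a by (simp add: field_simps)
      qed
      have far: "1 - e0 \<le> cum q (Suc y - k1)" if "r y \<noteq> 0" for y
      proof -
        have y: "j0 \<le> y" using that by (simp add: r_def split: if_splits)
        let ?i = "Suc y - k1"
        have "real m * ((B + 1) / e0) \<le> real ?i"
        proof -
          have "real j0 - real k1 \<le> real ?i" using y by linarith
          moreover have "real k1 \<le> real m * (4 * (B + 1) / a1)" using kt mL by (simp add: field_simps)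
          ultimately show ?thesis using j0 by (simp add: L_def algebra_simps)
        qed
        then have "(B + 1) / e0 \<le> real ?i / real m" using mL by (simp add: field_simps)
        then have "(1 - cum q ?i) * ((B + 1) / e0) \<le> (1 - cum q ?i) * (real ?i / real m)"
          using pvec_cum(2)[OF q, of ?i] by (intro mult_left_mono) auto
        also have "\<dots> \<le> B + 1" by (rule KL_bound_tail[OF mL(2) q KLB])
        finally have "(1 - cum q ?i) * (B + 1) \<le> e0 * (B + 1)" using e0 by (simp add: field_simps)
        then show ?thesis using B by simp
      qed
      have "4 * (1 - 3 * e0) \<le> dkap ?J k1 q r"
        by (rule dkap_ge_concentrated[OF q r(1) far]) (use e0 in auto)
      then have dk: "4 - 12 * e0 \<le> dkap ?J k1 q r" by (simp add: algebra_simps)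
      have rk: "0 \<le> cum r k" by (rule pvec_cum(1)[OF r(1)])
      have "3 / 4 * c \<le> dkap ?J k1 q r - 4 * kap ?J k1 q + cum r k - cum q k"
        using dk True rk e0 unfolding K_def by linarith
      note G = mix_gain[OF q r(1) _ _ this, of e1]
      have "48 * e1^2 \<le> e1 * (c / 4)"
        using mult_left_mono[OF e1(3), of "48 * e1"] e1 by (simp add: power2_eq_square)
      then have gain: "K + ?F + e1 * c / 2 \<le> kap ?J k1 (\<lambda>j. (1-e1) * q j + e1 * r j) + cum (\<lambda>j. (1-e1) * q j + e1 * r j) k"
        using G e1 by (simp add: K_def)
      show ?thesis
      proof (intro exI conjI)
        let ?q = "\<lambda>j. (1-e1) * q j + e1 * r j"
        show "pvec ?J ?q" by (rule pvec_mix[OF q r(1)]) (use e1 in auto)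
        have "KL ?J (gp m) ?q \<le> (1-e1) * KL ?J (gp m) q + e1 * KL ?J (gp m) r"
          by (rule KL_convex[OF p q r(1)]) (use e1 in auto)
        also have "(1-e1) * KL ?J (gp m) q \<le> KL ?J (gp m) q"
          using e1 KL_nonneg[OF p q] by (simp add: mult_left_le_one_le)
        also have "e1 * KL ?J (gp m) r \<le> e1 * (L + 1)"
        proof (rule mult_left_mono)
          have "real j0 \<le> real m * (L + 1)" using j0 mL by (simp add: algebra_simps)
          then show "KL ?J (gp m) r \<le> L + 1" unfolding r(2) using mL by (simp add: field_simps)
        qed (use e1 in auto)
        finally show "KL ?J (gp m) ?q \<le> KL ?J (gp m) q + om" using e1L by linarith
        have "0 < e1 * c" using e1 c by simp
        then show "t + \<eta> < down_excess ?J k ?q" using gain F(5) \<eta> unfolding down_excess_def k1_def[symmetric] by linarith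
      qed
    next
      case False
      \<comment> \<open>Otherwise almost every point above \<open>k\<close> would have to create a gap, which a heavy block prevents.\<close>
      have kT: "T0 \<le> real k / real m"
      proof -
        have l: "?F * ln (real m / real k) \<le> B + 1" by (rule KL_bound_initial[OF mL(2) q KLB k])
        have "ln (real m / real k) \<le> (B + 1) / a1"
        proof (cases "ln (real m / real k) \<le> 0")
          case True then show ?thesis using a B by (meson add_nonneg_nonneg divide_nonneg_pos order_trans zero_le_one)
        next
          case False
          then have "a1 * ln (real m / real k) \<le> ?F * ln (real m / real k)" using F by (intro mult_right_mono) auto
          then show ?thesis using l a by (simp add: pos_le_divide_eq mult.commute)
        qed
        then have "- ((B + 1) / a1) \<le> - ln (real m / real k)" by simp
        also have "\<dots> = ln (real k / real m)" using k mL by (simp add: ln_div)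
        finally show ?thesis using k mL unfolding T0_def by (metis divide_pos_pos exp_le_cancel_iff exp_ln of_nat_0_less_iff less_le_trans zero_less_one)
      qed
      have tail: "1 - cum q (k + N * k1) \<le> a1 / 6"
      proof -
        let ?i = "k + N * k1"
        have "L1 \<le> real N * T0" using N T0 by (simp add: field_simps)
        also have "\<dots> \<le> real N * (real k / real m)" using kT by (intro mult_left_mono) auto
        also have "\<dots> \<le> real N * (real k1 / real m)"
          using k1 by (intro mult_left_mono divide_right_mono) auto
        also have "\<dots> \<le> real ?i / real m" using mL by (simp add: divide_right_mono)
        finally have "(1 - cum q ?i) * L1 \<le> (1 - cum q ?i) * (real ?i / real m)"
          using pvec_cum(2)[OF q, of ?i] by (intro mult_left_mono) auto
        also have "\<dots> \<le> B + 1" by (rule KL_bound_tail[OF mL(2) q KLB])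
        finally have "(1 - cum q ?i) * (B + 1) \<le> (a1 / 6) * (B + 1)" using a by (simp add: L1_def field_simps)
        then show ?thesis using B by simp
      qed
      obtain i where i: "(cum q (k + N * k1) - ?F) / N \<le> cum q (k + i * k1 + k1) - cum q (k + i * k1)"
        using exists_heavy_block[OF N(1)] by blast
      let ?s = "k + i * k1"
      have "\<beta> \<le> (cum q (k + N * k1) - ?F) / N"
        using tail F N by (simp add: \<beta>_def field_simps)
      then have block: "\<beta> \<le> cum q (?s + k1) - cum q ?s" using i by simp
      define u where "u = (\<lambda>j. if k \<le> j then q j else 0)"
      define r where "r = (\<lambda>j. if j < k then q j / ?F else 0)"
      have F0: "0 < ?F" using F a by linarith
      have "dkap ?J k1 q u \<le> 4 * (1 - ?F) - 4 * (cum q (?s + k1) - cum q ?s) ^ 4"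
        unfolding u_def by (rule dkap_upper_part_le[OF q k1(1)]) simp
      also have "\<dots> \<le> 4 * (1 - ?F) - 4 * \<beta>^4"
        using block \<beta> by (intro diff_left_mono mult_left_mono power_mono) auto
      finally have du: "dkap ?J k1 q u \<le> 4 * (1 - ?F) - 2 * c" by (simp add: c_def)
      have "(\<lambda>j. ?F * r j + 1 * u j) = q" using F0 by (auto simp: r_def u_def)
      then have "?F * dkap ?J k1 q r + dkap ?J k1 q u = 4 * K"
        using dkap_add[of ?J k1 q ?F r 1 u] dkap_self[of ?J k1 q] by (simp add: K_def)
      then have dr: "4 * K - 4 * (1 - ?F) + 2 * c \<le> ?F * dkap ?J k1 q r" using du by linarith
      have rs: "pvec ?J r"
      proof -
        have "(\<Sum>j\<le>?J. r j) = (\<Sum>j\<le>?J. if j < k then q j else 0) / ?F"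
          unfolding sum_divide_distrib by (intro sum.cong) (auto simp: r_def)
        then have "(\<Sum>j\<le>?J. r j) = 1" unfolding cum_eq_sum_if[OF q, symmetric] using F0 by simp
        then show ?thesis using q F0 by (auto simp: pvec_def r_def)
      qed
      have rk: "cum r k = 1"
      proof -
        have "cum r k = (\<Sum>j<k. q j / ?F)" unfolding cum_def by (intro sum.cong) (auto simp: r_def cum_def)
        also have "\<dots> = ?F / ?F" by (simp only: sum_divide_distrib[symmetric] cum_def)
        finally show ?thesis using F0 by simp
      qed
      have "c \<le> ?F * (dkap ?J k1 q r - 4 * K + 1 - ?F)"
      proof -
        have "(1 - ?F) * (4 - 4 * K - ?F) \<le> c"
        proof (cases "0 \<le> 4 - 4 * K - ?F")
          case True
          then have "(1 - ?F) * (4 - 4 * K - ?F) \<le> 1 * (4 - 4 * K - ?F)" using F F0 by (intro mult_right_mono) auto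
          then show ?thesis using False by simp
        next
          case False
          then have "(1 - ?F) * (4 - 4 * K - ?F) \<le> 0" using F by (intro mult_nonneg_nonpos) auto
          then show ?thesis using c by linarith
        qed
        then show ?thesis using dr by (simp add: algebra_simps)
      qed
      then have "0 < dkap ?J k1 q r - 4 * K + 1 - ?F" using c F0 by (smt (verit) mult_nonneg_nonpos)
      then have "?F * (dkap ?J k1 q r - 4 * K + 1 - ?F) \<le> dkap ?J k1 q r - 4 * K + 1 - ?F"
        using F F0 by (simp add: mult_left_le_one_le)
      then have "c \<le> dkap ?J k1 q r - 4 * kap ?J k1 q + cum r k - ?F"
        using \<open>c \<le> ?F * (dkap ?J k1 q r - 4 * K + 1 - ?F)\<close> rk by (simp add: K_def)
      note G = mix_gain[OF q rs _ _ this, of e2]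
      have e21: "e2 \<le> 1" using e2 F by linarith
      have "48 * e2^2 \<le> e2 * \<beta>^4"
        using mult_left_mono[OF e2(3), of "48 * e2"] e2 by (simp add: power2_eq_square)
      then have gain: "K + ?F + e2 * \<beta>^4 \<le> kap ?J k1 (\<lambda>j. (1-e2) * q j + e2 * r j) + cum (\<lambda>j. (1-e2) * q j + e2 * r j) k"
        using G e2 e21 by (simp add: K_def c_def)
      define w where "w = (\<lambda>j. if j < k then 1 - e2 + e2 / ?F else 1 - e2)"
      have wq: "(\<lambda>j. (1-e2) * q j + e2 * r j) = (\<lambda>j. w j * q j)"
        by (auto simp: w_def r_def algebra_simps)
      have pv: "pvec ?J (\<lambda>j. w j * q j)" unfolding wq[symmetric] by (rule pvec_mix[OF q rs]) (use e2 e21 in auto)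
      have e2F: "e2 \<le> e2 / ?F" using e2 F F0 by (simp add: pos_le_divide_eq mult_left_le)
      have e2a: "e2 / ?F \<le> e2 / a1" using e2 F a by (intro divide_left_mono) auto
      have wv: "\<bar>w j - 1\<bar> \<le> e2 / a1" for j using e2F e2a e2 by (auto simp: w_def)
      have v1: "e2 / a1 < 1" using e2 a by (simp add: field_simps)
      show ?thesis
      proof (intro exI conjI)
        show "pvec ?J (\<lambda>j. w j * q j)" by (rule pv)
        have "KL ?J (gp m) (\<lambda>j. w j * q j) \<le> KL ?J (gp m) q + e2 / a1 * (KL ?J (gp m) q + 3)"
          by (rule KL_reweight[OF p q pv wv v1])
        also have "e2 / a1 * (KL ?J (gp m) q + 3) \<le> e2 / a1 * (B + 3)"
          using e2 a KLB by (intro mult_left_mono) auto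
        also have "\<dots> \<le> om" using e2(4) a B by (simp add: field_simps)
        finally show "KL ?J (gp m) (\<lambda>j. w j * q j) \<le> KL ?J (gp m) q + om" by simp
        have "0 < e2 * \<beta>^4" using e2 \<beta> by simp
        then show "t + \<eta> < down_excess ?J k (\<lambda>j. w j * q j)"
          using gain F(5) \<eta> unfolding down_excess_def k1_def[symmetric] wq by linarith
      qed
    qed
  qed
  show ?thesis
  proof (rule exI[of _ \<eta>], rule conjI[OF \<eta>(1)], rule exI[of _ m0], intro allI impI)
    fix m q k t
    assume "m0 \<le> m" "pvec (m*m) q" "KL (m*m) (gp m) q \<le> B" "1 \<le> k" "k \<le> m * m" "a1 \<le> t" "t < down_excess (m*m) k q"
    then show "\<exists>q'. pvec (m*m) q' \<and> KL (m*m) (gp m) q' \<le> KL (m*m) (gp m) q + om \<and> t + \<eta> < down_excess (m*m) k q'"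
      by (rule main)
  qed
qed

text \<open>The disjunction over \<open>k\<close> stands for the supremum over \<open>t\<close>,
  the one over the two excesses for the absolute value.\<close>

definition feas :: "nat \<Rightarrow> real \<Rightarrow> (nat \<Rightarrow> real) \<Rightarrow> bool" where
  "feas m a q \<longleftrightarrow> pvec (m*m) q \<and> (\<exists>k. 1 \<le> k \<and> k \<le> m * m \<and> (a < up_excess (m*m) k q \<or> a < down_excess (m*m) k q))"

lemma eventually_small_cells:
  assumes d: "0 < d" and B: "0 \<le> B"
  shows "\<exists>m0>1. \<forall>m\<ge>m0. \<forall>q. pvec (m*m) q \<longrightarrow> KL (m*m) (gp m) q \<le> B \<longrightarrow> (\<forall>j. q j \<le> d)"
proof -
  define m0 where "m0 = nat \<lceil>exp ((B + 1) / d)\<rceil> + 2"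
  have "q j \<le> d" if m: "m0 \<le> m" and q: "pvec (m*m) q" "KL (m*m) (gp m) q \<le> B" for m q j
  proof -
    have "exp ((B + 1) / d) \<le> real m" using m unfolding m0_def by linarith
    then have l: "(B + 1) / d \<le> ln (real m)" using m by (simp add: ln_ge_iff m0_def)
    have "0 < m" using m by (simp add: m0_def)
    then have "q j * ln (real m) \<le> B + 1" by (rule KL_bound_cell[OF _ q])
    moreover have "q j * ((B + 1) / d) \<le> q j * ln (real m)"
      using l pvec_nonneg[OF q(1)] by (intro mult_left_mono) auto
    ultimately have "q j * ((B + 1) / d) \<le> B + 1" by linarith
    then have "q j * (B + 1) \<le> d * (B + 1)" using d by (simp add: field_simps)
    then show ?thesis using B by simp
  qed
  then show ?thesis by (intro exI[of _ m0]) (auto simp: m0_def)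
qed

text \<open>On fine grids the level that a distribution reaches can be raised at little cost.\<close>

lemma perturb_level:
  fixes a1 a2 B om :: real
  assumes a: "0 < a1" "a1 \<le> a2" "a2 < 1" and om: "0 < om" and B: "0 \<le> B"
  shows "\<exists>\<eta>>0. \<exists>m0. \<forall>m\<ge>m0. \<forall>q a. a1 \<le> a \<longrightarrow> a \<le> a2 \<longrightarrow> feas m a q \<longrightarrow> KL (m*m) (gp m) q \<le> B \<longrightarrow>
     (\<exists>q'. feas m (a + \<eta>) q' \<and> KL (m*m) (gp m) q' \<le> KL (m*m) (gp m) q + om)"
proof -
  obtain \<eta>1 \<delta> where 1: "0 < \<eta>1" "0 < \<delta>" "\<And>J p q k a. ref_pvec J p \<Longrightarrow> pvec J q \<Longrightarrow> KL J p q \<le> B \<Longrightarrow> (\<And>j. q j \<le> \<delta>) \<Longrightarrow>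
     1 \<le> k \<Longrightarrow> k \<le> J \<Longrightarrow> a1 \<le> a \<Longrightarrow> a \<le> a2 \<Longrightarrow> a < up_excess J k q \<Longrightarrow>
     (\<exists>q'. pvec J q' \<and> KL J p q' \<le> KL J p q + om \<and> a + \<eta>1 < up_excess J k q')"
    using perturb_up[OF assms] by metis
  obtain \<eta>2 m2 where 2: "0 < \<eta>2" "\<And>m q k a. m2 \<le> m \<Longrightarrow> pvec (m*m) q \<Longrightarrow> KL (m*m) (gp m) q \<le> B \<Longrightarrow>
     1 \<le> k \<Longrightarrow> k \<le> m * m \<Longrightarrow> a1 \<le> a \<Longrightarrow> a < down_excess (m*m) k q \<Longrightarrow>
     (\<exists>q'. pvec (m*m) q' \<and> KL (m*m) (gp m) q' \<le> KL (m*m) (gp m) q + om \<and> a + \<eta>2 < down_excess (m*m) k q')"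
    using perturb_down[OF a(1) om B] by metis
  obtain m3 where 3: "1 < m3" "\<And>m q j. m3 \<le> m \<Longrightarrow> pvec (m*m) q \<Longrightarrow> KL (m*m) (gp m) q \<le> B \<Longrightarrow> q j \<le> \<delta>"
    using eventually_small_cells[OF 1(2) B] by metis
  define \<eta> where "\<eta> = min \<eta>1 \<eta>2"
  have \<eta>: "0 < \<eta>" "\<eta> \<le> \<eta>1" "\<eta> \<le> \<eta>2" using 1 2 by (simp_all add: \<eta>_def)
  have main: "\<exists>q'. feas m (t + \<eta>) q' \<and> KL (m*m) (gp m) q' \<le> KL (m*m) (gp m) q + om"
    if m: "max m2 m3 \<le> m" and t: "a1 \<le> t" "t \<le> a2" and f: "feas m t q" and KLB: "KL (m*m) (gp m) q \<le> B" for m q t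
  proof -
    have m': "m2 \<le> m" "m3 \<le> m" "0 < m" using m 3(1) by auto
    obtain k where q: "pvec (m*m) q" and k: "1 \<le> k" "k \<le> m * m" and e: "t < up_excess (m*m) k q \<or> t < down_excess (m*m) k q"
      using f by (auto simp: feas_def)
    show ?thesis using e
    proof
      assume "t < up_excess (m*m) k q"
      then obtain q' where q': "pvec (m*m) q'" "KL (m*m) (gp m) q' \<le> KL (m*m) (gp m) q + om" "t + \<eta>1 < up_excess (m*m) k q'"
        using 1(3)[OF ref_pvec_gp[OF m'(3)] q KLB 3(2)[OF m'(2) q KLB] k t] by blast
      then have "t + \<eta> < up_excess (m*m) k q'" using \<eta> by linarith
      then show ?thesis using q' k by (auto simp: feas_def)
    next
      assume "t < down_excess (m*m) k q"
      then obtain q' where q': "pvec (m*m) q'" "KL (m*m) (gp m) q' \<le> KL (m*m) (gp m) q + om" "t + \<eta>2 < down_excess (m*m) k q'"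
        using 2(2)[OF m'(1) q KLB k t(1)] by blast
      then have "t + \<eta> < down_excess (m*m) k q'" using \<eta> by linarith
      then show ?thesis using q' k by (auto simp: feas_def)
    qed
  qed
  show ?thesis
    by (rule exI[of _ \<eta>], rule conjI[OF \<eta>(1)], rule exI[of _ "max m2 m3"], intro allI impI, rule main)
qed

section \<open>The statistic as a function of counts\<close>

text \<open>With ties, any choice of a largest and a second largest index gives the same two
  values.\<close>

lemma order_stat_top_two:
  assumes S: "finite S" "card S = 4" and y: "y \<in> S" "\<forall>i\<in>S. x i \<le> x y"
    and z: "z \<in> S" "z \<noteq> y" "\<forall>i\<in>S. i \<noteq> y \<longrightarrow> x i \<le> x z"
  shows "order_stat 4 S x = x y" "order_stat 3 S x = x z"
proof -
  define R where "R = S - {y, z}"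
  define l where "l = sorted_list_of_multiset (image_mset x (mset_set R))"
  have R: "finite R" "card R = 2" "S = insert y (insert z R)" "y \<notin> insert z R" "z \<notin> R"
    using S y(1) z(1,2) by (auto simp: R_def card_Diff_subset)
  have ms: "mset l = image_mset x (mset_set R)" by (simp add: l_def)
  have len: "length l = 2" using arg_cong[OF ms, of size] R by simp
  have "set l = x ` R" using arg_cong[OF ms, of set_mset] R by simp
  then have le: "\<And>a. a \<in> set l \<Longrightarrow> a \<le> x z" using z(3) by (auto simp: R_def)
  have "mset (l @ [x z, x y]) = image_mset x (mset_set S)" using ms R by simp
  moreover have "sorted (l @ [x z, x y])"
    using le bspec[OF y(2) z(1)] by (auto simp: sorted_append l_def intro: order_trans)
  ultimately have "sorted_list_of_multiset (image_mset x (mset_set S)) = l @ [x z, x y]"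
    using sorted_sort_id[of "l @ [x z, x y]"] sorted_list_of_multiset_mset[of "l @ [x z, x y]"] by simp
  then show "order_stat 4 S x = x y" "order_stat 3 S x = x z"
    using len by (simp_all add: order_stat_def nth_append)
qed

lemma exists_top_two:
  fixes x :: "nat \<Rightarrow> real"
  assumes S: "finite S" "card S = 4"
  shows "\<exists>y z. y \<in> S \<and> (\<forall>i\<in>S. x i \<le> x y) \<and> z \<in> S \<and> z \<noteq> y \<and> (\<forall>i\<in>S. i \<noteq> y \<longrightarrow> x i \<le> x z)"
proof -
  have ex: "\<exists>y\<in>A. \<forall>i\<in>A. x i \<le> x y" if "finite A" "A \<noteq> {}" for A
  proof -
    have "Max (x ` A) \<in> x ` A" using that by (intro Max_in) auto
    then obtain y where "y \<in> A" "Max (x ` A) = x y" by blast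
    moreover have "x i \<le> Max (x ` A)" if "i \<in> A" for i using \<open>finite A\<close> that by (intro Max_ge) auto
    ultimately show ?thesis by auto
  qed
  have "S \<noteq> {}" using S by auto
  then obtain y where y: "y \<in> S" "\<forall>i\<in>S. x i \<le> x y" using ex[of S] S by auto
  have "card (S - {y}) = 3" using S y by simp
  then have "S - {y} \<noteq> {}" by (metis card.empty zero_neq_numeral)
  then obtain z where "z \<in> S - {y}" "\<forall>i\<in>S - {y}. x i \<le> x z" using ex[of "S - {y}"] S by auto
  with y show ?thesis by (intro exI[of _ y] exI[of _ z]) auto
qed

lemma four_subset: "S \<subseteq> {1..n} \<and> card S = 4 \<Longrightarrow> finite S" for S :: "nat set"
  by (auto intro: finite_subset)

lemma H_emp_bounds: "0 \<le> H_emp n x t" "H_emp n x t \<le> 1"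
proof -
  let ?A = "{S. S \<subseteq> {1..n} \<and> card S = 4}"
  have c: "real (card ?A) = real (n choose 4)" using n_subsets[of "{1..n}" 4] by simp
  have "(\<Sum>S\<in>?A. of_bool (order_stat 4 S x / order_stat 3 S x < t)) \<le> (\<Sum>S\<in>?A. 1 :: real)"
    by (intro sum_mono) auto
  then have "(\<Sum>S\<in>?A. of_bool (order_stat 4 S x / order_stat 3 S x < t)) \<le> real (n choose 4)"
    using c by simp
  then show "H_emp n x t \<le> 1" unfolding H_emp_def by (intro divide_le_eq_1[THEN iffD2]) (auto simp: zero_less_binomial_iff not_less)
  show "0 \<le> H_emp n x t" unfolding H_emp_def by (intro divide_nonneg_nonneg sum_nonneg) auto
qed

lemma F_emp_bounds: "0 \<le> F_emp n x t" "F_emp n x t \<le> 1"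
proof -
  have "(\<Sum>i = 1..n. of_bool (x i < t)) \<le> (\<Sum>i = 1..n. 1 :: real)" by (intro sum_mono) auto
  then have "(\<Sum>i = 1..n. of_bool (x i < t)) \<le> real n" by simp
  then show "F_emp n x t \<le> 1" unfolding F_emp_def by (intro divide_le_eq_1[THEN iffD2]) auto
  show "0 \<le> F_emp n x t" unfolding F_emp_def by (intro divide_nonneg_nonneg sum_nonneg) auto
qed

text \<open>The supremum of a bounded family exceeds \<open>a\<close> iff a member does;
  boundedness is what makes the conditionally complete supremum behave.\<close>

lemma D_stat_gt_iff: "a < D_stat n x \<longleftrightarrow> (\<exists>t\<ge>1. a < \<bar>H_emp n x t - F_emp n x t\<bar>)"
proof -
  have "bdd_above ((\<lambda>t. \<bar>H_emp n x t - F_emp n x t\<bar>) ` {1..})"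
  proof (rule bdd_aboveI[of _ 1])
    fix b assume "b \<in> (\<lambda>t. \<bar>H_emp n x t - F_emp n x t\<bar>) ` {1..}"
    then obtain t where "b = \<bar>H_emp n x t - F_emp n x t\<bar>" by auto
    then show "b \<le> 1" using H_emp_bounds[of n x t] F_emp_bounds[of n x t] by auto
  qed
  then show ?thesis unfolding D_stat_def by (subst less_cSUP_iff) auto
qed

lemma D_stat_le_1: "\<not> 1 < D_stat n x"
proof
  assume "1 < D_stat n x"
  then obtain t where "1 < \<bar>H_emp n x t - F_emp n x t\<bar>" by (auto simp: D_stat_gt_iff)
  then show False using H_emp_bounds[of n x t] F_emp_bounds[of n x t] by linarith
qed

text \<open>\<open>H\<close> and \<open>F\<close> are left-continuous step functions, so their supremum is a countable one.\<close>

lemma D_stat_gt_iff_rational: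
  "a < D_stat n x \<longleftrightarrow> (\<exists>t\<in>{t\<in>\<rat>. 1 \<le> t}. a < \<bar>H_emp n x t - F_emp n x t\<bar>)"
proof
  assume "a < D_stat n x"
  then obtain t where t: "1 \<le> t" "a < \<bar>H_emp n x t - F_emp n x t\<bar>" by (auto simp: D_stat_gt_iff)
  show "\<exists>t\<in>{t\<in>\<rat>. 1 \<le> t}. a < \<bar>H_emp n x t - F_emp n x t\<bar>"
  proof (cases "t = 1")
    case False
    define V where "V = x ` {1..n} \<union> (\<lambda>S. order_stat 4 S x / order_stat 3 S x) ` {S. S \<subseteq> {1..n} \<and> card S = 4}"
    define b where "b = Max (insert 1 {v\<in>V. v < t})"
    have V: "finite V" unfolding V_def by (auto intro: finite_subset[of _ "Pow {1..n}"])
    then have fin: "finite (insert 1 {v\<in>V. v < t})" by simp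
    have "b \<in> insert 1 {v\<in>V. v < t}" unfolding b_def by (rule Max_in[OF fin]) simp
    then have "b < t" using t False by auto
    then obtain s where s: "s \<in> \<rat>" "b < s" "s < t" using Rats_dense_in_real by blast
    have "1 \<le> b" unfolding b_def by (rule Max_ge[OF fin]) simp
    have eq: "v < s \<longleftrightarrow> v < t" if "v \<in> V" for v
    proof
      assume "v < t"
      then have "v \<le> b" unfolding b_def using that by (intro Max_ge[OF fin]) simp
      then show "v < s" using s by simp
    qed (use s in simp)
    have "H_emp n x s = H_emp n x t" unfolding H_emp_def
      by (intro arg_cong2[where f="(/)"] sum.cong refl arg_cong[where f=of_bool] eq) (auto simp: V_def)
    moreover have "F_emp n x s = F_emp n x t" unfolding F_emp_def
      by (intro arg_cong2[where f="(/)"] sum.cong refl arg_cong[where f=of_bool] eq) (auto simp: V_def)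
    ultimately show ?thesis using t s \<open>1 \<le> b\<close> by (intro bexI[of _ s]) auto
  qed (use t in auto)
qed (auto simp: D_stat_gt_iff)

lemma D_stat_measurable:
  assumes X: "\<And>i. 1 \<le> i \<Longrightarrow> X i \<in> borel_measurable M"
  shows "{\<omega> \<in> space M. a < D_stat n (\<lambda>i. X i \<omega>)} \<in> sets M"
proof -
  have ratio: "{\<omega> \<in> space M. order_stat 4 S (\<lambda>i. X i \<omega>) / order_stat 3 S (\<lambda>i. X i \<omega>) < t} \<in> sets M"
    if S: "S \<subseteq> {1..n} \<and> card S = 4" for S t
  proof -
    have fin: "finite S" using S by (rule four_subset)
    let ?E = "\<lambda>y z. {\<omega> \<in> space M. (\<forall>i\<in>S. X i \<omega> \<le> X y \<omega>) \<and> (\<forall>i\<in>S-{y}. X i \<omega> \<le> X z \<omega>) \<and> X y \<omega> / X z \<omega> < t}"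
    have "{\<omega> \<in> space M. order_stat 4 S (\<lambda>i. X i \<omega>) / order_stat 3 S (\<lambda>i. X i \<omega>) < t} = (\<Union>y\<in>S. \<Union>z\<in>S-{y}. ?E y z)"
    proof (intro set_eqI iffI)
      fix \<omega> assume w: "\<omega> \<in> {\<omega> \<in> space M. order_stat 4 S (\<lambda>i. X i \<omega>) / order_stat 3 S (\<lambda>i. X i \<omega>) < t}"
      obtain y z where yz: "y \<in> S" "\<forall>i\<in>S. X i \<omega> \<le> X y \<omega>" "z \<in> S" "z \<noteq> y"
        "\<forall>i\<in>S. i \<noteq> y \<longrightarrow> X i \<omega> \<le> X z \<omega>"
        using exists_top_two[OF fin conjunct2[OF S], of "\<lambda>i. X i \<omega>"] by blast
      have "order_stat 4 S (\<lambda>i. X i \<omega>) = X y \<omega>" "order_stat 3 S (\<lambda>i. X i \<omega>) = X z \<omega>"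
        using order_stat_top_two[of S y "\<lambda>i. X i \<omega>" z] S fin yz by simp_all
      then have "\<omega> \<in> ?E y z" using w yz by simp
      then show "\<omega> \<in> (\<Union>y\<in>S. \<Union>z\<in>S-{y}. ?E y z)" using yz by blast
    next
      fix \<omega> assume "\<omega> \<in> (\<Union>y\<in>S. \<Union>z\<in>S-{y}. ?E y z)"
      then obtain y z where yz: "y \<in> S" "z \<in> S - {y}" and w: "\<omega> \<in> ?E y z" by blast
      have "order_stat 4 S (\<lambda>i. X i \<omega>) = X y \<omega>" "order_stat 3 S (\<lambda>i. X i \<omega>) = X z \<omega>"
        using order_stat_top_two[of S y "\<lambda>i. X i \<omega>" z] S fin yz w by simp_all
      then show "\<omega> \<in> {\<omega> \<in> space M. order_stat 4 S (\<lambda>i. X i \<omega>) / order_stat 3 S (\<lambda>i. X i \<omega>) < t}"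
        using w by simp
    qed
    moreover have "?E y z \<in> sets M" if "y \<in> S" "z \<in> S - {y}" for y z
    proof -
      have m: "X i \<in> borel_measurable M" if "i \<in> S" for i using S that X by auto
      show ?thesis using that fin
        by (intro sets.sets_Collect_conj sets.sets_Collect_finite_All borel_measurable_le borel_measurable_less
            borel_measurable_divide borel_measurable_const m) auto
    qed
    ultimately show ?thesis using fin by (auto intro!: sets.finite_UN)
  qed
  have H: "(\<lambda>\<omega>. H_emp n (\<lambda>i. X i \<omega>) t) \<in> borel_measurable M" for t
    unfolding H_emp_def of_bool_def
    by (intro borel_measurable_divide borel_measurable_sum measurable_If ratio) (auto)
  have F: "(\<lambda>\<omega>. F_emp n (\<lambda>i. X i \<omega>) t) \<in> borel_measurable M" for t
    unfolding F_emp_def of_bool_def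
    by (intro borel_measurable_divide borel_measurable_sum measurable_If borel_measurable_less X) (auto)
  have "{\<omega> \<in> space M. a < D_stat n (\<lambda>i. X i \<omega>)}
     = (\<Union>t\<in>{t\<in>\<rat>. 1 \<le> t}. {\<omega> \<in> space M. a < \<bar>H_emp n (\<lambda>i. X i \<omega>) t - F_emp n (\<lambda>i. X i \<omega>) t\<bar>})"
    unfolding D_stat_gt_iff_rational by auto
  also have "\<dots> \<in> sets M"
  proof (rule sets.countable_UN'')
    show "countable {t\<in>\<rat>. 1 \<le> (t::real)}" by (rule countable_subset[OF _ countable_rat]) auto
    show "{\<omega> \<in> space M. a < \<bar>H_emp n (\<lambda>i. X i \<omega>) t - F_emp n (\<lambda>i. X i \<omega>) t\<bar>} \<in> sets M" for t
      by (intro borel_measurable_less borel_measurable_const borel_measurable_abs borel_measurable_diff H F)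
  qed
  finally show ?thesis .
qed

text \<open>A 4-subset whose top two members have ratio at least \<open>t\<close> is its maximum \<open>y\<close> together with
  three indices whose values are at most \<open>x y / t\<close>.\<close>

lemma H_emp_eq:
  assumes x: "\<And>i. i \<in> {1..n} \<Longrightarrow> 0 < x i" and t: "1 < t" and n: "4 \<le> n"
  shows "H_emp n x t = 1 - (\<Sum>y=1..n. real (card {i\<in>{1..n}. x i * t \<le> x y} choose 3)) / real (n choose 4)"
proof -
  let ?A = "{S. S \<subseteq> {1..n} \<and> card S = 4}"
  let ?lt = "\<lambda>S. order_stat 4 S x / order_stat 3 S x < t"
  define B where "B = (\<lambda>y. {i\<in>{1..n}. x i * t \<le> x y})"
  define G where "G = (\<lambda>y. insert y ` {A. A \<subseteq> B y \<and> card A = 3})"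
  have finA: "finite ?A" by (rule finite_subset[of _ "Pow {1..n}"]) auto
  have finB: "finite (B y)" for y by (simp add: B_def)
  have Bless: "x i < x y" if "i \<in> B y" for i y
  proof -
    have "x i * 1 < x i * t" using that x t by (intro mult_strict_left_mono) (auto simp: B_def)
    then show ?thesis using that by (simp add: B_def)
  qed
  have yB: "y \<notin> B y" for y using Bless[of y y] by auto
  have eq: "{S\<in>?A. \<not> ?lt S} = (\<Union>y\<in>{1..n}. G y)"
  proof (intro set_eqI iffI)
    fix S assume S: "S \<in> {S\<in>?A. \<not> ?lt S}"
    then have fin: "finite S" and S': "S \<subseteq> {1..n}" "card S = 4" by (auto intro: finite_subset)
    obtain y z where yz: "y \<in> S" "\<forall>i\<in>S. x i \<le> x y" "z \<in> S" "z \<noteq> y"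
        "\<forall>i\<in>S. i \<noteq> y \<longrightarrow> x i \<le> x z"
      using exists_top_two[OF fin S'(2), of x] by blast
    have "order_stat 4 S x = x y" "order_stat 3 S x = x z"
      using order_stat_top_two[of S y x z] fin S' yz by simp_all
    then have "t \<le> x y / x z" using S by simp
    moreover have "0 < x z" using x yz(3) S' by auto
    ultimately have zt: "x z * t \<le> x y" by (simp add: pos_le_divide_eq mult.commute)
    have "i \<in> B y" if "i \<in> S - {y}" for i
    proof -
      have "x i * t \<le> x z * t" using yz(5) that t by (intro mult_right_mono) auto
      then show ?thesis using zt that S' by (auto simp: B_def)
    qed
    then have "S - {y} \<subseteq> B y" "card (S - {y}) = 3" using S' fin yz by auto
    then have "insert y (S - {y}) \<in> G y" unfolding G_def by blast
    then show "S \<in> (\<Union>y\<in>{1..n}. G y)" using yz(1) S' by (auto simp: insert_absorb)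
  next
    fix S assume "S \<in> (\<Union>y\<in>{1..n}. G y)"
    then obtain y A where y: "y \<in> {1..n}" "A \<subseteq> B y" "card A = 3" "S = insert y A" by (auto simp: G_def)
    have finA': "finite A" using y(2) finB finite_subset by blast
    have yA: "y \<notin> A" using y yB by auto
    have S: "finite S" "card S = 4" "S \<subseteq> {1..n}" using y finA' yA by (auto simp: B_def)
    have top: "\<forall>i\<in>S. x i \<le> x y" using y Bless by (auto intro: less_imp_le)
    have "A \<noteq> {}" using y by auto
    then have "Max (x ` A) \<in> x ` A" using finA' by (intro Max_in) auto
    then obtain z where zM: "z \<in> A" "Max (x ` A) = x z" by blast
    have z: "z \<in> A" "\<And>i. i \<in> A \<Longrightarrow> x i \<le> x z"
      unfolding zM(2)[symmetric] using finA' zM(1) by (auto intro: Max_ge)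
    have "y \<in> S" "z \<in> S" "z \<noteq> y" "\<forall>i\<in>S. i \<noteq> y \<longrightarrow> x i \<le> x z" using y z yA by auto
    then have "order_stat 4 S x = x y" "order_stat 3 S x = x z"
      using order_stat_top_two[of S y x z] S top by simp_all
    moreover have "x z * t \<le> x y" "0 < x z" using z y x by (auto simp: B_def)
    ultimately have "\<not> ?lt S" by (simp add: pos_divide_less_eq not_less mult.commute)
    then show "S \<in> {S\<in>?A. \<not> ?lt S}" using S by auto
  qed
  have inj: "inj_on (insert y) {A. A \<subseteq> B y \<and> card A = 3}" for y
  proof (rule inj_onI)
    fix A A' assume A: "A \<in> {A. A \<subseteq> B y \<and> card A = 3}" "A' \<in> {A. A \<subseteq> B y \<and> card A = 3}" "insert y A = insert y A'"
    then have "y \<notin> A" "y \<notin> A'" using yB[of y] by auto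
    then show "A = A'" using A(3) by (simp add: insert_ident)
  qed
  have cG: "card (G y) = card (B y) choose 3" for y
    unfolding G_def by (subst card_image[OF inj]) (simp add: n_subsets finB)
  have disj: "G y \<inter> G y' = {}" if "y \<noteq> y'" for y y'
  proof (rule ccontr)
    assume "G y \<inter> G y' \<noteq> {}"
    then obtain S where S: "S \<in> G y" "S \<in> G y'" by auto
    then obtain A where A: "A \<subseteq> B y" "S = insert y A" unfolding G_def by blast
    obtain A' where A': "A' \<subseteq> B y'" "S = insert y' A'" using S(2) unfolding G_def by blast
    have "y' \<in> S" unfolding A'(2) by simp
    then have 1: "y' \<in> A" using that unfolding A(2) by simp
    have "y \<in> S" unfolding A(2) by simp
    then have 2: "y \<in> A'" using that unfolding A'(2) by simp
    then have "x y' < x y" "x y < x y'" using A(1) A'(1) Bless 1 2 by auto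
    then show False by simp
  qed
  have finG: "finite (G y)" for y unfolding G_def
    by (rule finite_imageI, rule finite_subset[of _ "Pow (B y)"]) (auto simp: finB)
  have "card {S\<in>?A. \<not> ?lt S} = (\<Sum>y=1..n. card (G y))"
    unfolding eq by (rule card_UN_disjoint) (simp_all add: disj finG)
  then have bad: "card {S\<in>?A. \<not> ?lt S} = (\<Sum>y=1..n. card (B y) choose 3)" by (simp only: cG)
  have "(\<Sum>S\<in>?A. of_bool (?lt S) :: real) = (\<Sum>S\<in>?A. 1 - (if \<not> ?lt S then 1 else 0))"
    by (intro sum.cong refl) (simp only: of_bool_def split: if_split, simp)
  also have "\<dots> = real (card ?A) - (\<Sum>S\<in>?A. if \<not> ?lt S then 1 else 0)"
    by (simp only: sum_subtractf sum_constant mult_1_right)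
  also have "(\<Sum>S\<in>?A. if \<not> ?lt S then 1 else 0) = (\<Sum>S\<in>{S\<in>?A. \<not> ?lt S}. 1 :: real)"
    by (rule sum.inter_filter[OF finA, symmetric])
  also have "\<dots> = real (card {S\<in>?A. \<not> ?lt S})" by simp
  also have "card ?A = n choose 4" using n_subsets[of "{1..n}" 4] by simp
  finally have "(\<Sum>S\<in>?A. of_bool (?lt S) :: real) = real (n choose 4) - (\<Sum>y=1..n. real (card (B y) choose 3))"
    by (simp only: bad of_nat_sum)
  moreover have "0 < real (n choose 4)" using n by simp
  ultimately show ?thesis unfolding H_emp_def B_def by (simp add: diff_divide_distrib)
qed

lemma H_emp_at_1:
  assumes x: "\<And>i. i \<in> {1..n} \<Longrightarrow> 0 < x i"
  shows "H_emp n x 1 = 0"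
proof -
  have "\<not> order_stat 4 S x / order_stat 3 S x < 1" if S: "S \<subseteq> {1..n} \<and> card S = 4" for S
  proof -
    have fin: "finite S" using S by (rule four_subset)
    obtain y z where yz: "y \<in> S" "\<forall>i\<in>S. x i \<le> x y" "z \<in> S" "z \<noteq> y"
        "\<forall>i\<in>S. i \<noteq> y \<longrightarrow> x i \<le> x z"
      using exists_top_two[OF fin conjunct2[OF S], of x] by blast
    have "order_stat 4 S x = x y" "order_stat 3 S x = x z"
      using order_stat_top_two[of S y x z] fin S yz by simp_all
    moreover have "0 < x z" using yz(3) S x by auto
    ultimately show ?thesis using bspec[OF yz(2) yz(3)] by simp
  qed
  then show ?thesis unfolding H_emp_def by (simp add: sum.neutral)
qed

lemma choose3: "real (N choose 3) = real N * (real N - 1) * (real N - 2) / 6"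
proof (induction N)
  case (Suc N)
  have 2: "real (N choose 2) = real N * (real N - 1) / 2"
    by (induction N) (auto simp: numeral_2_eq_2 field_simps)
  have "Suc N choose 3 = (N choose 2) + (N choose 3)" by (simp add: numeral_3_eq_3 numeral_2_eq_2)
  then show ?case using Suc 2 by (simp add: field_simps)
qed simp

lemma choose4: "real (N choose 4) = real N * (real N - 1) * (real N - 2) * (real N - 3) / 24"
proof (induction N)
  case (Suc N)
  have "Suc N choose 4 = (N choose 3) + (N choose 4)" by (simp add: eval_nat_numeral)
  then show ?case using Suc choose3[of N] by (simp add: field_simps)
qed simp

text \<open>Sampling without replacement agrees with sampling with replacement up to order \<open>1 / n\<close>.\<close>

lemma choose_ratio_approx:
  assumes n: "12 \<le> n" and N: "N \<le> n"
  shows "\<bar>real (N choose 3) / real (n choose 4) - 4 / n * (N / n) ^ 3\<bar> \<le> 48 / n^2"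
proof -
  define a where "a = real N"
  define b where "b = real n"
  have ab: "0 \<le> a" "a \<le> b" "12 \<le> b" using n N by (auto simp: a_def b_def)
  define d where "d = (b - 1) * (b - 2) * (b - 3)"
  have d: "0 < d" "d \<le> b^3" "b^3 - 6 * b^2 \<le> d"
    using ab by (auto simp: d_def power3_eq_cube power2_eq_square intro!: mult_mono) (auto simp: algebra_simps)
  have e: "real (N choose 3) / real (n choose 4) = 4 / b * (a * (a - 1) * (a - 2) / d)"
  proof -
    have "p / 6 / (b * w / 24) = 4 / b * (p / w)" for p w :: real
      using ab by (cases "w = 0") (auto simp: field_simps)
    from this[of "a * (a - 1) * (a - 2)" d] show ?thesis
      unfolding choose3 choose4 a_def[symmetric] b_def[symmetric] d_def by (simp only: mult.assoc)
  qed
  have nn: "0 \<le> a * (a - 1) * (a - 2)"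
    using of_nat_0_le_iff[of "N choose 3", where 'a=real] unfolding choose3 a_def by linarith
  have "(a/b)^3 - 3 / b \<le> a * (a - 1) * (a - 2) / d"
  proof -
    have "a^3 - 3 * b^2 \<le> a * (a - 1) * (a - 2)"
    proof -
      have "a * a \<le> b * b" using ab by (intro mult_mono) auto
      then show ?thesis using ab by (simp add: algebra_simps power3_eq_cube power2_eq_square)
    qed
    then have "(a^3 - 3 * b^2) / b^3 \<le> a * (a - 1) * (a - 2) / b^3" using ab by (intro divide_right_mono) auto
    also have "\<dots> \<le> a * (a - 1) * (a - 2) / d" using nn d ab by (intro divide_left_mono) auto
    also have "(a^3 - 3 * b^2) / b^3 = (a/b)^3 - 3/b" using ab by (simp add: field_simps power3_eq_cube power2_eq_square)
    finally show ?thesis .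
  qed
  moreover have "a * (a - 1) * (a - 2) / d \<le> (a/b)^3 + 12 / b"
  proof -
    have a3: "a^3 \<le> b^3" using ab by (intro power_mono) auto
    have "a * (a - 1) * (a - 2) \<le> a^3"
    proof (cases "a < 1")
      case True
      then have "a = 0" by (simp add: a_def)
      then show ?thesis by simp
    next
      case False
      have "a * (a-1) * (a - 2) \<le> a * (a-1) * a" using False by (intro mult_left_mono) auto
      also have "\<dots> \<le> a * a * a" using False by (intro mult_mono) auto
      finally show ?thesis by (simp add: power3_eq_cube)
    qed
    moreover have "a^3 \<le> ((a/b)^3 + 12/b) * d"
    proof -
      have "((a/b)^3 + 12/b) * (b^3 - 6 * b^2) = a^3 - 6 * (a^3/b) + 12 * b^2 - 72 * b"
        using ab by (simp add: field_simps power3_eq_cube power2_eq_square)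
      moreover have "a^3 / b \<le> b^2" using a3 ab by (simp add: field_simps power3_eq_cube power2_eq_square)
      moreover have "72 * b \<le> 6 * b^2" using ab by (simp add: power2_eq_square)
      ultimately have "a^3 \<le> ((a/b)^3 + 12/b) * (b^3 - 6 * b^2)" by linarith
      also have "\<dots> \<le> ((a/b)^3 + 12/b) * d" using d ab by (intro mult_left_mono) auto
      finally show ?thesis .
    qed
    ultimately have "a * (a - 1) * (a - 2) \<le> ((a/b)^3 + 12/b) * d" by linarith
    then show ?thesis using d by (simp add: pos_divide_le_eq)
  qed
  moreover have "3 / b \<le> 12 / b" using ab by (intro divide_right_mono) auto
  ultimately have "\<bar>a * (a - 1) * (a - 2) / d - (a/b)^3\<bar> \<le> 12 / b" by linarith
  then have "4 / b * \<bar>a * (a - 1) * (a - 2) / d - (a/b)^3\<bar> \<le> 4 / b * (12 / b)" using ab by (intro mult_left_mono) auto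
  moreover have "\<bar>4 / b * (a * (a - 1) * (a - 2) / d) - 4 / b * (a/b)^3\<bar> = 4 / b * \<bar>a * (a - 1) * (a - 2) / d - (a/b)^3\<bar>"
  proof -
    have "\<bar>c * u - c * v\<bar> = c * \<bar>u - v\<bar>" if "0 \<le> c" for c u v :: real
      by (metis abs_mult abs_of_nonneg right_diff_distrib that)
    moreover have "0 \<le> 4 / b" using ab by simp
    ultimately show ?thesis by blast
  qed
  ultimately show ?thesis unfolding e a_def[symmetric] b_def[symmetric] by (simp add: power2_eq_square)
qed

section \<open>Binning the sample\<close>

text \<open>The last cell \<open>m * m\<close> collects everything beyond \<open>m\<close>.\<close>

definition cell :: "nat \<Rightarrow> real \<Rightarrow> nat" where
  "cell m v = min (m * m) (nat \<lfloor>real m * v\<rfloor>)"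

definition freq :: "nat \<Rightarrow> (nat \<Rightarrow> nat) \<Rightarrow> nat \<Rightarrow> real" where
  "freq n c j = real (card {i\<in>{1..n}. c i = j}) / real n"

text \<open>The fraction of 4-subsets with a gap of length at least \<open>T\<close>, counted by
  the three indices below the largest one.\<close>

definition gap_mass :: "nat \<Rightarrow> (nat \<Rightarrow> real) \<Rightarrow> real \<Rightarrow> real" where
  "gap_mass n v T = (\<Sum>y=1..n. real (card {i\<in>{1..n}. v i + T \<le> v y} choose 3)) / real (n choose 4)"

lemma cell_le: "cell m v \<le> m * m" by (simp add: cell_def)

lemma cell_less_iff:
  assumes "0 < m" "0 \<le> v" "k \<le> m * m"
  shows "cell m v < k \<longleftrightarrow> v < real k / real m"
proof -
  have "cell m v < k \<longleftrightarrow> nat \<lfloor>real m * v\<rfloor> < k" using assms by (auto simp: cell_def)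
  also have "\<dots> \<longleftrightarrow> \<lfloor>real m * v\<rfloor> < int k" using assms by (simp add: nat_less_iff)
  also have "\<dots> \<longleftrightarrow> real m * v < real k" by (simp add: floor_less_iff)
  also have "\<dots> \<longleftrightarrow> v < real k / real m" using assms by (simp add: field_simps)
  finally show ?thesis .
qed

lemma gap_imp_cells:
  assumes m: "0 < m" and v: "0 \<le> v" "v + T \<le> w" and T: "real k / real m \<le> T" and c: "cell m w < m * m"
  shows "cell m v < Suc (cell m w) - k"
proof -
  have "real m * v + real k \<le> real m * w"
  proof -
    have "v + real k / real m \<le> w" using v T by linarith
    then have "real m * (v + real k / real m) \<le> real m * w" using m by (intro mult_left_mono) auto
    then show ?thesis using m by (simp add: distrib_left)
  qed
  then have "\<lfloor>real m * v\<rfloor> + int k \<le> \<lfloor>real m * w\<rfloor>" by linarith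
  moreover have "0 \<le> \<lfloor>real m * v\<rfloor>" using v m by simp
  ultimately have "nat \<lfloor>real m * v\<rfloor> + k \<le> nat \<lfloor>real m * w\<rfloor>" by linarith
  moreover have "cell m w = nat \<lfloor>real m * w\<rfloor>" using c by (auto simp: cell_def)
  moreover have "cell m v \<le> nat \<lfloor>real m * v\<rfloor>" by (simp add: cell_def)
  ultimately show ?thesis by linarith
qed

lemma cells_imp_gap:
  assumes m: "0 < m" and v: "0 \<le> v" "0 \<le> w" and T: "T \<le> real k / real m" and c: "cell m v < Suc (cell m w) - (k + 1)"
  shows "v + T \<le> w"
proof -
  have "cell m v < m * m" using c cell_le[of m w] by linarith
  then have "cell m v = nat \<lfloor>real m * v\<rfloor>" by (auto simp: cell_def)
  moreover have "cell m w \<le> nat \<lfloor>real m * w\<rfloor>" by (simp add: cell_def)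
  ultimately have "nat \<lfloor>real m * v\<rfloor> + k + 1 \<le> nat \<lfloor>real m * w\<rfloor>" using c by linarith
  moreover have "0 \<le> \<lfloor>real m * v\<rfloor>" "0 \<le> \<lfloor>real m * w\<rfloor>" using v m by simp_all
  ultimately have "\<lfloor>real m * v\<rfloor> + int k + 1 \<le> \<lfloor>real m * w\<rfloor>" by linarith
  then have "real m * v + real k \<le> real m * w" by linarith
  then have "real m * v + real m * T \<le> real m * w"
    using mult_left_mono[OF T, of "real m"] m by simp
  then have "real m * (v + T) \<le> real m * w" by (simp add: distrib_left)
  then show ?thesis using m by simp
qed

lemma sum_freq:
  assumes c: "\<And>i. i \<in> {1..n} \<Longrightarrow> c i \<le> J"
  shows "(\<Sum>j\<le>J. freq n c j * g j) = (\<Sum>i=1..n. g (c i)) / real n"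
proof -
  have "(\<Sum>i=1..n. g (c i)) = (\<Sum>i=1..n. \<Sum>j\<le>J. if c i = j then g j else 0)"
    by (intro sum.cong refl) (use c in simp)
  also have "\<dots> = (\<Sum>j\<le>J. \<Sum>i=1..n. if c i = j then g j else 0)" by (rule sum.swap)
  also have "\<dots> = (\<Sum>j\<le>J. real (card {i\<in>{1..n}. c i = j}) * g j)"
  proof (intro sum.cong refl)
    fix j
    have "(\<Sum>i=1..n. if c i = j then g j else 0) = (\<Sum>i\<in>{i\<in>{1..n}. c i = j}. g j)"
      by (rule sum.inter_filter[symmetric]) simp
    then show "(\<Sum>i=1..n. if c i = j then g j else 0) = real (card {i\<in>{1..n}. c i = j}) * g j" by simp
  qed
  finally show ?thesis by (simp add: freq_def sum_divide_distrib)
qed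

lemma freq_pvec:
  assumes n: "0 < n" and c: "\<And>i. i \<in> {1..n} \<Longrightarrow> c i \<le> J"
  shows "pvec J (freq n c)"
proof -
  have "(\<Sum>j\<le>J. freq n c j) = 1" using sum_freq[OF c, where g="\<lambda>_. 1"] n by simp
  moreover have "freq n c j = 0" if "J < j" for j
  proof -
    have "{i\<in>{1..n}. c i = j} = {}" using c that by fastforce
    then show ?thesis by (simp add: freq_def)
  qed
  ultimately show ?thesis by (simp add: pvec_def) (simp add: freq_def)
qed

lemma cum_freq: "cum (freq n c) j = real (card {i\<in>{1..n}. c i < j}) / real n"
proof (induction j)
  case (Suc j)
  have "{i\<in>{1..n}. c i < Suc j} = {i\<in>{1..n}. c i < j} \<union> {i\<in>{1..n}. c i = j}" by auto
  then have "card {i\<in>{1..n}. c i < Suc j} = card {i\<in>{1..n}. c i < j} + card {i\<in>{1..n}. c i = j}"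
    by (simp only:) (rule card_Un_disjoint, auto)
  then show ?case using Suc by (simp add: cum_Suc freq_def add_divide_distrib)
qed simp

lemma kap_freq:
  assumes c: "\<And>i. i \<in> {1..n} \<Longrightarrow> c i \<le> J"
  shows "kap J k (freq n c) = (\<Sum>y=1..n. 4 / real n * cum (freq n c) (Suc (c y) - k) ^ 3)"
proof -
  have "(\<Sum>y\<le>J. freq n c y * cum (freq n c) (Suc y - k) ^ 3) = (\<Sum>y=1..n. cum (freq n c) (Suc (c y) - k) ^ 3) / real n"
    by (rule sum_freq) (rule c)
  then show ?thesis unfolding kap_def by (simp add: sum_distrib_left sum_divide_distrib)
qed

lemma gap_mass_ge:
  assumes n: "12 \<le> n" and c: "\<And>i. i \<in> {1..n} \<Longrightarrow> c i \<le> J"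
    and b: "\<And>y. y \<in> {1..n} \<Longrightarrow> {i\<in>{1..n}. c i < Suc (c y) - k} \<subseteq> {i\<in>{1..n}. v i + T \<le> v y}"
  shows "kap J k (freq n c) - 48 / n \<le> gap_mass n v T"
proof -
  let ?N = "\<lambda>y. card {i\<in>{1..n}. v i + T \<le> v y}"
  have "4 / n * cum (freq n c) (Suc (c y) - k) ^ 3 - 48 / (real n)^2 \<le> real (?N y choose 3) / real (n choose 4)" if "y \<in> {1..n}" for y
  proof -
    have "?N y \<le> card {1..n}" by (intro card_mono) auto
    then have N: "?N y \<le> n" by simp
    have "card {i\<in>{1..n}. c i < Suc (c y) - k} \<le> ?N y" by (intro card_mono b that) auto
    then have "cum (freq n c) (Suc (c y) - k) \<le> ?N y / n" unfolding cum_freq by (intro divide_right_mono) auto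
    then have "cum (freq n c) (Suc (c y) - k) ^ 3 \<le> (?N y / n) ^ 3"
      by (intro power_mono) (simp_all add: cum_freq)
    then have "4 / n * cum (freq n c) (Suc (c y) - k) ^ 3 \<le> 4 / n * (?N y / n) ^ 3" by (intro mult_left_mono) auto
    then show ?thesis using choose_ratio_approx[OF n N] by linarith
  qed
  then have "(\<Sum>y=1..n. 4 / n * cum (freq n c) (Suc (c y) - k) ^ 3 - 48 / (real n)^2) \<le> gap_mass n v T"
    unfolding gap_mass_def sum_divide_distrib by (rule sum_mono)
  moreover have "(\<Sum>y=1..n. 48 / (real n)^2) = 48 / n" using n by (simp add: power2_eq_square)
  moreover have "kap J k (freq n c) = (\<Sum>y=1..n. 4 / real n * cum (freq n c) (Suc (c y) - k) ^ 3)"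
    by (rule kap_freq) (rule c)
  ultimately show ?thesis unfolding sum_subtractf by linarith
qed

lemma gap_mass_le:
  assumes n: "12 \<le> n" and c: "\<And>i. i \<in> {1..n} \<Longrightarrow> c i \<le> J"
    and b: "\<And>y. y \<in> {1..n} \<Longrightarrow> c y < J \<Longrightarrow> {i\<in>{1..n}. v i + T \<le> v y} \<subseteq> {i\<in>{1..n}. c i < Suc (c y) - k}"
  shows "gap_mass n v T \<le> kap J k (freq n c) + 4 * freq n c J + 48 / n"
proof -
  let ?N = "\<lambda>y. card {i\<in>{1..n}. v i + T \<le> v y}"
  let ?top = "\<lambda>j. if j = J then 1 else 0 :: real"
  have "real (?N y choose 3) / real (n choose 4) \<le> 4 / n * cum (freq n c) (Suc (c y) - k) ^ 3 + 4 / n * ?top (c y) + 48 / (real n)^2"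
    if y: "y \<in> {1..n}" for y
  proof -
    have "?N y \<le> card {1..n}" by (intro card_mono) auto
    then have N: "?N y \<le> n" by simp
    have "(?N y / n) ^ 3 \<le> cum (freq n c) (Suc (c y) - k) ^ 3 + ?top (c y)"
    proof (cases "c y < J")
      case True
      have "?N y \<le> card {i\<in>{1..n}. c i < Suc (c y) - k}" by (intro card_mono b y True) auto
      then have "?N y / n \<le> cum (freq n c) (Suc (c y) - k)" unfolding cum_freq by (intro divide_right_mono) auto
      then have "(?N y / n) ^ 3 \<le> cum (freq n c) (Suc (c y) - k) ^ 3" by (intro power_mono) auto
      then show ?thesis using True by simp
    next
      case False
      then have "?top (c y) = 1" using c[OF y] by simp
      moreover have "(?N y / n) ^ 3 \<le> 1" using N n by (intro power_le_one) auto
      moreover have "0 \<le> cum (freq n c) (Suc (c y) - k) ^ 3" by (simp add: cum_freq)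
      ultimately show ?thesis by linarith
    qed
    then have "4 / n * (?N y / n) ^ 3 \<le> 4 / n * (cum (freq n c) (Suc (c y) - k) ^ 3 + ?top (c y))" by (intro mult_left_mono) auto
    then show ?thesis using choose_ratio_approx[OF n N] by (simp add: distrib_left)
  qed
  then have "gap_mass n v T \<le> (\<Sum>y=1..n. 4 / n * cum (freq n c) (Suc (c y) - k) ^ 3 + 4 / n * ?top (c y) + 48 / (real n)^2)"
    unfolding gap_mass_def sum_divide_distrib by (rule sum_mono)
  moreover have "(\<Sum>y=1..n. 48 / (real n)^2) = 48 / n" using n by (simp add: power2_eq_square)
  moreover have "(\<Sum>y=1..n. 4 / n * ?top (c y)) = 4 * freq n c J"
  proof -
    have "(\<Sum>y=1..n. 4 / n * ?top (c y)) = 4 * ((\<Sum>y=1..n. ?top (c y)) / n)"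
      unfolding sum_divide_distrib sum_distrib_left by (intro sum.cong) auto
    also have "(\<Sum>y=1..n. ?top (c y)) / n = (\<Sum>j\<le>J. freq n c j * ?top j)" by (rule sum_freq[OF c, symmetric])
    also have "\<dots> = (\<Sum>j\<le>J. if j = J then freq n c j else 0)" by (intro sum.cong) auto
    also have "\<dots> = freq n c J" by simp
    finally show ?thesis .
  qed
  moreover have "kap J k (freq n c) = (\<Sum>y=1..n. 4 / real n * cum (freq n c) (Suc (c y) - k) ^ 3)"
    by (rule kap_freq) (rule c)
  ultimately show ?thesis unfolding sum.distrib by linarith
qed

text \<open>Passing from \<open>k\<close> to \<open>k + 1\<close> moves one cell in each factor,
  and the cells carry mass at most \<open>d\<close>.\<close>

lemma kap_shift_le:
  assumes q: "pvec J q" and d: "\<And>j. q j \<le> d"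
  shows "kap J k q \<le> kap J (k + 1) q + 12 * d"
proof -
  have d0: "0 \<le> d" using d[of 0] pvec_nonneg[OF q, of 0] by linarith
  have "q y * cum q (Suc y - k) ^ 3 \<le> q y * cum q (Suc y - (k+1)) ^ 3 + q y * (3 * d)" for y
  proof -
    let ?a = "cum q (Suc y - k)" and ?b = "cum q (Suc y - (k+1))"
    have ab: "0 \<le> ?b" "?b \<le> ?a" "?a \<le> 1" by (auto intro: pvec_cum[OF q])
    have "?a \<le> ?b + d"
    proof (cases "k \<le> y")
      case True
      then have "Suc y - k = Suc (Suc y - (k+1))" by simp
      then show ?thesis using d[of "Suc y - (k+1)"] by (simp add: cum_Suc)
    next
      case False then show ?thesis using d0 by simp
    qed
    have "?a^3 - ?b^3 = (?a - ?b) * (?a * ?a + ?a * ?b + ?b * ?b)" by (simp add: algebra_simps power3_eq_cube)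
    also have "\<dots> \<le> d * 3"
    proof (rule mult_mono)
      have "?a * ?a \<le> 1" "?a * ?b \<le> 1" "?b * ?b \<le> 1" using ab by (auto intro!: mult_le_one)
      then show "?a * ?a + ?a * ?b + ?b * ?b \<le> 3" by linarith
    qed (use \<open>?a \<le> ?b + d\<close> ab d0 in auto)
    finally have "?a^3 \<le> ?b^3 + 3 * d" by simp
    then have "q y * ?a^3 \<le> q y * (?b^3 + 3 * d)" using pvec_nonneg[OF q] by (intro mult_left_mono) auto
    then show ?thesis by (simp add: distrib_left)
  qed
  then have "(\<Sum>y\<le>J. q y * cum q (Suc y - k) ^ 3) \<le> (\<Sum>y\<le>J. q y * cum q (Suc y - (k+1)) ^ 3 + q y * (3 * d))"
    by (intro sum_mono) auto
  also have "\<dots> = (\<Sum>y\<le>J. q y * cum q (Suc y - (k+1)) ^ 3) + 3 * d"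
    using pvec_sum[OF q] by (simp add: sum.distrib flip: sum_distrib_right)
  finally show ?thesis unfolding kap_def by (simp add: algebra_simps)
qed

context
  fixes n m :: nat and x v :: "nat \<Rightarrow> real" and lam :: real and q :: "nat \<Rightarrow> real"
  assumes n: "12 \<le> n" and m: "0 < m" and lam: "0 < lam"
    and x: "\<And>i. i \<in> {1..n} \<Longrightarrow> 1 \<le> x i"
    and v: "v = (\<lambda>i. lam * ln (x i))"
    and q: "q = freq n (\<lambda>i. cell m (v i))"
begin

lemma v_nonneg: "i \<in> {1..n} \<Longrightarrow> 0 \<le> v i"
  using x[of i] lam by (simp add: v)

lemma q_pvec: "pvec (m * m) q"
  unfolding q by (rule freq_pvec) (use n cell_le in auto)

lemma H_emp_gap_mass:
  assumes t: "1 < t" shows "H_emp n x t = 1 - gap_mass n v (lam * ln t)"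
proof -
  have "x i * t \<le> x y \<longleftrightarrow> v i + lam * ln t \<le> v y" if "i \<in> {1..n}" "y \<in> {1..n}" for i y
  proof -
    have p: "0 < x i" "0 < x y" "0 < t" using x[OF that(1)] x[OF that(2)] t by linarith+
    have "x i * t \<le> x y \<longleftrightarrow> ln (x i * t) \<le> ln (x y)" using p by simp
    also have "\<dots> \<longleftrightarrow> ln (x i) + ln t \<le> ln (x y)" using p by (simp add: ln_mult)
    also have "\<dots> \<longleftrightarrow> lam * (ln (x i) + ln t) \<le> lam * ln (x y)" using lam by simp
    finally show ?thesis by (simp add: v distrib_left)
  qed
  then have "(\<Sum>y=1..n. real (card {i\<in>{1..n}. x i * t \<le> x y} choose 3))
      = (\<Sum>y=1..n. real (card {i\<in>{1..n}. v i + lam * ln t \<le> v y} choose 3))"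
    by (intro sum.cong refl arg_cong[where f="\<lambda>A. real (card A choose 3)"]) auto
  moreover have "0 < x i" if "i \<in> {1..n}" for i using x[OF that] by linarith
  ultimately show ?thesis using H_emp_eq[of n x t] t n by (simp add: gap_mass_def)
qed

lemma F_emp_count:
  assumes t: "0 < t" shows "F_emp n x t = real (card {i\<in>{1..n}. v i < lam * ln t}) / n"
proof -
  have "x i < t \<longleftrightarrow> v i < lam * ln t" if "i \<in> {1..n}" for i
  proof -
    have p: "0 < x i" using x[OF that] by linarith
    have "x i < t \<longleftrightarrow> ln (x i) < ln t" using p t by simp
    then show ?thesis using lam by (simp add: v)
  qed
  then have "(\<Sum>i=1..n. of_bool (x i < t)) = (\<Sum>i=1..n. if v i < lam * ln t then 1 else 0 :: real)"
    by (intro sum.cong) auto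
  also have "\<dots> = (\<Sum>i\<in>{i\<in>{1..n}. v i < lam * ln t}. 1)" by (rule sum.inter_filter[symmetric]) simp
  finally show ?thesis by (simp add: F_emp_def)
qed

lemma F_emp_grid:
  assumes t: "0 < t" and k: "k \<le> m * m" and T: "lam * ln t = real k / real m"
  shows "F_emp n x t = cum q k"
proof -
  have "{i\<in>{1..n}. v i < real k / real m} = {i\<in>{1..n}. cell m (v i) < k}"
    using cell_less_iff[OF m v_nonneg k] by auto
  then show ?thesis unfolding F_emp_count[OF t] T q cum_freq by simp
qed

lemma F_emp_ge:
  assumes t: "0 < t" and k: "k \<le> m * m" and T: "real k / real m \<le> lam * ln t"
  shows "cum q k \<le> F_emp n x t"
proof -
  have "{i\<in>{1..n}. cell m (v i) < k} \<subseteq> {i\<in>{1..n}. v i < lam * ln t}"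
    using cell_less_iff[OF m v_nonneg k] T by fastforce
  then have "card {i\<in>{1..n}. cell m (v i) < k} \<le> card {i\<in>{1..n}. v i < lam * ln t}" by (intro card_mono) auto
  then show ?thesis unfolding F_emp_count[OF t] q cum_freq by (intro divide_right_mono) auto
qed

lemma F_emp_le:
  assumes t: "0 < t" and k: "k \<le> m * m" and T: "lam * ln t \<le> real k / real m"
  shows "F_emp n x t \<le> cum q k"
proof -
  have "{i\<in>{1..n}. v i < lam * ln t} \<subseteq> {i\<in>{1..n}. cell m (v i) < k}"
    using cell_less_iff[OF m v_nonneg k] T by fastforce
  then have "card {i\<in>{1..n}. v i < lam * ln t} \<le> card {i\<in>{1..n}. cell m (v i) < k}" by (intro card_mono) auto
  then show ?thesis unfolding F_emp_count[OF t] q cum_freq by (intro divide_right_mono) auto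
qed

lemma gap_mass_cells_ge:
  assumes "T \<le> real k / real m" shows "kap (m*m) (k+1) q - 48 / n \<le> gap_mass n v T"
  unfolding q
proof (rule gap_mass_ge[OF n])
  fix y assume y: "y \<in> {1..n}"
  show "{i\<in>{1..n}. cell m (v i) < Suc (cell m (v y)) - (k+1)} \<subseteq> {i\<in>{1..n}. v i + T \<le> v y}"
    using cells_imp_gap[OF m v_nonneg v_nonneg[OF y] assms] by auto
qed (rule cell_le)

lemma gap_mass_cells_le:
  assumes "real k / real m \<le> T" shows "gap_mass n v T \<le> kap (m*m) k q + 4 * q (m*m) + 48 / n"
  unfolding q
proof (rule gap_mass_le[OF n])
  fix y assume y: "y \<in> {1..n}" "cell m (v y) < m * m"
  show "{i\<in>{1..n}. v i + T \<le> v y} \<subseteq> {i\<in>{1..n}. cell m (v i) < Suc (cell m (v y)) - k}"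
    using gap_imp_cells[OF m v_nonneg _ assms y(2)] by auto
qed (rule cell_le)

lemma excess_imp_D_stat:
  assumes k: "1 \<le> k" "k \<le> m * m"
    and a: "a + 48 / n < up_excess (m*m) k q \<or> a + 48 / n < down_excess (m*m) k q"
  shows "a < D_stat n x"
proof -
  define t where "t = exp (real k / real m / lam)"
  have T: "lam * ln t = real k / real m" using lam by (simp add: t_def)
  have t: "1 < t" using k m lam by (simp add: t_def)
  have H: "H_emp n x t = 1 - gap_mass n v (real k / real m)" using H_emp_gap_mass[OF t] T by simp
  have F: "F_emp n x t = cum q k" using F_emp_grid[OF _ k(2) T] t by simp
  have "up_excess (m*m) k q - 48 / n \<le> H_emp n x t - F_emp n x t"
    using gap_mass_cells_le[OF order_refl, of k] unfolding H F up_excess_def by linarith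
  moreover have "down_excess (m*m) k q - 48 / n \<le> F_emp n x t - H_emp n x t"
    using gap_mass_cells_ge[OF order_refl, of k] unfolding H F down_excess_def by linarith
  ultimately have "a < \<bar>H_emp n x t - F_emp n x t\<bar>" using a by linarith
  then show ?thesis using t by (auto simp: D_stat_gt_iff intro: less_imp_le)
qed

text \<open>Round \<open>lam ln t\<close> to the grid. No cell has mass above \<open>d\<close>,
  so the rounding costs a bounded multiple of \<open>d\<close> in the level.\<close>

lemma D_stat_imp_feas:
  assumes D: "a < D_stat n x" and d: "\<And>j. q j \<le> d" and a: "20 * d + 48 / n \<le> a"
  shows "feas m (a - 17 * d - 48 / n) q"
proof -
  obtain t where t: "1 \<le> t" "a < \<bar>H_emp n x t - F_emp n x t\<bar>" using D by (auto simp: D_stat_gt_iff)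
  have d0: "0 \<le> d" using d[of 0] pvec_nonneg[OF q_pvec, of 0] by linarith
  have n0: "0 \<le> 48 / real n" by simp
  have a0: "0 \<le> a" "d \<le> a" using a d0 n0 by linarith+
  let ?T = "lam * ln t" and ?J = "m * m"
  have x0: "0 < x i" if "i \<in> {1..n}" for i using x[OF that] by linarith
  have t1: "1 < t"
  proof (rule ccontr)
    assume "\<not> 1 < t"
    then have t1: "t = 1" using t by simp
    have "H_emp n x t = 0" unfolding t1 by (rule H_emp_at_1) (rule x0)
    moreover have "(\<Sum>i=1..n. of_bool (x i < 1)) = (0 :: real)"
    proof (rule sum.neutral, rule ballI)
      fix i assume "i \<in> {1..n}"
      from x[OF this] show "of_bool (x i < 1) = (0 :: real)" by simp
    qed
    then have "F_emp n x t = 0" unfolding F_emp_def t1 by simp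
    ultimately show False using t a0 by simp
  qed
  have T: "0 < ?T" using t1 lam by simp
  have H: "H_emp n x t = 1 - gap_mass n v ?T" by (rule H_emp_gap_mass[OF t1])
  have qJ: "q ?J \<le> d" "cum q (Suc ?J) = 1" using d pvec_cum(4)[OF q_pvec] by auto
  have cumJ: "1 - d \<le> cum q ?J" using qJ by (simp add: cum_Suc)
  show ?thesis
  proof (cases "a < H_emp n x t - F_emp n x t")
    case True
    define k where "k = nat \<lceil>real m * ?T\<rceil>"
    have mT: "0 < real m * ?T" using m T by simp
    have k1: "1 \<le> k" "real m * ?T \<le> real k" "real k - 1 < real m * ?T"
      using mT unfolding k_def by linarith+
    have kT: "?T \<le> real k / real m" "real (k - 1) / real m \<le> ?T"
      using k1 m by (simp_all add: field_simps of_nat_diff)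
    have kJ: "k \<le> ?J"
    proof (rule ccontr)
      assume "\<not> k \<le> ?J"
      then have "?J \<le> k - 1" by simp
      then have "real ?J / real m \<le> real (k - 1) / real m" by (intro divide_right_mono) linarith+
      then have "cum q ?J \<le> F_emp n x t" using kT(2) t1 by (intro F_emp_ge) linarith+
      then show False using True H_emp_bounds(2)[of n x t] cumJ a0 by linarith
    qed
    have "cum q (k - 1) \<le> F_emp n x t" by (rule F_emp_ge) (use t1 kT kJ in auto)
    moreover have "cum q k = cum q (k - 1) + q (k - 1)" using k1 cum_Suc[of q "k - 1"] by simp
    moreover have "q (k - 1) \<le> d" by (rule d)
    moreover have "kap ?J (k+1) q - 48 / n \<le> gap_mass n v ?T" by (rule gap_mass_cells_ge[OF kT(1)])
    moreover have "kap ?J k q \<le> kap ?J (k+1) q + 12 * d" by (rule kap_shift_le[OF q_pvec d])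
    ultimately have "a - 17 * d - 48 / n < up_excess ?J k q"
      using True H qJ unfolding up_excess_def by linarith
    then show ?thesis using k1 kJ q_pvec by (auto simp: feas_def)
  next
    case False
    then have F: "a < F_emp n x t - H_emp n x t" using t a0 by linarith
    define k where "k = nat \<lfloor>real m * ?T\<rfloor>"
    have mT: "0 < real m * ?T" using m T by simp
    have k1: "real k \<le> real m * ?T" "real m * ?T < real k + 1"
      using mT unfolding k_def by linarith+
    have kT: "real k / real m \<le> ?T" "?T \<le> real (Suc k) / real m"
      using k1 m by (simp_all add: field_simps)
    have k0: "1 \<le> k"
    proof (rule ccontr)
      assume "\<not> 1 \<le> k"
      then have k: "Suc k = 1" by simp
      have "F_emp n x t \<le> cum q 1" by (rule F_emp_le) (use t1 kT(2) k m in auto)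
      also have "\<dots> = q 0" using cum_Suc[of q 0] by simp
      finally show False using F H_emp_bounds(1)[of n x t] d[of 0] a0 by linarith
    qed
    have kJ: "k \<le> ?J"
    proof (rule ccontr)
      assume "\<not> k \<le> ?J"
      then have "real ?J / real m \<le> real k / real m" by (intro divide_right_mono) linarith+
      then have "real ?J / real m \<le> ?T" using kT by linarith
      then have "gap_mass n v ?T \<le> kap ?J ?J q + 4 * q ?J + 48 / n" by (rule gap_mass_cells_le)
      moreover have "kap ?J ?J q \<le> 4 * (1 - cum q ?J)" by (rule kap_le_tail[OF q_pvec])
      moreover have "4 * (1 - cum q ?J) \<le> 4 * d" using cumJ by simp
      moreover have "F_emp n x t \<le> 1" by (rule F_emp_bounds)
      ultimately show False using F H qJ a d0 by linarith
    qed
    have "F_emp n x t \<le> cum q (Suc k)"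
    proof (cases "k = ?J")
      case True then show ?thesis using qJ F_emp_bounds(2)[of n x t] by simp
    next
      case False
      then show ?thesis by (intro F_emp_le) (use t1 kT kJ in auto)
    qed
    moreover have "cum q (Suc k) \<le> cum q k + d" using d[of k] by (simp add: cum_Suc)
    moreover have "gap_mass n v ?T \<le> kap ?J k q + 4 * q ?J + 48 / n" by (rule gap_mass_cells_le[OF kT(1)])
    moreover have "kap ?J k q \<le> kap ?J (k+1) q + 12 * d" by (rule kap_shift_le[OF q_pvec d])
    ultimately have "a - 17 * d - 48 / n < down_excess ?J k q"
      using F H qJ unfolding down_excess_def by linarith
    then show ?thesis using k0 kJ q_pvec by (auto simp: feas_def)
  qed
qed

end

section \<open>Types and tilting for a binned Pareto sample\<close>

lemma cell_measurable [measurable]: "(\<lambda>x. cell m (lam * ln x)) \<in> borel \<rightarrow>\<^sub>M count_space UNIV"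
proof -
  have "(\<lambda>z::int. min (m*m) (nat z)) \<in> count_space UNIV \<rightarrow>\<^sub>M count_space UNIV" by simp
  moreover have "(\<lambda>x. \<lfloor>real m * (lam * ln x)\<rfloor>) \<in> borel \<rightarrow>\<^sub>M count_space UNIV" by measurable
  ultimately have "(\<lambda>x. min (m*m) (nat \<lfloor>real m * (lam * ln x)\<rfloor>)) \<in> borel \<rightarrow>\<^sub>M count_space UNIV"
    by (rule measurable_compose_rev)
  then show ?thesis by (simp add: cell_def)
qed

text \<open>The distribution function is continuous on \<open>[1, \<infinity>)\<close>, so strict
  and non-strict inequalities have the same probability.\<close>

lemma pareto_measure_lessThan:
  fixes N :: "real measure"
  assumes N: "prob_space N" "sets N = sets borel" and lam: "0 < lam"
    and cdf: "\<forall>x\<ge>1. cdf N x = 1 - x powr (- lam)" and t: "1 \<le> t"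
  shows "measure N {..<t} = 1 - t powr (- lam)"
proof -
  interpret real_distribution N using N by (simp add: real_distribution_def real_distribution_axioms_def)
  show ?thesis
  proof (cases "t = 1")
    case True
    have "measure N {..<1} \<le> measure N {..1}" by (intro finite_measure_mono) auto
    then show ?thesis using True spec[OF cdf, of 1] by (simp add: cdf_def measure_le_0_iff)
  next
    case False
    have "(cdf N \<longlongrightarrow> measure N {..<t}) (at_left t)" by (rule cdf_at_left)
    moreover have "(cdf N \<longlongrightarrow> 1 - t powr (- lam)) (at_left t)"
    proof (rule Lim_transform_eventually)
      show "((\<lambda>x. 1 - x powr (- lam)) \<longlongrightarrow> 1 - t powr (- lam)) (at_left t)"
        using t by (intro tendsto_intros) auto
      have "\<forall>\<^sub>F x in at_left t. x \<in> {1<..<t}" using False t by (intro eventually_at_leftI[of 1]) auto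
      then show "\<forall>\<^sub>F x in at_left t. 1 - x powr (- lam) = cdf N x" by eventually_elim (simp add: cdf)
    qed
    ultimately show ?thesis by (rule tendsto_unique[rotated]) simp
  qed
qed

lemma pareto_AE_ge_1:
  fixes N :: "real measure"
  assumes N: "prob_space N" "sets N = sets borel" and lam: "0 < lam"
    and cdf: "\<forall>x\<ge>1. cdf N x = 1 - x powr (- lam)"
  shows "AE x in N. 1 \<le> x"
proof -
  interpret prob_space N by fact
  have "measure N {..<1} = 0" using pareto_measure_lessThan[OF N lam cdf order_refl] by simp
  then have "emeasure N {..<1} = 0" by (simp add: emeasure_eq_measure)
  then have "{..<1} \<in> null_sets N" using N by (simp add: null_sets_def)
  then have "AE x in N. x \<notin> {..<1}" by (rule AE_not_in)
  then show ?thesis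
  proof eventually_elim
    case (elim x) then show ?case by simp
  qed
qed

lemma pareto_cell_prob:
  fixes N :: "real measure"
  assumes N: "prob_space N" "sets N = sets borel" and lam: "0 < lam"
    and cdf: "\<forall>x\<ge>1. cdf N x = 1 - x powr (- lam)" and m: "0 < m" and j: "j \<le> m * m"
  shows "measure N {x. cell m (lam * ln x) = j} = gp m j"
proof -
  interpret prob_space N by fact
  let ?c = "\<lambda>x. cell m (lam * ln x)"
  have sp: "space N = UNIV" using sets_eq_imp_space_eq[OF N(2)] by simp
  have meas: "{x. ?c x \<in> A} \<in> sets N" for A
    using measurable_sets[OF cell_measurable, of A m lam] N by (simp add: vimage_def)
  have less: "measure N {x. ?c x < k} = cum (gp m) k" if "k \<le> Suc (m * m)" for k
  proof (cases "k \<le> m * m")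
    case True
    define t where "t = exp (real k / real m / lam)"
    have t1: "1 \<le> t" using lam by (simp add: t_def)
    have ae: "AE x in N. (x \<in> {x. ?c x < k}) = (x \<in> {..<t})"
      using pareto_AE_ge_1[OF N lam cdf]
    proof eventually_elim
      case (elim x)
      then have "?c x < k \<longleftrightarrow> lam * ln x < real k / real m" using lam by (intro cell_less_iff[OF m _ True]) simp
      also have "\<dots> \<longleftrightarrow> ln x < real k / real m / lam"
        using pos_less_divide_eq[OF lam, of "ln x" "real k / real m"] by (simp only: mult.commute)
      also have "\<dots> \<longleftrightarrow> exp (ln x) < t" unfolding t_def by (rule exp_less_cancel_iff[symmetric])
      also have "exp (ln x) = x" using elim by simp
      finally show ?case by simp
    qed
    have "measure N {x. ?c x < k} = measure N {..<t}"
    proof (rule finite_measure_eq_AE[OF ae])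
      show "{x. ?c x < k} \<in> sets N" using meas[of "{..<k}"] by (simp only: lessThan_iff)
      show "{..<t} \<in> sets N" unfolding N(2) by simp
    qed
    also have "\<dots> = 1 - t powr (- lam)" by (rule pareto_measure_lessThan[OF N lam cdf t1])
    also have "t powr (- lam) = exp (- (real k / real m))" using lam by (simp add: t_def powr_def)
    finally show ?thesis using cum_gp[OF m True] by simp
  next
    case False
    then have "k = Suc (m * m)" using that by simp
    then have "{x. ?c x < k} = UNIV" using cell_le by (simp add: less_Suc_eq_le)
    moreover have "cum (gp m) k = 1" using False ref_pvec_gp[OF m] by (intro pvec_cum(4)) (auto simp: ref_pvec_def)
    ultimately show ?thesis using prob_space sp by simp
  qed
  have eq: "{x. ?c x = j} = {x. ?c x < Suc j} - {x. ?c x < j}" by auto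
  have "measure N ({x. ?c x < Suc j} - {x. ?c x < j}) = measure N {x. ?c x < Suc j} - measure N {x. ?c x < j}"
  proof (rule finite_measure_Diff)
    show "{x. ?c x < Suc j} \<in> sets N" using meas[of "{..<Suc j}"] by (simp only: lessThan_iff)
    show "{x. ?c x < j} \<in> sets N" using meas[of "{..<j}"] by (simp only: lessThan_iff)
    show "{x. ?c x < j} \<subseteq> {x. ?c x < Suc j}" by auto
  qed
  then show ?thesis using less[of j] less[of "Suc j"] j unfolding eq by (simp add: cum_Suc)
qed

text \<open>The binned logarithm of a Pareto variable has the binned exponential distribution.\<close>

lemma pareto_cell_expectation:
  fixes N :: "real measure" and \<phi> :: "nat \<Rightarrow> real"
  assumes N: "prob_space N" "sets N = sets borel" and lam: "0 < lam"
    and cdf: "\<forall>x\<ge>1. cdf N x = 1 - x powr (- lam)" and m: "0 < m"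
  shows "integrable N (\<lambda>x. \<phi> (cell m (lam * ln x)))"
    and "(\<integral>x. \<phi> (cell m (lam * ln x)) \<partial>N) = (\<Sum>j\<le>m*m. gp m j * \<phi> j)"
proof -
  interpret prob_space N by fact
  let ?c = "\<lambda>x. cell m (lam * ln x)"
  have sp: "space N = UNIV" using sets_eq_imp_space_eq[OF N(2)] by simp
  have meas: "{x. ?c x = j} \<in> sets N" for j
    using measurable_sets[OF cell_measurable, of "{j}" m lam] N by (simp add: vimage_def)
  have eq: "\<phi> (?c x) = (\<Sum>j\<le>m*m. \<phi> j * indicator {x. ?c x = j} x)" for x
    using cell_le[of m "lam * ln x"] by (simp add: indicator_def)
  have int: "integrable N (\<lambda>x. \<phi> j * indicator {x. ?c x = j} x)" for j
    using meas[of j] by (intro integrable_mult_right integrable_real_indicator) (auto simp: emeasure_eq_measure)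
  show "integrable N (\<lambda>x. \<phi> (cell m (lam * ln x)))"
    unfolding eq by (intro Bochner_Integration.integrable_sum int)
  show "(\<integral>x. \<phi> (cell m (lam * ln x)) \<partial>N) = (\<Sum>j\<le>m*m. gp m j * \<phi> j)"
  proof -
    have 1: "(\<integral>x. \<phi> (cell m (lam * ln x)) \<partial>N) = (\<Sum>j\<le>m*m. \<integral>x. \<phi> j * indicator {x. ?c x = j} x \<partial>N)"
      unfolding eq by (rule Bochner_Integration.integral_sum[OF int])
    have 2: "(\<Sum>j\<le>m*m. \<integral>x. \<phi> j * indicator {x. ?c x = j} x \<partial>N) = (\<Sum>j\<le>m*m. gp m j * \<phi> j)"
    proof (intro sum.cong refl)
      fix j assume "j \<in> {..m*m}"
      then have "measure N {x. ?c x = j} = gp m j" using pareto_cell_prob[OF N lam cdf m, of j] by simp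
      then show "(\<integral>x. \<phi> j * indicator {x. ?c x = j} x \<partial>N) = gp m j * \<phi> j" using sp by simp
    qed
    show ?thesis using 1 2 by (rule trans)
  qed
qed

lemma exp_le_quadratic:
  fixes y :: real
  assumes "y \<le> 1" shows "exp y \<le> 1 + y + y^2"
proof (cases "0 \<le> y")
  case True then show ?thesis using assms by (intro exp_bound) auto
next
  case False
  have "exp y = 1 / exp (- y)" by (simp add: exp_minus inverse_eq_divide)
  also have "\<dots> \<le> 1 / (1 - y)" using exp_ge_add_one_self[of "- y"] False by (intro divide_left_mono) auto
  also have "\<dots> \<le> 1 + y + y^2"
  proof -
    have "y * y^2 \<le> 0" using False by (intro mult_nonpos_nonneg) auto
    moreover have "(1 + y + y^2) * (1 - y) = 1 - y * y^2" by (simp add: algebra_simps power2_eq_square)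
    ultimately have "1 \<le> (1 + y + y^2) * (1 - y)" by linarith
    then show ?thesis using False by (simp add: pos_divide_le_eq)
  qed
  finally show ?thesis .
qed

context
  fixes M :: "'a measure" and X :: "nat \<Rightarrow> 'a \<Rightarrow> real" and lam :: real and m :: nat
  assumes iid: "iid_pareto M X lam" and lam: "0 < lam" and m: "0 < m"
begin

lemma X_prob_space: "prob_space M" using iid by (simp add: iid_pareto_def)

lemma X_indep: "prob_space.indep_vars M (\<lambda>_. borel) X {1..}" using iid by (simp add: iid_pareto_def)

lemma X_meas:
  assumes "1 \<le> i" shows "X i \<in> borel_measurable M"
proof -
  have "\<forall>i\<in>{1..}. X i \<in> borel_measurable M"
    using X_indep unfolding prob_space.indep_vars_def2[OF X_prob_space] by (rule conjunct1)
  then show ?thesis using assms by simp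
qed

lemma X_distr:
  assumes "1 \<le> i"
  shows "prob_space (distr M borel (X i))" "sets (distr M borel (X i)) = sets borel"
    "\<forall>x\<ge>1. cdf (distr M borel (X i)) x = 1 - x powr (- lam)"
proof -
  show "prob_space (distr M borel (X i))" by (rule prob_space.prob_space_distr[OF X_prob_space X_meas[OF assms]])
  show "sets (distr M borel (X i)) = sets borel" by (rule sets_distr)
  have "\<forall>i\<ge>1. \<forall>x\<ge>1. cdf (distr M borel (X i)) x = 1 - x powr (- lam)"
    using iid unfolding iid_pareto_def by (elim conjE)
  then show "\<forall>x\<ge>1. cdf (distr M borel (X i)) x = 1 - x powr (- lam)" using assms by blast
qed

lemma X_AE: "AE \<omega> in M. \<forall>i\<in>{1..n}. 1 \<le> X i \<omega>"
proof (rule AE_finite_allI)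
  fix i :: nat assume "i \<in> {1..n}"
  then have i: "1 \<le> i" by simp
  have "AE x in distr M borel (X i). 1 \<le> x" by (rule pareto_AE_ge_1[OF X_distr(1,2)[OF i] lam X_distr(3)[OF i]])
  from AE_distrD[OF X_meas[OF i] this] show "AE \<omega> in M. 1 \<le> X i \<omega>" .
qed simp

lemma cell_X_expectation:
  assumes i: "1 \<le> i"
  shows "integrable M (\<lambda>\<omega>. \<phi> (cell m (lam * ln (X i \<omega>))))"
    and "(\<integral>\<omega>. \<phi> (cell m (lam * ln (X i \<omega>))) \<partial>M) = (\<Sum>j\<le>m*m. gp m j * \<phi> j)"
proof -
  have bm: "(\<lambda>x. \<phi> (cell m (lam * ln x))) \<in> borel_measurable borel"
    by (rule measurable_compose[OF cell_measurable]) simp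
  note E = pareto_cell_expectation[OF X_distr(1,2)[OF i] lam X_distr(3)[OF i] m, of \<phi>]
  show "integrable M (\<lambda>\<omega>. \<phi> (cell m (lam * ln (X i \<omega>))))"
    using E(1) unfolding integrable_distr_eq[OF X_meas[OF i] bm] .
  show "(\<integral>\<omega>. \<phi> (cell m (lam * ln (X i \<omega>))) \<partial>M) = (\<Sum>j\<le>m*m. gp m j * \<phi> j)"
    using E(2) unfolding integral_distr[OF X_meas[OF i] bm] .
qed

text \<open>The independence of the sample, in the form in which it is used for types and for
  tilting.\<close>

lemma cells_product_expectation:
  shows "integrable M (\<lambda>\<omega>. \<Prod>i=1..n. \<phi> (cell m (lam * ln (X i \<omega>))))"
    and "(\<integral>\<omega>. (\<Prod>i=1..n. \<phi> (cell m (lam * ln (X i \<omega>)))) \<partial>M) = (\<Sum>j\<le>m*m. gp m j * \<phi> j) ^ n"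
proof -
  interpret prob_space M by (rule X_prob_space)
  have "indep_vars (\<lambda>_. borel) X {1..n}" by (rule indep_vars_subset[OF X_indep]) auto
  then have iv: "indep_vars (\<lambda>_. borel) (\<lambda>i \<omega>. \<phi> (cell m (lam * ln (X i \<omega>)))) {1..n}"
    by (rule indep_vars_compose2) (rule measurable_compose[OF cell_measurable], simp)
  have int: "integrable M (\<lambda>\<omega>. \<phi> (cell m (lam * ln (X i \<omega>))))" if "i \<in> {1..n}" for i
    using that by (intro cell_X_expectation(1)) simp
  show "integrable M (\<lambda>\<omega>. \<Prod>i=1..n. \<phi> (cell m (lam * ln (X i \<omega>))))"
    by (rule indep_vars_integrable[OF _ iv int]) auto
  have "(\<integral>\<omega>. (\<Prod>i=1..n. \<phi> (cell m (lam * ln (X i \<omega>)))) \<partial>M)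
      = (\<Prod>i=1..n. \<integral>\<omega>. \<phi> (cell m (lam * ln (X i \<omega>))) \<partial>M)"
    by (rule indep_vars_lebesgue_integral[OF _ iv int]) auto
  also have "\<dots> = (\<Prod>i=1..n. \<Sum>j\<le>m*m. gp m j * \<phi> j)"
    by (intro prod.cong refl cell_X_expectation(2)) simp
  finally show "(\<integral>\<omega>. (\<Prod>i=1..n. \<phi> (cell m (lam * ln (X i \<omega>)))) \<partial>M) = (\<Sum>j\<le>m*m. gp m j * \<phi> j) ^ n" by simp
qed

abbreviation (input) cells :: "'a \<Rightarrow> nat \<Rightarrow> nat" where
  "cells \<omega> \<equiv> (\<lambda>i. cell m (lam * ln (X i \<omega>)))"

lemma prod_cells_eq_exp:
  assumes n: "0 < n" and pos: "\<And>i. i \<in> {1..n} \<Longrightarrow> 0 < \<phi> (cells \<omega> i)"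
  shows "(\<Prod>i=1..n. \<phi> (cells \<omega> i)) = exp (real n * (\<Sum>j\<le>m*m. freq n (cells \<omega>) j * ln (\<phi> j)))"
proof -
  have "(\<Prod>i=1..n. \<phi> (cells \<omega> i)) = (\<Prod>i=1..n. exp (ln (\<phi> (cells \<omega> i))))"
    by (intro prod.cong refl) (use pos in simp)
  also have "\<dots> = exp (\<Sum>i=1..n. ln (\<phi> (cells \<omega> i)))" by (simp add: exp_sum)
  also have "(\<Sum>i=1..n. ln (\<phi> (cells \<omega> i))) = real n * (\<Sum>j\<le>m*m. freq n (cells \<omega>) j * ln (\<phi> j))"
    using n by (subst sum_freq) (simp_all add: cell_le)
  finally show ?thesis .
qed

text \<open>Upper bound by the method of types: the likelihood ratio of the type of the sample is
  \<open>exp (n KL)\<close>, each type contributes expectation 1, and there are polynomially many types.\<close>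

lemma prob_types_upper:
  assumes n: "0 < n" and A: "A \<in> sets M"
    and b: "\<And>\<omega>. \<omega> \<in> A \<Longrightarrow> b \<le> KL (m*m) (gp m) (freq n (cells \<omega>))"
  shows "measure M A \<le> real (n + 1) ^ (m * m + 1) * exp (- (real n * b))"
proof -
  interpret prob_space M by (rule X_prob_space)
  define Ks where "Ks = {\<kappa> \<in> {..m*m} \<rightarrow>\<^sub>E {..n}. (\<Sum>j\<le>m*m. \<kappa> j) = n}"
  define r where "r = (\<lambda>(\<kappa>::nat\<Rightarrow>nat) j. real (\<kappa> j) / real n / gp m j)"
  define Z where "Z = (\<lambda>\<omega>. \<Sum>\<kappa>\<in>Ks. \<Prod>i=1..n. r \<kappa> (cells \<omega> i))"
  have fin: "finite ({..m*m} \<rightarrow>\<^sub>E {..n})" by (rule finite_PiE) simp_all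
  have sub: "Ks \<subseteq> {..m*m} \<rightarrow>\<^sub>E {..n}" unfolding Ks_def by blast
  have finK: "finite Ks" by (rule finite_subset[OF sub fin])
  have "card Ks \<le> card ({..m*m} \<rightarrow>\<^sub>E {..n})" by (rule card_mono[OF fin sub])
  also have "\<dots> = (n + 1) ^ (m * m + 1)" by (simp add: card_PiE)
  finally have "real (card Ks) \<le> real ((n + 1) ^ (m * m + 1))" by (simp only: of_nat_le_iff)
  then have cardK: "real (card Ks) \<le> real (n + 1) ^ (m * m + 1)" by (simp only: of_nat_power)
  have rnn: "0 \<le> r \<kappa> (cells \<omega> i)" for \<kappa> \<omega> i
    using gp_pos[OF m cell_le, of "lam * ln (X i \<omega>)"] by (simp add: r_def)
  have intZ: "integrable M Z" unfolding Z_def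
    by (intro Bochner_Integration.integrable_sum cells_product_expectation(1))
  have "(\<integral>\<omega>. Z \<omega> \<partial>M) = (\<Sum>\<kappa>\<in>Ks. \<integral>\<omega>. (\<Prod>i=1..n. r \<kappa> (cells \<omega> i)) \<partial>M)"
    unfolding Z_def by (rule Bochner_Integration.integral_sum) (rule cells_product_expectation(1))
  also have "\<dots> = (\<Sum>\<kappa>\<in>Ks. (\<Sum>j\<le>m*m. gp m j * r \<kappa> j) ^ n)"
    by (rule sum.cong[OF refl]) (rule cells_product_expectation(2))
  also have "\<dots> = (\<Sum>\<kappa>\<in>Ks. 1)"
  proof (rule sum.cong[OF refl])
    fix \<kappa> assume k: "\<kappa> \<in> Ks"
    have "(\<Sum>j\<le>m*m. gp m j * r \<kappa> j) = (\<Sum>j\<le>m*m. real (\<kappa> j)) / n"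
      unfolding sum_divide_distrib by (intro sum.cong) (use gp_pos[OF m] in \<open>auto simp: r_def less_imp_neq[symmetric]\<close>)
    also have "(\<Sum>j\<le>m*m. real (\<kappa> j)) = real n" using k by (simp add: Ks_def flip: of_nat_sum)
    finally show "(\<Sum>j\<le>m*m. gp m j * r \<kappa> j) ^ n = 1" using n by simp
  qed
  finally have EZ: "(\<integral>\<omega>. Z \<omega> \<partial>M) = real (card Ks)" by simp
  have ZA: "exp (real n * b) * indicator A \<omega> \<le> Z \<omega>" for \<omega>
  proof (cases "\<omega> \<in> A")
    case True
    define \<kappa> where "\<kappa> = restrict (\<lambda>j. card {i\<in>{1..n}. cells \<omega> i = j}) {..m*m}"
    have kj: "real (\<kappa> j) / real n = freq n (cells \<omega>) j" if "j \<le> m*m" for j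
      using that by (simp add: \<kappa>_def freq_def)
    have pv: "pvec (m*m) (freq n (cells \<omega>))" using n cell_le by (intro freq_pvec) auto
    have "real (\<Sum>j\<le>m*m. \<kappa> j) = real n * (\<Sum>j\<le>m*m. freq n (cells \<omega>) j)"
      unfolding of_nat_sum sum_distrib_left by (intro sum.cong) (use n in \<open>auto simp: kj[symmetric]\<close>)
    then have "real (\<Sum>j\<le>m*m. \<kappa> j) = real n" using pv by (simp add: pvec_def)
    then have sum\<kappa>: "(\<Sum>j\<le>m*m. \<kappa> j) = n" by (simp only: of_nat_eq_iff)
    have "card {i\<in>{1..n}. cells \<omega> i = j} \<le> card {1..n}" for j by (intro card_mono) auto
    then have "\<kappa> \<in> {..m*m} \<rightarrow>\<^sub>E {..n}" by (auto simp: \<kappa>_def PiE_iff)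
    then have \<kappa>: "\<kappa> \<in> Ks" using sum\<kappa> by (simp add: Ks_def)
    have pos: "0 < r \<kappa> (cells \<omega> i)" if "i \<in> {1..n}" for i
    proof -
      have "i \<in> {i'\<in>{1..n}. cells \<omega> i' = cells \<omega> i}" using that by simp
      then have "0 < card {i'\<in>{1..n}. cells \<omega> i' = cells \<omega> i}" by (intro card_gt_0_iff[THEN iffD2]) auto
      then have "0 < \<kappa> (cells \<omega> i)" by (simp add: \<kappa>_def cell_le)
      then show ?thesis using gp_pos[OF m cell_le, of "lam * ln (X i \<omega>)"] n by (simp add: r_def)
    qed
    have "(\<Sum>j\<le>m*m. freq n (cells \<omega>) j * ln (r \<kappa> j)) = KL (m*m) (gp m) (freq n (cells \<omega>))"
      unfolding KL_def by (intro sum.cong refl) (simp only: r_def kj atMost_iff)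
    then have "(\<Prod>i=1..n. r \<kappa> (cells \<omega> i)) = exp (real n * KL (m*m) (gp m) (freq n (cells \<omega>)))"
      using prod_cells_eq_exp[OF n, of "r \<kappa>" \<omega>] pos by simp
    moreover have "exp (real n * b) \<le> exp (real n * KL (m*m) (gp m) (freq n (cells \<omega>)))"
      using b[OF True] by (simp add: mult_left_mono)
    moreover have "(\<Prod>i=1..n. r \<kappa> (cells \<omega> i)) \<le> Z \<omega>"
      unfolding Z_def by (rule member_le_sum[OF \<kappa>]) (auto intro!: prod_nonneg rnn finK)
    ultimately have "exp (real n * b) \<le> Z \<omega>" by linarith
    then show ?thesis using True by simp
  next
    case False
    then show ?thesis unfolding Z_def by (auto intro!: sum_nonneg prod_nonneg rnn)
  qed
  have intA: "integrable M (\<lambda>\<omega>. exp (real n * b) * indicator A \<omega>)"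
    using A by (intro integrable_mult_right integrable_real_indicator) (auto simp: emeasure_eq_measure)
  have "exp (real n * b) * measure M A = (\<integral>\<omega>. exp (real n * b) * indicator A \<omega> \<partial>M)" using A by simp
  also have "\<dots> \<le> (\<integral>\<omega>. Z \<omega> \<partial>M)" by (rule integral_mono[OF intA intZ ZA])
  finally have "exp (real n * b) * measure M A \<le> real (n + 1) ^ (m * m + 1)" using EZ cardK by simp
  then have "exp (- (real n * b)) * (exp (real n * b) * measure M A) \<le> exp (- (real n * b)) * real (n + 1) ^ (m * m + 1)"
    by (intro mult_left_mono) auto
  moreover have "exp (- (real n * b)) * (exp (real n * b) * measure M A) = measure M A" by (simp add: exp_minus)
  ultimately show ?thesis by (simp only: mult.commute)
qed

end

context
  fixes M :: "'a measure" and X :: "nat \<Rightarrow> 'a \<Rightarrow> real" and lam :: real and m :: nat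
  assumes iid: "iid_pareto M X lam" and lam: "0 < lam" and m: "0 < m"
begin

abbreviation (input) binned :: "'a \<Rightarrow> nat \<Rightarrow> nat" where
  "binned \<omega> \<equiv> (\<lambda>i. cell m (lam * ln (X i \<omega>)))"

text \<open>Lower bound by exponential tilting to \<open>q\<close>, under which the type concentrates near \<open>q\<close> by a
  Chernoff bound.\<close>

lemma prob_tilting_lower:
  assumes n: "0 < n" and A: "A \<in> sets M" and q: "pvec (m*m) q" and e: "0 < e" "e \<le> 1"
    and near: "AE \<omega> in M. (\<forall>j\<le>m*m. \<bar>freq n (binned \<omega>) j - q j\<bar> \<le> e) \<longrightarrow> \<omega> \<in> A"
  defines "S \<equiv> (\<Sum>j\<le>m*m. \<bar>ln (q j / gp m j)\<bar>)"
  shows "1 \<le> measure M A * exp (real n * (KL (m*m) (gp m) q + e * S)) + 2 * real (m*m+1) * exp (- (real n * (e^2 / 4)))"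
proof -
  interpret prob_space M by (rule X_prob_space[OF iid lam m])
  define r where "r = (\<lambda>j. q j / gp m j)"
  define g where "g = (\<lambda>(s::real) j l. r l * exp (e / 2 * (s * (of_bool (l = j) - q j) - e)))"
  have qn: "0 \<le> q j" for j using q by (simp add: pvec_def)
  have rnn: "0 \<le> r (binned \<omega> i)" for \<omega> i
    using gp_pos[OF m cell_le, of "lam * ln (X i \<omega>)"] qn by (simp add: r_def)
  have gr: "gp m j * r j = q j" if "j \<le> m*m" for j using gp_pos[OF m that] by (simp add: r_def)
  let ?R = "\<lambda>\<omega>. \<Prod>i=1..n. r (binned \<omega> i)" and ?G = "\<lambda>s j \<omega>. \<Prod>i=1..n. g s j (binned \<omega> i)"
  let ?c = "exp (real n * (KL (m*m) (gp m) q + e * S))"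
  have "(\<Sum>j\<le>m*m. gp m j * r j) = (\<Sum>j\<le>m*m. q j)" by (intro sum.cong) (auto simp: gr)
  then have ER: "(\<integral>\<omega>. ?R \<omega> \<partial>M) = 1" using cells_product_expectation(2)[OF iid lam m, of r n] pvec_sum[OF q] by simp
  have EG: "(\<integral>\<omega>. ?G s j \<omega> \<partial>M) \<le> exp (- (real n * (e^2 / 4)))" if s: "s = 1 \<or> s = -1" and j: "j \<le> m*m" for s j
  proof -
    have "(\<Sum>l\<le>m*m. gp m l * g s j l) = (\<Sum>l\<le>m*m. q l * exp (e/2 * (s * (of_bool (l = j) - q j)))) * exp (- (e^2/2))"
      unfolding sum_distrib_right
    proof (intro sum.cong refl)
      fix l assume "l \<in> {..m*m}"
      then have gl: "gp m l * r l = q l" by (intro gr) simp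
      have "e / 2 * (s * (of_bool (l = j) - q j) - e) = e/2 * (s * (of_bool (l = j) - q j)) + - (e^2/2)"
        by (simp add: algebra_simps power2_eq_square)
      then show "gp m l * g s j l = q l * exp (e/2 * (s * (of_bool (l = j) - q j))) * exp (- (e^2/2))"
        unfolding g_def mult.assoc[symmetric] gl by (simp only: exp_add mult.assoc)
    qed
    also have "\<dots> \<le> (1 + (e/2)^2) * exp (- (e^2/2))"
    proof (rule mult_right_mono)
      have "(\<Sum>l\<le>m*m. q l * exp (e/2 * (s * (of_bool (l = j) - q j))))
          \<le> (\<Sum>l\<le>m*m. q l + (e/2 * s) * (if l = j then q l else 0) - (e/2 * s * q j) * q l + (e/2)^2 * q l)"
      proof (rule sum_mono)
        fix l
        define y where "y = e/2 * (s * (of_bool (l = j) - q j))"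
        have "\<bar>of_bool (l = j) - q j\<bar> \<le> 1" using qn[of j] pvec_le_1[OF q, of j] by auto
        moreover have "\<bar>s\<bar> = 1" using s by auto
        ultimately have "\<bar>s * (of_bool (l = j) - q j)\<bar> \<le> 1" by (simp add: abs_mult)
        then have "e/2 * \<bar>s * (of_bool (l = j) - q j)\<bar> \<le> e/2 * 1" using e by (intro mult_left_mono) auto
        then have y: "\<bar>y\<bar> \<le> e/2" unfolding y_def using e by (simp add: abs_mult)
        have "y \<le> 1" using y e by linarith
        then have "exp y \<le> 1 + y + y^2" by (rule exp_le_quadratic)
        also have "y^2 \<le> (e/2)^2"
        proof -
          have "\<bar>y\<bar>^2 \<le> (e/2)^2" using y by (intro power_mono) auto
          then show ?thesis by simp
        qed
        finally have "q l * exp y \<le> q l * (1 + y + (e/2)^2)" using qn by (intro mult_left_mono) auto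
        moreover have "(if l = j then q l else 0) = q l * of_bool (l = j)" by simp
        moreover have "q l * (1 + y + (e/2)^2)
            = q l + (e/2 * s) * (q l * of_bool (l = j)) - (e/2 * s * q j) * q l + (e/2)^2 * q l"
        proof -
          have "Q * (1 + E * (s' * (B - q')) + C) = Q + (E * s') * (Q * B) - (E * s' * q') * Q + C * Q"
            for Q E s' B q' C :: real by (simp add: algebra_simps)
          from this[of "q l" "e/2" s "of_bool (l = j)" "q j" "(e/2)^2"] show ?thesis unfolding y_def .
        qed
        ultimately show "q l * exp (e/2 * (s * (of_bool (l = j) - q j)))
            \<le> q l + (e/2 * s) * (if l = j then q l else 0) - (e/2 * s * q j) * q l + (e/2)^2 * q l"
          by (simp only: y_def)
      qed
      also have "\<dots> = 1 + (e/2)^2"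
      proof -
        have d: "(\<Sum>l\<le>m*m. if l = j then q l else 0) = q j" using j by simp
        have "(\<Sum>l\<le>m*m. q l + (e/2 * s) * (if l = j then q l else 0) - (e/2 * s * q j) * q l + (e/2)^2 * q l)
           = (\<Sum>l\<le>m*m. q l) + (e/2 * s) * (\<Sum>l\<le>m*m. if l = j then q l else 0)
             - (e/2 * s * q j) * (\<Sum>l\<le>m*m. q l) + (e/2)^2 * (\<Sum>l\<le>m*m. q l)"
          by (simp only: sum.distrib sum_subtractf sum_distrib_left)
        then show ?thesis unfolding d pvec_sum[OF q] by simp
      qed
      finally show "(\<Sum>l\<le>m*m. q l * exp (e/2 * (s * (of_bool (l = j) - q j)))) \<le> 1 + (e/2)^2" .
    qed simp
    also have "\<dots> \<le> exp ((e/2)^2) * exp (- (e^2/2))" by (intro mult_right_mono exp_ge_add_one_self) auto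
    also have "\<dots> = exp (- (e^2/4))" by (simp add: power2_eq_square flip: exp_add)
    finally have b: "(\<Sum>l\<le>m*m. gp m l * g s j l) \<le> exp (- (e^2/4))" .
    have "0 \<le> (\<Sum>l\<le>m*m. gp m l * g s j l)"
    proof (intro sum_nonneg)
      fix l assume "l \<in> {..m*m}"
      then have "gp m l * g s j l = q l * exp (e / 2 * (s * (of_bool (l = j) - q j) - e))"
        using gr[of l] by (simp add: g_def flip: mult.assoc)
      then show "0 \<le> gp m l * g s j l" using qn by simp
    qed
    then have "(\<Sum>l\<le>m*m. gp m l * g s j l) ^ n \<le> exp (- (e^2/4)) ^ n" using b by (intro power_mono)
    then show ?thesis unfolding cells_product_expectation(2)[OF iid lam m] by (simp flip: exp_of_nat_mult)
  qed
  have bound: "?R \<omega> \<le> ?c * indicator A \<omega> + (\<Sum>j\<le>m*m. ?G 1 j \<omega> + ?G (-1) j \<omega>)"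
    if w: "(\<forall>j\<le>m*m. \<bar>freq n (binned \<omega>) j - q j\<bar> \<le> e) \<longrightarrow> \<omega> \<in> A" for \<omega>
  proof -
    have Gnn: "0 \<le> ?G s j \<omega>" for s j using rnn by (intro prod_nonneg) (simp add: g_def)
    have Sn: "0 \<le> (\<Sum>j\<le>m*m. ?G 1 j \<omega> + ?G (-1) j \<omega>)" using Gnn by (intro sum_nonneg add_nonneg_nonneg)
    show ?thesis
    proof (cases "\<forall>j\<le>m*m. \<bar>freq n (binned \<omega>) j - q j\<bar> \<le> e")
      case True
      then have wA: "\<omega> \<in> A" using w by simp
      have "?R \<omega> \<le> ?c"
      proof (cases "\<forall>i\<in>{1..n}. 0 < r (binned \<omega> i)")
        case pos: True
        have "?R \<omega> = exp (real n * (\<Sum>j\<le>m*m. freq n (binned \<omega>) j * ln (r j)))"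
          by (rule prod_cells_eq_exp[OF iid lam m n]) (use pos in simp)
        also have "(\<Sum>j\<le>m*m. freq n (binned \<omega>) j * ln (r j)) \<le> (\<Sum>j\<le>m*m. q j * ln (r j) + e * \<bar>ln (r j)\<bar>)"
        proof (rule sum_mono)
          fix j assume "j \<in> {..m*m}"
          then have "\<bar>freq n (binned \<omega>) j - q j\<bar> * \<bar>ln (r j)\<bar> \<le> e * \<bar>ln (r j)\<bar>"
            using True by (intro mult_right_mono) auto
          moreover have "(freq n (binned \<omega>) j - q j) * ln (r j) \<le> \<bar>freq n (binned \<omega>) j - q j\<bar> * \<bar>ln (r j)\<bar>"
            by (metis abs_ge_self abs_mult)
          ultimately show "freq n (binned \<omega>) j * ln (r j) \<le> q j * ln (r j) + e * \<bar>ln (r j)\<bar>"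
            by (simp add: algebra_simps)
        qed
        also have "\<dots> = KL (m*m) (gp m) q + e * S"
          by (simp add: KL_def S_def r_def sum.distrib sum_distrib_left)
        finally show ?thesis by (simp add: mult_left_mono)
      next
        case False
        then obtain i where i: "i \<in> {1..n}" "\<not> 0 < r (binned \<omega> i)" by blast
        then have "r (binned \<omega> i) = 0" using rnn[of i \<omega>] by linarith
        then have "\<exists>i\<in>{1..n}. r (binned \<omega> i) = 0" using i(1) by blast
        then have R0: "?R \<omega> = 0" by (rule prod_zero[OF finite_atLeastAtMost])
        show ?thesis unfolding R0 by simp
      qed
      then show ?thesis using wA Sn by simp
    next
      case False
      then obtain j where j: "j \<le> m*m" "e < \<bar>freq n (binned \<omega>) j - q j\<bar>" by (auto simp: not_le)
      define s :: real where "s = (if e < freq n (binned \<omega>) j - q j then 1 else -1)"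
      have s: "e < s * (freq n (binned \<omega>) j - q j)" using j by (auto simp: s_def)
      have "?G s j \<omega> = ?R \<omega> * (\<Prod>i=1..n. exp (e / 2 * (s * (of_bool (binned \<omega> i = j) - q j) - e)))"
        by (simp add: g_def prod.distrib)
      also have "(\<Prod>i=1..n. exp (e / 2 * (s * (of_bool (binned \<omega> i = j) - q j) - e)))
          = exp (\<Sum>i=1..n. e / 2 * (s * (of_bool (binned \<omega> i = j) - q j) - e))" by (simp add: exp_sum)
      also have "(\<Sum>i=1..n. e / 2 * (s * (of_bool (binned \<omega> i = j) - q j) - e))
          = e / 2 * (real n * (s * (freq n (binned \<omega>) j - q j) - e))"
      proof -
        have "(\<Sum>i=1..n. of_bool (binned \<omega> i = j)) = (\<Sum>i=1..n. if binned \<omega> i = j then 1 else 0 :: real)"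
          by (intro sum.cong) auto
        also have "\<dots> = (\<Sum>i\<in>{i\<in>{1..n}. binned \<omega> i = j}. 1)" by (rule sum.inter_filter[symmetric]) simp
        also have "\<dots> = real n * freq n (binned \<omega>) j" using n by (simp add: freq_def)
        finally have f: "(\<Sum>i=1..n. of_bool (binned \<omega> i = j)) = real n * freq n (binned \<omega>) j" .
        have "(\<Sum>i=1..n. e / 2 * (s * (of_bool (binned \<omega> i = j) - q j) - e))
           = e / 2 * (s * ((\<Sum>i=1..n. of_bool (binned \<omega> i = j)) - real n * q j) - real n * e)"
        proof -
          have "(\<Sum>i=1..n. c * (s' * (F i - b) - d)) = c * (s' * ((\<Sum>i=1..n. F i) - real n * b) - real n * d)"
            for c s' b d :: real and F :: "nat \<Rightarrow> real" by (induction n) (simp_all add: algebra_simps)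
          from this[of "e/2" s "\<lambda>i. of_bool (binned \<omega> i = j)" "q j" e] show ?thesis .
        qed
        also have "\<dots> = e / 2 * (real n * (s * (freq n (binned \<omega>) j - q j) - e))"
          unfolding f by (simp add: right_diff_distrib mult.left_commute)
        finally show ?thesis .
      qed
      finally have "?G s j \<omega> = ?R \<omega> * exp (e / 2 * (real n * (s * (freq n (binned \<omega>) j - q j) - e)))" .
      moreover have "1 \<le> exp (e / 2 * (real n * (s * (freq n (binned \<omega>) j - q j) - e)))" using s e by simp
      moreover have "0 \<le> ?R \<omega>" using rnn by (intro prod_nonneg) auto
      ultimately have "?R \<omega> * 1 \<le> ?G s j \<omega>" by (simp only:) (rule mult_left_mono)
      then have "?R \<omega> \<le> ?G s j \<omega>" by simp
      also have "\<dots> \<le> ?G 1 j \<omega> + ?G (-1) j \<omega>" using Gnn[of 1 j] Gnn[of "-1" j] by (auto simp: s_def)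
      also have "\<dots> \<le> (\<Sum>j\<le>m*m. ?G 1 j \<omega> + ?G (-1) j \<omega>)"
        by (rule member_le_sum[where f="\<lambda>j. ?G 1 j \<omega> + ?G (-1) j \<omega>"]) (use j Gnn in \<open>auto intro: add_nonneg_nonneg\<close>)
      finally show ?thesis by (simp add: add_increasing)
    qed
  qed
  have intR: "integrable M ?R" by (rule cells_product_expectation(1)[OF iid lam m])
  have intG: "integrable M (?G s j)" for s j by (rule cells_product_expectation(1)[OF iid lam m])
  have intA: "integrable M (\<lambda>\<omega>. ?c * indicator A \<omega>)"
    using A by (intro integrable_mult_right integrable_real_indicator) (auto simp: emeasure_eq_measure)
  have intS: "integrable M (\<lambda>\<omega>. \<Sum>j\<le>m*m. ?G 1 j \<omega> + ?G (-1) j \<omega>)"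
    by (intro Bochner_Integration.integrable_sum Bochner_Integration.integrable_add intG)
  have "1 = (\<integral>\<omega>. ?R \<omega> \<partial>M)" using ER by simp
  also have "\<dots> \<le> (\<integral>\<omega>. ?c * indicator A \<omega> + (\<Sum>j\<le>m*m. ?G 1 j \<omega> + ?G (-1) j \<omega>) \<partial>M)"
  proof (rule integral_mono_AE[OF intR])
    show "integrable M (\<lambda>\<omega>. ?c * indicator A \<omega> + (\<Sum>j\<le>m*m. ?G 1 j \<omega> + ?G (-1) j \<omega>))"
      by (rule Bochner_Integration.integrable_add[OF intA intS])
    show "AE \<omega> in M. ?R \<omega> \<le> ?c * indicator A \<omega> + (\<Sum>j\<le>m*m. ?G 1 j \<omega> + ?G (-1) j \<omega>)"
      using near by eventually_elim (rule bound)
  qed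
  also have "\<dots> = ?c * measure M A + (\<Sum>j\<le>m*m. (\<integral>\<omega>. ?G 1 j \<omega> \<partial>M) + (\<integral>\<omega>. ?G (-1) j \<omega> \<partial>M))"
  proof -
    have 1: "(\<integral>\<omega>. ?c * indicator A \<omega> + (\<Sum>j\<le>m*m. ?G 1 j \<omega> + ?G (-1) j \<omega>) \<partial>M)
       = (\<integral>\<omega>. ?c * indicator A \<omega> \<partial>M) + (\<integral>\<omega>. (\<Sum>j\<le>m*m. ?G 1 j \<omega> + ?G (-1) j \<omega>) \<partial>M)"
      by (rule Bochner_Integration.integral_add[OF intA intS])
    have 2: "(\<integral>\<omega>. ?c * indicator A \<omega> \<partial>M) = ?c * measure M A" using A by simp
    have 3: "(\<integral>\<omega>. (\<Sum>j\<le>m*m. ?G 1 j \<omega> + ?G (-1) j \<omega>) \<partial>M) = (\<Sum>j\<le>m*m. \<integral>\<omega>. ?G 1 j \<omega> + ?G (-1) j \<omega> \<partial>M)"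
      by (rule Bochner_Integration.integral_sum) (rule Bochner_Integration.integrable_add[OF intG intG])
    have 4: "(\<Sum>j\<le>m*m. \<integral>\<omega>. ?G 1 j \<omega> + ?G (-1) j \<omega> \<partial>M)
        = (\<Sum>j\<le>m*m. (\<integral>\<omega>. ?G 1 j \<omega> \<partial>M) + (\<integral>\<omega>. ?G (-1) j \<omega> \<partial>M))"
      by (rule sum.cong[OF refl]) (rule Bochner_Integration.integral_add[OF intG intG])
    show ?thesis unfolding 1 2 3 4 ..
  qed
  also have "(\<Sum>j\<le>m*m. (\<integral>\<omega>. ?G 1 j \<omega> \<partial>M) + (\<integral>\<omega>. ?G (-1) j \<omega> \<partial>M))
      \<le> (\<Sum>j\<le>m*m. exp (- (real n * (e^2 / 4))) + exp (- (real n * (e^2 / 4))))"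
    by (intro sum_mono add_mono EG) auto
  also have "\<dots> = 2 * real (m*m+1) * exp (- (real n * (e^2 / 4)))" by simp
  finally show ?thesis by (simp add: mult.commute)
qed

end

section \<open>The rate function\<close>

text \<open>The limit inferior over fine grids of the infimal cost of the level \<open>a\<close>.
  Phrased through eventual lower bounds, so that neither attained minima nor convergence in
  \<open>m\<close> has to be established.\<close>

definition grate :: "real \<Rightarrow> real" where
  "grate a = Sup {c. \<exists>m0. \<forall>m\<ge>m0. \<forall>q. feas m a q \<longrightarrow> c \<le> KL (m*m) (gp m) q}"

lemma feas_mono: "feas m b q \<Longrightarrow> a \<le> b \<Longrightarrow> feas m a q"
  unfolding feas_def by (meson le_less_trans)

lemma feas_pvec: "feas m a q \<Longrightarrow> pvec (m*m) q" by (simp add: feas_def)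

text \<open>If all observations lie in \<open>[s, s\<^sup>2)\<close>, every ratio is below \<open>s\<close> and no observation is: all
  levels below 1 are reached at bounded cost.\<close>

lemma exists_feas:
  assumes a: "a < 1" and m: "3 \<le> m"
  shows "\<exists>q. feas m a q \<and> KL (m*m) (gp m) q \<le> 2"
proof -
  define w where "w = exp (- 1) - exp (- 2 :: real)"
  define q where "q = (\<lambda>j. if m \<le> j \<and> j < 2 * m then gp m j / w else 0)"
  have m0: "0 < m" using m by simp
  have J: "2 * m < m * m" using m by simp
  then have J': "\<forall>j. j < 2 * m \<longrightarrow> j \<le> m * m" by (meson less_trans less_imp_le)
  have p: "ref_pvec (m*m) (gp m)" by (rule ref_pvec_gp[OF m0])
  have "exp (- 1 :: real) = exp 1 * exp (- 2)" by (simp flip: exp_add)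
  moreover have "2 * exp (- 2) \<le> exp 1 * exp (- 2 :: real)"
    using exp_ge_add_one_self[of "1::real"] by (intro mult_right_mono) auto
  ultimately have w: "exp (- 2) \<le> w" by (simp add: w_def)
  then have w0: "0 < w" by (meson exp_gt_zero less_le_trans)
  have cumz: "cum q i = 0" if "i \<le> m" for i
    unfolding cum_def by (rule sum.neutral) (use that in \<open>auto simp: q_def\<close>)
  have "(\<Sum>j\<le>m*m. q j) = (\<Sum>j\<in>{m..<2*m}. gp m j / w)"
    by (rule sum.mono_neutral_cong_right) (use J' in \<open>auto simp: q_def\<close>)
  also have "\<dots> = (cum (gp m) (2*m) - cum (gp m) m) / w"
  proof -
    have "cum (gp m) (2*m) = cum (gp m) m + sum (gp m) {m..<2*m}"
      unfolding cum_def by (subst sum.union_disjoint[symmetric]) (auto intro!: sum.cong)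
    then show ?thesis by (simp add: sum_divide_distrib)
  qed
  also have "\<dots> = 1" using cum_gp[OF m0, of "2*m"] cum_gp[OF m0, of m] J m0 w0 by (simp add: w_def)
  finally have sq: "(\<Sum>j\<le>m*m. q j) = 1" .
  have q: "pvec (m*m) q"
    unfolding pvec_def
  proof (intro conjI allI impI sq)
    show "0 \<le> q j" for j using pvec_nonneg[OF ref_pvecD(1)[OF p], of j] w0 by (simp add: q_def)
    show "q j = 0" if "m * m < j" for j using J' that by (auto simp: q_def)
  qed
  have z: "q y * cum q (Suc y - m) ^ 3 = 0" for y
    using cumz[of "Suc y - m"] by (cases "y < 2 * m") (auto simp: q_def)
  have "(\<Sum>y\<le>m*m. q y * cum q (Suc y - m) ^ 3) = 0" by (intro sum.neutral ballI z)
  then have "kap (m*m) m q = 0" by (simp only: kap_def mult_zero_right)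
  moreover have "q (m*m) = 0" using J by (simp add: q_def)
  ultimately have "up_excess (m*m) m q = 1" using cumz[of m] by (simp add: up_excess_def)
  then have "feas m a q" using q a m0 by (auto simp: feas_def intro!: exI[of _ m])
  moreover have "KL (m*m) (gp m) q \<le> 2"
  proof -
    have "KL (m*m) (gp m) q = (\<Sum>j\<le>m*m. q j * (- ln w))"
      unfolding KL_def
      by (intro sum.cong refl) (use gp_pos[OF m0] w0 in \<open>auto simp: q_def ln_div less_imp_neq[symmetric]\<close>)
    also have "\<dots> = - ln w" by (simp only: sum_distrib_right[symmetric] sq mult_1)
    also have "\<dots> \<le> 2" using w w0 ln_le_cancel_iff[of "exp (-2)" w] by simp
    finally show ?thesis .
  qed
  ultimately show ?thesis by blast
qed

lemma grate_set:
  assumes "a < 1"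
  shows "0 \<in> {c. \<exists>m0. \<forall>m\<ge>m0. \<forall>q. feas m a q \<longrightarrow> c \<le> KL (m*m) (gp m) q}"
    and "\<And>c. c \<in> {c. \<exists>m0. \<forall>m\<ge>m0. \<forall>q. feas m a q \<longrightarrow> c \<le> KL (m*m) (gp m) q} \<Longrightarrow> c \<le> 2"
proof -
  have "\<forall>m\<ge>1. \<forall>q. feas m a q \<longrightarrow> 0 \<le> KL (m*m) (gp m) q"
    using KL_nonneg[OF ref_pvec_gp feas_pvec] by auto
  then show "0 \<in> {c. \<exists>m0. \<forall>m\<ge>m0. \<forall>q. feas m a q \<longrightarrow> c \<le> KL (m*m) (gp m) q}" by blast
  fix c assume "c \<in> {c. \<exists>m0. \<forall>m\<ge>m0. \<forall>q. feas m a q \<longrightarrow> c \<le> KL (m*m) (gp m) q}"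
  then obtain m0 where m0: "\<And>m q. m0 \<le> m \<Longrightarrow> feas m a q \<Longrightarrow> c \<le> KL (m*m) (gp m) q" by blast
  obtain q where "feas (max m0 3) a q" "KL (max m0 3 * max m0 3) (gp (max m0 3)) q \<le> 2"
    using exists_feas[OF assms, of "max m0 3"] by auto
  then show "c \<le> 2" using m0[of "max m0 3" q] by simp
qed

lemma grate_bdd:
  assumes "a < 1"
  shows "bdd_above {c. \<exists>m0. \<forall>m\<ge>m0. \<forall>q. feas m a q \<longrightarrow> c \<le> KL (m*m) (gp m) q}"
  by (rule bdd_aboveI[of _ 2]) (rule grate_set(2)[OF assms])

lemma grate_ge:
  assumes "a < 1" "\<And>m q. m0 \<le> m \<Longrightarrow> feas m a q \<Longrightarrow> c \<le> KL (m*m) (gp m) q"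
  shows "c \<le> grate a"
  unfolding grate_def by (rule cSup_upper[OF _ grate_bdd[OF assms(1)]]) (use assms(2) in blast)

lemma grate_le_2: "a < 1 \<Longrightarrow> grate a \<le> 2"
  unfolding grate_def by (rule cSup_least) (use grate_set in blast)+

lemma less_grateD:
  assumes "a < 1" "c < grate a"
  shows "\<exists>m0. \<forall>m\<ge>m0. \<forall>q. feas m a q \<longrightarrow> c < KL (m*m) (gp m) q"
proof -
  have "{c. \<exists>m0. \<forall>m\<ge>m0. \<forall>q. feas m a q \<longrightarrow> c \<le> KL (m*m) (gp m) q} \<noteq> {}"
    using grate_set(1)[OF assms(1)] by blast
  then obtain d where "c < d" "d \<in> {c. \<exists>m0. \<forall>m\<ge>m0. \<forall>q. feas m a q \<longrightarrow> c \<le> KL (m*m) (gp m) q}"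
    using less_cSupD[OF _ assms(2)[unfolded grate_def]] by blast
  then obtain m0 where "\<forall>m\<ge>m0. \<forall>q. feas m a q \<longrightarrow> d \<le> KL (m*m) (gp m) q" by blast
  then have "\<forall>m\<ge>m0. \<forall>q. feas m a q \<longrightarrow> c < KL (m*m) (gp m) q" using \<open>c < d\<close> by (meson less_le_trans)
  then show ?thesis by blast
qed

lemma grate_lessD:
  assumes "a < 1" "grate a < c"
  shows "\<exists>m\<ge>m0. \<exists>q. feas m a q \<and> KL (m*m) (gp m) q < c"
proof (rule ccontr)
  assume "\<not> ?thesis"
  then have "c \<le> KL (m*m) (gp m) q" if "m0 \<le> m" "feas m a q" for m q using that by (meson not_le)
  then have "c \<le> grate a" by (rule grate_ge[OF assms(1)])
  then show False using assms by simp
qed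

lemma grate_mono:
  assumes "a \<le> b" "b < 1" shows "grate a \<le> grate b"
proof (rule ccontr)
  assume "\<not> ?thesis"
  then have "grate b < grate a" by simp
  then obtain c where c: "grate b < c" "c < grate a" using dense by blast
  obtain m0 where m0: "\<forall>m\<ge>m0. \<forall>q. feas m a q \<longrightarrow> c < KL (m*m) (gp m) q"
    using less_grateD[of a c] c assms by auto
  obtain m q where "m0 \<le> m" "feas m b q" "KL (m*m) (gp m) q < c" using grate_lessD[OF assms(2) c(1)] by blast
  then show False using m0 feas_mono[OF _ assms(1)] by (meson less_asym)
qed

text \<open>Continuity from the right, transferred from single distributions by
  \<open>perturb_level\<close>, uniformly in the level.\<close>

lemma grate_perturb:
  assumes a: "0 < a1" "a1 \<le> a2" "a2 < 1" and om: "0 < om"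
  shows "\<exists>\<eta>>0. \<forall>a d. a1 \<le> a \<longrightarrow> a \<le> a2 \<longrightarrow> 0 \<le> d \<longrightarrow> d \<le> \<eta> \<longrightarrow> a + d < 1 \<longrightarrow> grate (a + d) \<le> grate a + om"
proof -
  obtain \<eta> m0 where \<eta>: "0 < \<eta>" and pert: "\<And>m q a. m0 \<le> m \<Longrightarrow> a1 \<le> a \<Longrightarrow> a \<le> a2 \<Longrightarrow> feas m a q \<Longrightarrow>
      KL (m*m) (gp m) q \<le> 2 \<Longrightarrow> \<exists>q'. feas m (a + \<eta>) q' \<and> KL (m*m) (gp m) q' \<le> KL (m*m) (gp m) q + om"
    using perturb_level[OF a om, of 2] by (metis zero_le_numeral)
  have "grate (t + d) \<le> grate t + om" if t: "a1 \<le> t" "t \<le> a2" "0 \<le> d" "d \<le> \<eta>" "t + d < 1" for t d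
  proof (rule ccontr)
    assume "\<not> ?thesis"
    then have "grate t < grate (t + d) - om" by simp
    then obtain c where c: "grate t < c" "c < grate (t + d) - om" using dense by blast
    have t1: "t < 1" using t by simp
    obtain m1 where m1: "\<And>m q. m1 \<le> m \<Longrightarrow> feas m (t + d) q \<Longrightarrow> c + om < KL (m*m) (gp m) q"
      using less_grateD[of "t + d" "c + om"] c t by auto
    obtain m q where m: "max m0 m1 \<le> m" and q: "feas m t q" "KL (m*m) (gp m) q < c"
      using grate_lessD[OF t1 c(1)] by blast
    have "c \<le> 2" using c grate_le_2[OF t(5)] om by simp
    then obtain q' where q': "feas m (t + \<eta>) q'" "KL (m*m) (gp m) q' \<le> KL (m*m) (gp m) q + om"
      using pert[of m t q] m q t by auto
    have "feas m (t + d) q'" by (rule feas_mono[OF q'(1)]) (use t in simp)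
    then show False using m1[of m q'] m q q' by auto
  qed
  then show ?thesis using \<eta> by blast
qed

lemma isCont_grate:
  assumes a: "0 < a" "a < 1" shows "isCont grate a"
  unfolding continuous_at_eps_delta
proof (intro allI impI)
  fix e :: real assume e: "0 < e"
  have "0 < a/2" "a/2 \<le> a" "0 < e/2" using a e by auto
  then obtain \<eta> where \<eta>: "0 < \<eta>" "\<And>t d. a/2 \<le> t \<Longrightarrow> t \<le> a \<Longrightarrow> 0 \<le> d \<Longrightarrow> d \<le> \<eta> \<Longrightarrow> t + d < 1 \<Longrightarrow> grate (t + d) \<le> grate t + e/2"
    using grate_perturb[of "a/2" a "e/2"] a by blast
  define d where "d = min \<eta> (min (a/2) ((1 - a)/2))"
  have d: "0 < d" using \<eta>(1) a by (simp add: d_def)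
  have d2: "d \<le> \<eta>" "d \<le> a/2" "d \<le> (1-a)/2"
    unfolding d_def by (meson min.cobounded1 min.cobounded2 order_trans)+
  have "dist (grate t) (grate a) < e" if "dist t a < d" for t
  proof -
    have ta: "a - d < t" "t < a + d" "t < 1" using that d d2 a by (auto simp: dist_real_def)
    show ?thesis
    proof (cases "a \<le> t")
      case True
      have "grate a \<le> grate t" by (rule grate_mono) (use True ta in auto)
      moreover have "grate (a + (t - a)) \<le> grate a + e/2" by (rule \<eta>(2)) (use True ta d d2 a in auto)
      ultimately show ?thesis using e by (simp add: dist_real_def)
    next
      case False
      have "grate t \<le> grate a" by (rule grate_mono) (use False ta a in auto)
      moreover have "grate (t + (a - t)) \<le> grate t + e/2" by (rule \<eta>(2)) (use False ta d d2 a in auto)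
      ultimately show ?thesis using e by (simp add: dist_real_def)
    qed
  qed
  then show "\<exists>d>0. \<forall>x'. dist x' a < d \<longrightarrow> dist (grate x') (grate a) < e" using d by blast
qed

section \<open>The large deviation limit\<close>

lemma cum_diff_le:
  assumes "\<And>j. \<bar>r j - q j\<bar> \<le> e"
  shows "\<bar>cum r k - cum q k\<bar> \<le> real k * e"
proof -
  have "\<bar>cum r k - cum q k\<bar> = \<bar>\<Sum>j<k. r j - q j\<bar>" by (simp add: cum_def sum_subtractf)
  also have "\<dots> \<le> (\<Sum>j<k. \<bar>r j - q j\<bar>)" by (rule sum_abs)
  also have "\<dots> \<le> (\<Sum>j<k. e)" by (intro sum_mono assms)
  finally show ?thesis by simp
qed

text \<open>A crude Lipschitz bound; the constant depends on the grid, which is fixed when it is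
  used.\<close>

lemma kap_diff_le:
  assumes q: "pvec J q" and r: "pvec J r" and d: "\<And>j. \<bar>r j - q j\<bar> \<le> e"
  shows "\<bar>kap J k r - kap J k q\<bar> \<le> 4 * real (J + 1) * (3 * real (J + 1) + 1) * e"
proof -
  have e: "0 \<le> e" using d[of 0] by linarith
  have t: "\<bar>r y * cum r (Suc y - k) ^ 3 - q y * cum q (Suc y - k) ^ 3\<bar> \<le> (3 * real (J + 1) + 1) * e" if y: "y \<le> J" for y
  proof -
    let ?a = "cum r (Suc y - k)" and ?b = "cum q (Suc y - k)"
    have ab: "0 \<le> ?a" "?a \<le> 1" "0 \<le> ?b" "?b \<le> 1" using pvec_cum(1,2)[OF q] pvec_cum(1,2)[OF r] by auto
    have "\<bar>?a - ?b\<bar> \<le> real (Suc y - k) * e" by (rule cum_diff_le[OF d])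
    also have "\<dots> \<le> real (J + 1) * e" using y e by (intro mult_right_mono) auto
    finally have c: "\<bar>?a - ?b\<bar> \<le> real (J + 1) * e" .
    have "?a^3 - ?b^3 = (?a - ?b) * (?a * ?a + ?a * ?b + ?b * ?b)" by (simp add: algebra_simps power3_eq_cube)
    then have "\<bar>?a^3 - ?b^3\<bar> = \<bar>?a - ?b\<bar> * \<bar>?a * ?a + ?a * ?b + ?b * ?b\<bar>" by (simp only: abs_mult)
    also have "\<dots> \<le> (real (J + 1) * e) * 3"
    proof (rule mult_mono[OF c])
      have "?a * ?a \<le> 1" "?a * ?b \<le> 1" "?b * ?b \<le> 1" "0 \<le> ?a * ?a" "0 \<le> ?a * ?b" "0 \<le> ?b * ?b"
        using ab by (auto intro!: mult_le_one)
      then show "\<bar>?a * ?a + ?a * ?b + ?b * ?b\<bar> \<le> 3" by linarith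
    qed (use e in auto)
    finally have c3: "\<bar>?a^3 - ?b^3\<bar> \<le> 3 * (real (J + 1) * e)" by simp
    have a3: "\<bar>?a^3\<bar> \<le> 1" using ab by (simp add: power_le_one)
    have "r y * ?a^3 - q y * ?b^3 = (r y - q y) * ?a^3 + q y * (?a^3 - ?b^3)" by (simp add: algebra_simps)
    then have "\<bar>r y * ?a^3 - q y * ?b^3\<bar> \<le> \<bar>(r y - q y) * ?a^3\<bar> + \<bar>q y * (?a^3 - ?b^3)\<bar>" by linarith
    also have "\<bar>(r y - q y) * ?a^3\<bar> \<le> e * 1"
      unfolding abs_mult using d[of y] a3 e by (intro mult_mono) auto
    also have "\<bar>q y * (?a^3 - ?b^3)\<bar> \<le> 1 * (3 * (real (J + 1) * e))"
      unfolding abs_mult using c3 pvec_le_1[OF q, of y] pvec_nonneg[OF q, of y] by (intro mult_mono) auto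
    finally show ?thesis by (simp add: algebra_simps)
  qed
  have "\<bar>kap J k r - kap J k q\<bar> = 4 * \<bar>\<Sum>y\<le>J. r y * cum r (Suc y - k) ^ 3 - q y * cum q (Suc y - k) ^ 3\<bar>"
    unfolding kap_def sum_subtractf by (simp only: right_diff_distrib[symmetric] abs_mult abs_numeral diff_diff_eq2 diff_add_cancel add_diff_cancel_left add_diff_cancel_right minus_diff_eq diff_minus_eq_add)
  also have "\<dots> \<le> 4 * (\<Sum>y\<le>J. \<bar>r y * cum r (Suc y - k) ^ 3 - q y * cum q (Suc y - k) ^ 3\<bar>)"
    by (intro mult_left_mono sum_abs) auto
  also have "\<dots> \<le> 4 * (\<Sum>y\<le>J. (3 * real (J + 1) + 1) * e)"
    using t by (intro mult_left_mono sum_mono) auto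
  finally show ?thesis by (simp add: algebra_simps)
qed

text \<open>Feasibility of a level is an open condition on the distribution.\<close>

lemma feas_open:
  assumes f: "feas m a q"
  shows "\<exists>e>0. \<exists>d>0. \<forall>r. pvec (m*m) r \<longrightarrow> (\<forall>j\<le>m*m. \<bar>r j - q j\<bar> \<le> e) \<longrightarrow>
     (\<exists>k. 1 \<le> k \<and> k \<le> m*m \<and> (a + d < up_excess (m*m) k r \<or> a + d < down_excess (m*m) k r))"
proof -
  let ?J = "m * m"
  obtain k where q: "pvec ?J q" and k: "1 \<le> k" "k \<le> ?J"
    and a: "a < up_excess ?J k q \<or> a < down_excess ?J k q" using f by (auto simp: feas_def)
  define g where "g = max (up_excess ?J k q) (down_excess ?J k q) - a"
  define L where "L = 4 * real (?J + 1) * (3 * real (?J + 1) + 1) + real k + 4"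
  have g: "0 < g" using a by (auto simp: g_def)
  have L: "0 < L" unfolding L_def by (intro add_nonneg_pos) auto
  define e where "e = g / (3 * L)"
  have e: "0 < e" "L * e = g / 3" using g L by (auto simp: e_def)
  have main: "a + g/3 < up_excess ?J k r \<or> a + g/3 < down_excess ?J k r"
    if r: "pvec ?J r" and d: "\<And>j. j \<le> ?J \<Longrightarrow> \<bar>r j - q j\<bar> \<le> e" for r
  proof -
    have d': "\<bar>r j - q j\<bar> \<le> e" for j using d[of j] q r e by (cases "j \<le> ?J") (auto simp: pvec_def)
    have "\<bar>kap ?J k r - kap ?J k q\<bar> \<le> 4 * real (?J + 1) * (3 * real (?J + 1) + 1) * e" by (rule kap_diff_le[OF q r d'])
    moreover have "\<bar>kap ?J (k+1) r - kap ?J (k+1) q\<bar> \<le> 4 * real (?J + 1) * (3 * real (?J + 1) + 1) * e" by (rule kap_diff_le[OF q r d'])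
    moreover have "\<bar>cum r k - cum q k\<bar> \<le> real k * e" by (rule cum_diff_le[OF d'])
    moreover have "\<bar>r ?J - q ?J\<bar> \<le> e" by (rule d')
    moreover have "4 * real (?J + 1) * (3 * real (?J + 1) + 1) * e + real k * e + 4 * e = g / 3"
      using e(2) by (simp only: L_def distrib_right)
    ultimately have b: "up_excess ?J k q - g/3 \<le> up_excess ?J k r" "down_excess ?J k q - g/3 \<le> down_excess ?J k r"
      using e(1) unfolding up_excess_def down_excess_def by linarith+
    show ?thesis
    proof (cases "down_excess ?J k q \<le> up_excess ?J k q")
      case True
      then have "g = up_excess ?J k q - a" by (simp add: g_def)
      then have "a + g/3 < up_excess ?J k r" using b(1) g by linarith
      then show ?thesis ..
    next
      case False
      then have "g = down_excess ?J k q - a" by (simp add: g_def)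
      then have "a + g/3 < down_excess ?J k r" using b(2) g by linarith
      then show ?thesis ..
    qed
  qed
  have g3: "0 < g/3" using g by simp
  show ?thesis
  proof (rule exI[of _ e], rule conjI[OF e(1)], rule exI[of _ "g/3"], rule conjI[OF g3], intro allI impI)
    fix r assume "pvec ?J r" "\<forall>j\<le>?J. \<bar>r j - q j\<bar> \<le> e"
    then show "\<exists>k. 1 \<le> k \<and> k \<le> ?J \<and> (a + g/3 < up_excess ?J k r \<or> a + g/3 < down_excess ?J k r)"
      using main[of r] k by blast
  qed
qed

lemma eventually_le_inverse:
  fixes K c :: real
  assumes "0 < c" shows "\<forall>\<^sub>F n in sequentially. K / real n \<le> c"
proof -
  have "(\<lambda>n. K / real n) \<longlonglongrightarrow> 0" by (rule lim_const_over_n)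
  then have "\<forall>\<^sub>F n in sequentially. K / real n < c" using assms by (rule order_tendstoD)
  then show ?thesis by eventually_elim simp
qed

context
  fixes M :: "'a measure" and X :: "nat \<Rightarrow> 'a \<Rightarrow> real" and lam :: real
  assumes iid: "iid_pareto M X lam" and lam: "0 < lam"
begin

abbreviation P_D :: "real \<Rightarrow> nat \<Rightarrow> real" where
  "P_D a n \<equiv> measure M {\<omega> \<in> space M. D_stat n (\<lambda>i. X i \<omega>) > a}"

lemma D_event: "{\<omega> \<in> space M. D_stat n (\<lambda>i. X i \<omega>) > a} \<in> sets M"
  by (rule D_stat_measurable) (rule X_meas[OF iid lam zero_less_one])

text \<open>A nearly optimal \<open>q\<close> on one fixed grid has a neighbourhood of feasible
  distributions, which by tilting has at least the probability \<open>exp (- n KL)\<close> up to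
  subexponential factors.\<close>

lemma P_D_lower:
  assumes a: "a < 1" and om: "0 < om"
  shows "\<forall>\<^sub>F n in sequentially. exp (- (real n * (grate a + om))) \<le> P_D a n"
proof -
  have "grate a < grate a + om / 4" using om by simp
  then obtain m q where m: "1 \<le> m" and q: "feas m a q" "KL (m*m) (gp m) q < grate a + om / 4"
    using grate_lessD[OF a, of "grate a + om / 4" 1] by blast
  have m0: "0 < m" using m by simp
  let ?J = "m * m"
  define S where "S = (\<Sum>j\<le>?J. \<bar>ln (q j / gp m j)\<bar>)"
  have S: "0 \<le> S" unfolding S_def by (intro sum_nonneg) auto
  obtain e0 d where e0: "0 < e0" and d: "0 < d" and open_q: "\<And>r. pvec ?J r \<Longrightarrow> (\<forall>j\<le>?J. \<bar>r j - q j\<bar> \<le> e0) \<Longrightarrow>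
     (\<exists>k. 1 \<le> k \<and> k \<le> ?J \<and> (a + d < up_excess ?J k r \<or> a + d < down_excess ?J k r))"
    using feas_open[OF q(1)] by blast
  define e where "e = min e0 (min 1 (om / (4 * (S + 1))))"
  have "0 < om / (4 * (S + 1))" using om S by simp
  then have e: "0 < e" "e \<le> 1" "e \<le> e0" "e \<le> om / (4 * (S + 1))" using e0 unfolding e_def by linarith+
  have eS: "e * S \<le> om / 4"
  proof -
    have "e * S \<le> e * (S + 1)" using e by (intro mult_left_mono) auto
    also have "\<dots> \<le> om / 4" using e(4) S by (simp add: field_simps)
    finally show ?thesis .
  qed
  define K where "K = 2 * real (?J + 1)"
  have e2: "0 < e^2 / 4" using e by simp
  have "\<forall>\<^sub>F n in sequentially. 48 / real n \<le> d / 2" using d by (intro eventually_le_inverse) simp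
  moreover have "\<forall>\<^sub>F n in sequentially. K / (e^2/4) / real n \<le> 1/2" by (intro eventually_le_inverse) simp
  moreover have "\<forall>\<^sub>F n in sequentially. 1 / real n \<le> om / 2" using om by (intro eventually_le_inverse) simp
  moreover have "\<forall>\<^sub>F n in sequentially. (12::nat) \<le> n" by (rule eventually_ge_at_top)
  ultimately show ?thesis
  proof eventually_elim
    case (elim n)
    have n0: "0 < n" using elim by simp
    have near: "AE \<omega> in M. (\<forall>j\<le>?J. \<bar>freq n (\<lambda>i. cell m (lam * ln (X i \<omega>))) j - q j\<bar> \<le> e) \<longrightarrow>
        \<omega> \<in> {\<omega> \<in> space M. D_stat n (\<lambda>i. X i \<omega>) > a}"
      using X_AE[OF iid lam zero_less_one, of n] AE_space
    proof eventually_elim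
      case w: (elim \<omega>)
      show ?case
      proof
        assume nr: "\<forall>j\<le>?J. \<bar>freq n (\<lambda>i. cell m (lam * ln (X i \<omega>))) j - q j\<bar> \<le> e"
        let ?r = "freq n (\<lambda>i. cell m (lam * ln (X i \<omega>)))"
        have "pvec ?J ?r" using n0 cell_le by (intro freq_pvec) auto
        moreover have "\<forall>j\<le>?J. \<bar>?r j - q j\<bar> \<le> e0" using nr e(3) by (meson order_trans)
        ultimately obtain k where k: "1 \<le> k" "k \<le> ?J" "a + d < up_excess ?J k ?r \<or> a + d < down_excess ?J k ?r"
          using open_q by blast
        have x1: "1 \<le> X i \<omega>" if "i \<in> {1..n}" for i using w(1) that by blast
        have ex: "a + 48 / n < up_excess ?J k ?r \<or> a + 48 / n < down_excess ?J k ?r"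
          using k(3) elim(1) d by linarith
        have "a < D_stat n (\<lambda>i. X i \<omega>)"
          by (rule excess_imp_D_stat[where x="\<lambda>i. X i \<omega>", OF elim(4) m0 lam x1 refl refl k(1,2) ex])
        then show "\<omega> \<in> {\<omega> \<in> space M. D_stat n (\<lambda>i. X i \<omega>) > a}" using w(2) by simp
      qed
    qed
    have T: "1 \<le> P_D a n * exp (real n * (KL ?J (gp m) q + e * S)) + 2 * real (?J + 1) * exp (- (real n * (e^2 / 4)))"
      unfolding S_def by (rule prob_tilting_lower[OF iid lam m0 n0 D_event feas_pvec[OF q(1)] e(1,2) near])
    have "K * exp (- (real n * (e^2/4))) \<le> 1/2"
    proof -
      have "exp (- (real n * (e^2/4))) = 1 / exp (real n * (e^2/4))" by (simp add: exp_minus inverse_eq_divide)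
      also have "\<dots> \<le> 1 / (real n * (e^2/4))"
      proof (rule divide_left_mono)
        show "real n * (e^2/4) \<le> exp (real n * (e^2/4))" using exp_ge_add_one_self[of "real n * (e^2/4)"] by linarith
      qed (use n0 e in auto)
      finally have "K * exp (- (real n * (e^2/4))) \<le> K * (1 / (real n * (e^2/4)))" unfolding K_def by (intro mult_left_mono) auto
      also have "\<dots> = K / (e^2/4) / real n" by simp
      finally show ?thesis using elim(2) by linarith
    qed
    then have "1/2 \<le> P_D a n * exp (real n * (KL ?J (gp m) q + e * S))" using T unfolding K_def by linarith
    also have "\<dots> \<le> P_D a n * exp (real n * (grate a + om / 2))"
    proof (intro mult_left_mono iffD2[OF exp_le_cancel_iff])
      show "KL ?J (gp m) q + e * S \<le> grate a + om / 2" using q eS by linarith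
    qed auto
    finally have half: "1/2 \<le> P_D a n * exp (real n * (grate a + om / 2))" .
    have "exp (- (real n * (grate a + om))) * exp (real n * (grate a + om / 2)) = exp (- (real n * (om / 2)))"
      unfolding exp_add[symmetric] by (simp add: algebra_simps)
    also have "\<dots> \<le> exp (- 1)"
      using elim(3) n0 by (simp add: field_simps)
    also have "\<dots> \<le> 1/2"
      using exp_ge_add_one_self[of "1::real"] by (simp add: exp_minus field_simps)
    also note half
    finally show ?case by simp
  qed
qed

text \<open>Samples whose type has entropy above 3 are cheap to discard since the rate is at most
  2. All other types have small cells, so the event makes them feasible for a slightly smaller
  level; raising the level back costs at most \<open>om / 4\<close>.\<close>

lemma P_D_upper:
  assumes a: "0 < a" "a < 1" and om: "0 < om"
  shows "\<forall>\<^sub>F n in sequentially. P_D a n \<le> exp (- (real n * (grate a - om)))"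
proof -
  interpret prob_space M by (rule X_prob_space[OF iid lam zero_less_one])
  have a2: "0 < a/2" "a/2 \<le> a" "0 < om/4" using a om by auto
  obtain \<eta>0 m0 where \<eta>0: "0 < \<eta>0" and pert: "\<And>m q t. m0 \<le> m \<Longrightarrow> a/2 \<le> t \<Longrightarrow> t \<le> a \<Longrightarrow> feas m t q \<Longrightarrow>
      KL (m*m) (gp m) q \<le> 3 \<Longrightarrow> \<exists>q'. feas m (t + \<eta>0) q' \<and> KL (m*m) (gp m) q' \<le> KL (m*m) (gp m) q + om/4"
    using perturb_level[OF a2(1,2) a(2) a2(3), of 3] by (metis zero_le_numeral)
  define \<eta> where "\<eta> = min \<eta>0 (a/2)"
  have \<eta>: "0 < \<eta>" "\<eta> \<le> \<eta>0" "\<eta> \<le> a/2" using \<eta>0 a unfolding \<eta>_def by linarith+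
  define \<delta> where "\<delta> = \<eta> / 40"
  have \<delta>: "0 < \<delta>" using \<eta> by (simp add: \<delta>_def)
  obtain m1 where m1: "\<And>m q. m1 \<le> m \<Longrightarrow> feas m a q \<Longrightarrow> grate a - om/4 < KL (m*m) (gp m) q"
    using less_grateD[OF a(2), of "grate a - om/4"] om by auto
  obtain m3 where m3: "\<And>m q j. m3 \<le> m \<Longrightarrow> pvec (m*m) q \<Longrightarrow> KL (m*m) (gp m) q \<le> 3 \<Longrightarrow> q j \<le> \<delta>"
    using eventually_small_cells[OF \<delta>, of 3] by (metis zero_le_numeral)
  define m where "m = Suc (max m0 (max m1 m3))"
  have m: "0 < m" "m0 \<le> m" "m1 \<le> m" "m3 \<le> m" by (auto simp: m_def)
  let ?J = "m * m"
  define b where "b = grate a - om/2"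
  define K where "K = real (?J + 1)"
  have "(\<lambda>n. K * (1 / real n + ln (real n) / real n)) \<longlonglongrightarrow> K * (0 + 0)"
    by (intro tendsto_intros lim_ln_over_n lim_const_over_n)
  then have "\<forall>\<^sub>F n in sequentially. K * (1 / real n + ln (real n) / real n) < om / 2"
    using om by (intro order_tendstoD(2)[where y="K * (0 + 0)"]) auto
  moreover have "\<forall>\<^sub>F n in sequentially. 48 / real n \<le> \<eta> / 4" using \<eta> by (intro eventually_le_inverse) simp
  moreover have "\<forall>\<^sub>F n in sequentially. (12::nat) \<le> n" by (rule eventually_ge_at_top)
  ultimately show ?thesis
  proof eventually_elim
    case (elim n)
    have n0: "0 < n" using elim by simp
    define A where "A = {\<omega> \<in> space M. D_stat n (\<lambda>i. X i \<omega>) > a} \<inter> {\<omega> \<in> space M. \<forall>i\<in>{1..n}. 1 \<le> X i \<omega>}"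
    have "{\<omega> \<in> space M. \<forall>i\<in>{1..n}. 1 \<le> X i \<omega>} \<in> sets M"
      using X_meas[OF iid lam zero_less_one] by (intro sets.sets_Collect_finite_All borel_measurable_le borel_measurable_const) auto
    then have A: "A \<in> sets M" unfolding A_def by (intro sets.Int D_event)
    have "P_D a n = measure M A"
    proof (rule finite_measure_eq_AE[OF _ D_event A])
      show "AE \<omega> in M. (\<omega> \<in> {\<omega> \<in> space M. D_stat n (\<lambda>i. X i \<omega>) > a}) = (\<omega> \<in> A)"
        using X_AE[OF iid lam zero_less_one, of n] by eventually_elim (auto simp: A_def)
    qed
    also have "measure M A \<le> real (n + 1) ^ (?J + 1) * exp (- (real n * b))"
    proof (rule prob_types_upper[OF iid lam m(1) n0 A])
      fix \<omega> assume w: "\<omega> \<in> A"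
      let ?q = "freq n (\<lambda>i. cell m (lam * ln (X i \<omega>)))"
      have pv: "pvec ?J ?q" using n0 cell_le by (intro freq_pvec) auto
      show "b \<le> KL ?J (gp m) ?q"
      proof (cases "KL ?J (gp m) ?q \<le> 3")
        case False
        then show ?thesis using grate_le_2[OF a(2)] om by (simp add: b_def)
      next
        case True
        have x1: "1 \<le> X i \<omega>" if "i \<in> {1..n}" for i using w that by (simp add: A_def)
        have D: "a < D_stat n (\<lambda>i. X i \<omega>)" using w by (simp add: A_def)
        have cells_small: "?q j \<le> \<delta>" for j by (rule m3[OF m(4) pv True])
        have lev: "20 * \<delta> + 48 / n \<le> a" using elim(2) \<eta> unfolding \<delta>_def by linarith
        have "feas m (a - 17 * \<delta> - 48 / n) ?q"
          by (rule D_stat_imp_feas[OF elim(3) m(1) lam x1 refl refl D cells_small lev])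
        then have f: "feas m (a - \<eta>) ?q" by (rule feas_mono) (use elim(2) \<eta> in \<open>simp add: \<delta>_def\<close>)
        obtain q' where q': "feas m (a - \<eta> + \<eta>0) q'" "KL ?J (gp m) q' \<le> KL ?J (gp m) ?q + om/4"
          using pert[OF m(2) _ _ f True] \<eta> by auto
        have "feas m a q'" by (rule feas_mono[OF q'(1)]) (use \<eta> in simp)
        then show ?thesis using m1[OF m(3), of q'] q'(2) unfolding b_def by linarith
      qed
    qed
    also have "\<dots> \<le> exp (real n * (om/2)) * exp (- (real n * b))"
    proof (rule mult_right_mono)
      have "ln (real (n + 1)) \<le> ln (2 * real n)" using n0 by (subst ln_le_cancel_iff) auto
      also have "\<dots> \<le> 1 + ln (real n)" using n0 ln_le_minus_one[of 2] by (simp add: ln_mult)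
      finally have l: "ln (real (n + 1)) \<le> 1 + ln (real n)" .
      have "real (n + 1) ^ (?J + 1) = exp (K * ln (real (n + 1)))"
        unfolding K_def exp_of_nat_mult by simp
      also have "\<dots> \<le> exp (real n * (om/2))"
      proof (rule iffD2[OF exp_le_cancel_iff])
        have "K * ln (real (n + 1)) \<le> K * (1 + ln (real n))" using l unfolding K_def by (intro mult_left_mono) auto
        also have "\<dots> = real n * (K * (1 / real n + ln (real n) / real n))" using n0 by (simp add: field_simps)
        also have "\<dots> \<le> real n * (om/2)" using elim(1) by (intro mult_left_mono) auto
        finally show "K * ln (real (n + 1)) \<le> real n * (om/2)" .
      qed
      finally show "real (n + 1) ^ (?J + 1) \<le> exp (real n * (om/2))" .
    qed simp
    also have "\<dots> = exp (- (real n * (grate a - om)))"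
      unfolding exp_add[symmetric] b_def by (simp add: algebra_simps)
    finally show ?case .
  qed
qed

lemma large_deviation_limit:
  assumes a: "0 < a"
  shows "(\<lambda>n. ereal (1 / real n) * ln_prob (P_D a n)) \<longlonglongrightarrow> - (if a < 1 then ereal (grate a) else \<infinity>)"
proof (cases "a < 1")
  case True
  have "\<forall>\<^sub>F n in sequentially. exp (- (real n * (grate a + 1))) \<le> P_D a n" by (rule P_D_lower[OF True]) simp
  then have pos: "\<forall>\<^sub>F n in sequentially. 0 < P_D a n"
    by eventually_elim (meson exp_gt_zero less_le_trans)
  have "(\<lambda>n. ln (P_D a n) / real n) \<longlonglongrightarrow> - grate a"
  proof (rule tendstoI)
    fix e :: real assume e: "0 < e"
    have e2: "0 < e/2" using e by simp
    show "\<forall>\<^sub>F n in sequentially. dist (ln (P_D a n) / real n) (- grate a) < e"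
      using pos P_D_lower[OF True e2] P_D_upper[OF a True e2] eventually_gt_at_top[of 0]
    proof eventually_elim
      case (elim n)
      have "ln (exp (- (real n * (grate a + e/2)))) \<le> ln (P_D a n)" using elim by (subst ln_le_cancel_iff) auto
      then have 1: "- (grate a + e/2) \<le> ln (P_D a n) / real n" using elim(4) by (simp add: field_simps)
      have "ln (P_D a n) \<le> ln (exp (- (real n * (grate a - e/2))))" using elim by (subst ln_le_cancel_iff) auto
      then have 2: "ln (P_D a n) / real n \<le> - (grate a - e/2)" using elim(4) by (simp add: field_simps)
      show ?case unfolding dist_real_def using 1 2 e by linarith
    qed
  qed
  then have "(\<lambda>n. ereal (ln (P_D a n) / real n)) \<longlonglongrightarrow> ereal (- grate a)" by (rule tendsto_ereal)
  moreover have "\<forall>\<^sub>F n in sequentially. ereal (ln (P_D a n) / real n) = ereal (1 / real n) * ln_prob (P_D a n)"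
    using pos by eventually_elim (simp add: ln_prob_def)
  ultimately have "(\<lambda>n. ereal (1 / real n) * ln_prob (P_D a n)) \<longlonglongrightarrow> ereal (- grate a)"
    by (rule Lim_transform_eventually)
  then show ?thesis using True by simp
next
  case False
  have "P_D a n = 0" for n
  proof -
    have "\<not> a < D_stat n (\<lambda>i. X i \<omega>)" for \<omega> using False D_stat_le_1[of n "\<lambda>i. X i \<omega>"] by linarith
    then show ?thesis by simp
  qed
  then have "\<forall>\<^sub>F n in sequentially. - \<infinity> = ereal (1 / real n) * ln_prob (P_D a n)"
    by (intro eventually_sequentiallyI[of 1]) (simp add: ln_prob_def)
  then have "(\<lambda>n. ereal (1 / real n) * ln_prob (P_D a n)) \<longlonglongrightarrow> - \<infinity>"
    by (rule Lim_transform_eventually[OF tendsto_const])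
  then show ?thesis using False by simp
qed

end

section \<open>The variance of the projection\<close>

definition pareto_measure :: "real measure" where
  "pareto_measure = density lborel (\<lambda>s. ennreal (indicator {1..} s / s\<^sup>2))"

lemma integral_inverse_square_nonneg:
  fixes p P :: "real \<Rightarrow> real"
  assumes a: "1 \<le> a" and P: "\<And>w. (P has_field_derivative p w) (at w)"
    and p: "\<And>w. 0 \<le> w \<Longrightarrow> w \<le> 1 \<Longrightarrow> 0 \<le> p w" and c: "continuous_on UNIV p"
  shows "has_bochner_integral lborel (\<lambda>s. indicator {a..} s * (p (1 / s) / s\<^sup>2)) (P (1 / a) - P 0)"
proof -
  define f where "f = (\<lambda>s. p (1 / s) / s\<^sup>2)"
  have pm[measurable]: "p \<in> borel_measurable borel" by (rule borel_measurable_continuous_onI[OF c])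
  have fm: "f \<in> borel_measurable borel" unfolding f_def by measurable
  have nn: "0 \<le> f s" if "a \<le> s" for s
    using that a by (auto simp: f_def intro!: divide_nonneg_nonneg p)
  have D: "((\<lambda>s. - P (1 / s)) has_real_derivative f s) (at s)" if "a \<le> s" for s
  proof -
    have "((\<lambda>s. 1 / s) has_real_derivative - (1 / s\<^sup>2)) (at s)"
      using that a by (auto intro!: derivative_eq_intros simp: power2_eq_square)
    from DERIV_chain2[OF P this] have "((\<lambda>s. P (1 / s)) has_real_derivative p (1 / s) * - (1 / s\<^sup>2)) (at s)" .
    from DERIV_minus[OF this] show ?thesis by (simp add: f_def)
  qed
  have cP: "isCont P 0" by (rule DERIV_isCont[OF P])
  have "((\<lambda>s::real. 1 / s) \<longlongrightarrow> 0) at_top"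
    by (rule tendsto_divide_0[OF tendsto_const filterlim_at_top_imp_at_infinity[OF filterlim_ident]])
  from tendsto_minus[OF isCont_tendsto_compose[OF cP this]]
  have lim: "((\<lambda>s. - P (1 / s)) \<longlongrightarrow> - P 0) at_top" .
  have "(\<integral>\<^sup>+s. ennreal (f s) * indicator {a..} s \<partial>lborel) = ennreal (- P 0 - - P (1 / a))"
    by (rule nn_integral_FTC_atLeast[OF fm D nn lim]) auto
  moreover have "ennreal (indicator {a..} s * f s) = ennreal (f s) * indicator {a..} s" for s
    by (simp add: indicator_def)
  ultimately have nn_int: "(\<integral>\<^sup>+s. ennreal (indicator {a..} s * f s) \<partial>lborel) = ennreal (P (1 / a) - P 0)"
    by simp
  have "P 0 \<le> P (1 / a)"
  proof (rule DERIV_nonneg_imp_nondecreasing[where f=P and a=0 and b="1 / a"])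
    show "0 \<le> 1 / a" using a by simp
    fix x assume "0 \<le> x" "x \<le> 1 / a"
    then have "0 \<le> x" "x \<le> 1" using a by (auto intro: order_trans)
    then show "\<exists>y. (P has_real_derivative y) (at x) \<and> 0 \<le> y" using P p by blast
  qed
  then have P0: "0 \<le> P (1 / a) - P 0" by simp
  have "has_bochner_integral lborel (\<lambda>s. indicator {a..} s * f s) (P (1 / a) - P 0)"
  proof (rule has_bochner_integral_nn_integral[OF _ _ P0 nn_int])
    show "(\<lambda>s. indicator {a..} s * f s) \<in> borel_measurable lborel" using fm by simp
    show "AE s in lborel. 0 \<le> indicator {a..} s * f s" using nn by (auto simp: indicator_def)
  qed
  then show ?thesis by (simp add: f_def)
qed

text \<open>In the variable \<open>w = 1 / s\<close> the density \<open>s\<^sup>-\<^sup>2\<close> becomes uniform.\<close>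

lemma integral_inverse_square:
  fixes p P :: "real \<Rightarrow> real"
  assumes a: "1 \<le> a" and P: "\<And>w. (P has_field_derivative p w) (at w)" and c: "continuous_on UNIV p"
  shows "has_bochner_integral lborel (\<lambda>s. indicator {a..} s * (p (1 / s) / s\<^sup>2)) (P (1 / a) - P 0)"
proof -
  have "compact (p ` {0..1})" by (intro compact_continuous_image continuous_on_subset[OF c]) auto
  then have "bounded (p ` {0..1})" by (rule compact_imp_bounded)
  then obtain C where "\<forall>y\<in>p ` {0..1}. norm y \<le> C" unfolding bounded_iff by blast
  then have C: "\<bar>p w\<bar> \<le> C" if "w \<in> {0..1}" for w using that by simp
  have C0: "0 \<le> C" using C[of 0] by auto
  have 1: "has_bochner_integral lborel (\<lambda>s. indicator {a..} s * ((p (1 / s) + C) / s\<^sup>2)) ((P (1 / a) + C * (1 / a)) - (P 0 + C * 0))"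
  proof (rule integral_inverse_square_nonneg[OF a, where P="\<lambda>w. P w + C * w" and p="\<lambda>w. p w + C"])
    show "((\<lambda>w. P w + C * w) has_real_derivative p w + C) (at w)" for w
      by (auto intro!: derivative_eq_intros P)
    show "0 \<le> p w + C" if "0 \<le> w" "w \<le> 1" for w using C[of w] that by auto
    show "continuous_on UNIV (\<lambda>w. p w + C)" by (intro continuous_intros c)
  qed
  have 2: "has_bochner_integral lborel (\<lambda>s. indicator {a..} s * (C / s\<^sup>2)) (C * (1 / a) - C * 0)"
  proof (rule integral_inverse_square_nonneg[OF a, where P="\<lambda>w. C * w" and p="\<lambda>w. C"])
    show "((\<lambda>w. C * w) has_real_derivative C) (at w)" for w by (auto intro!: derivative_eq_intros)
  qed (use C0 in auto)
  have "has_bochner_integral lborel (\<lambda>s. indicator {a..} s * ((p (1 / s) + C) / s\<^sup>2) - indicator {a..} s * (C / s\<^sup>2))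
     (((P (1 / a) + C * (1 / a)) - (P 0 + C * 0)) - (C * (1 / a) - C * 0))"
    by (rule has_bochner_integral_diff[OF 1 2])
  moreover have "indicator {a..} s * ((p (1 / s) + C) / s\<^sup>2) - indicator {a..} s * (C / s\<^sup>2) = indicator {a..} s * (p (1 / s) / s\<^sup>2)" for s
    by (simp add: add_divide_distrib algebra_simps)
  ultimately show ?thesis by simp
qed

lemma integral_inverse_poly:
  fixes a0 a1 a2 a3 a4 a5 a6 :: real
  assumes a: "1 \<le> a"
  shows "has_bochner_integral lborel (\<lambda>s. indicator {a..} s * ((a0 + a1 * (1/s) + a2 * (1/s)^2 + a3 * (1/s)^3
      + a4 * (1/s)^4 + a5 * (1/s)^5 + a6 * (1/s)^6) / s\<^sup>2))
    (a0 * (1/a) + a1 * ((1/a)^2 / 2) + a2 * ((1/a)^3 / 3) + a3 * ((1/a)^4 / 4)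
      + a4 * ((1/a)^5 / 5) + a5 * ((1/a)^6 / 6) + a6 * ((1/a)^7 / 7))"
proof -
  let ?p = "\<lambda>w. a0 + a1 * w + a2 * w^2 + a3 * w^3 + a4 * w^4 + a5 * w^5 + a6 * w^6"
  let ?P = "\<lambda>w. a0 * w + a1 * (w^2 / 2) + a2 * (w^3 / 3) + a3 * (w^4 / 4) + a4 * (w^5 / 5) + a5 * (w^6 / 6) + a6 * (w^7 / 7)"
  have pw: "((\<lambda>w. c * (w ^ Suc n / real (Suc n))) has_real_derivative c * w ^ n) (at w)" for c w :: real and n
    by (rule DERIV_cong[OF DERIV_cmult[OF DERIV_cdivide[OF DERIV_pow]]]) simp
  have "(?P has_real_derivative ?p w) (at w)" for w
    using DERIV_add[OF DERIV_add[OF DERIV_add[OF DERIV_add[OF DERIV_add[OF DERIV_add[OF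
      pw[of a0 0 w] pw[of a1 1 w]] pw[of a2 2 w]] pw[of a3 3 w]] pw[of a4 4 w]] pw[of a5 5 w]] pw[of a6 6 w]]
    by (simp add: numeral_eq_Suc)
  moreover have "continuous_on UNIV ?p" by (intro continuous_intros)
  ultimately have "has_bochner_integral lborel (\<lambda>s. indicator {a..} s * (?p (1 / s) / s\<^sup>2)) (?P (1 / a) - ?P 0)"
    by (rule integral_inverse_square[OF a])
  then show ?thesis by simp
qed

lemma cube_minus_quarter: "(1 - w)^3 - 1/4 = 3/4 - 3 * w + 3 * w^2 - w^3" for w :: real
  by (simp add: algebra_simps power3_eq_cube power2_eq_square)

lemma xi4_mean:
  assumes t: "1 \<le> t"
  shows "has_bochner_integral lborel (\<lambda>s. indicator {1..} s * (xi4 s t / s\<^sup>2)) 0"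
proof -
  define x where "x = 1 / t"
  have tx: "t * x = 1" using t by (simp add: x_def)
  note 1 = integral_inverse_poly[OF order_refl, of "x * (3/4)" "x * (-3)" "x * 3" "x * (-1)" 0 0 0]
  note 2 = integral_inverse_poly[OF t, of "3/4" "- 3 * t" "3 * t^2" "- (t^3)" 0 0 0, folded x_def]
  have "t * x^2 = x" "t^2 * x^3 = x" "t^3 * x^4 = x" using tx by (simp_all add: eval_nat_numeral) (metis mult.assoc mult.commute mult_1)+
  then have z: "3/4 * x + - 3 * t * (x^2 / 2) + 3 * t^2 * (x^3 / 3) + - (t^3) * (x^4 / 4) = 0" by simp
  have "xi4 s t = (x * (3/4) + x * (-3) * (1/s) + x * 3 * (1/s)^2 + x * (-1) * (1/s)^3)
     - of_bool (t \<le> s) * (3/4 + - 3 * t * (1/s) + 3 * t^2 * (1/s)^2 + - (t^3) * (1/s)^3)" for s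
  proof -
    have "1 / t * ((1 - 1/s)^3 - 1/4) = x * (3/4) + x * (-3) * (1/s) + x * 3 * (1/s)^2 + x * (-1) * (1/s)^3"
      unfolding cube_minus_quarter x_def[symmetric] by (simp add: distrib_left right_diff_distrib)
    moreover have "(1 - t/s)^3 - 1/4 = 3/4 + - 3 * t * (1/s) + 3 * t^2 * (1/s)^2 + - (t^3) * (1/s)^3"
      unfolding cube_minus_quarter by (simp add: power_divide)
    ultimately show ?thesis unfolding xi4_def by simp
  qed
  then have "indicator {1..} s * (xi4 s t / s\<^sup>2)
     = indicator {1..} s * ((x * (3/4) + x * (-3) * (1/s) + x * 3 * (1/s)^2 + x * (-1) * (1/s)^3) / s\<^sup>2)
     - indicator {t..} s * ((3/4 + - 3 * t * (1/s) + 3 * t^2 * (1/s)^2 + - (t^3) * (1/s)^3) / s\<^sup>2)" for s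
    using t by (cases "t \<le> s") (simp_all add: diff_divide_distrib)
  then have D: "has_bochner_integral lborel (\<lambda>s. indicator {1..} s * (xi4 s t / s\<^sup>2))
     ((x * (3/4) + x * (-3) * (1/2) + x * 3 * (1/3) + x * (-1) * (1/4))
      - (3/4 * x + - 3 * t * (x^2 / 2) + 3 * t^2 * (x^3 / 3) + - (t^3) * (x^4 / 4)))"
    using has_bochner_integral_diff[OF 1 2] by simp
  have "x * (3/4) + x * (-3) * (1/2) + x * 3 * (1/3) + x * (-1) * (1/4) = 0" by simp
  then show ?thesis using D unfolding z by simp
qed

text \<open>Expand in powers of \<open>1 / s\<close> on \<open>[1, \<infinity>)\<close> and on
  \<open>[t, \<infinity>)\<close>, where the cross term and the second square live.\<close>

lemma xi4_square_integral:
  assumes t: "1 \<le> t"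
  shows "has_bochner_integral lborel (\<lambda>s. indicator {1..} s * ((xi4 s t)\<^sup>2 / s\<^sup>2))
     ((45 * (1/t) + 45 * (1/t)^2 - 252 * (1/t)^3 + 224 * (1/t)^4 - 62 * (1/t)^5) / 560)"
proof -
  define x where "x = 1 / t"
  have tx: "t * x = 1" using t by (simp add: x_def)
  have tpow: "t^i * x^(i + j) = x^j" for i j
    by (simp add: power_add flip: mult.assoc power_mult_distrib) (simp add: tx)
  let ?A = "\<lambda>w::real. 3/4 - 3 * w + 3 * w^2 - w^3"
  define c0 c1 c2 c3 c4 c5 c6 where "c0 = - 2 * x * (9/16) + 9/16"
    and "c1 = - 2 * x * (- 9/4 * (t + 1)) + - 9/2 * t" and "c2 = - 2 * x * (9/4 * t^2 + 9 * t + 9/4) + 27/2 * t^2"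
    and "c3 = - 2 * x * (- (3/4 * t^3 + 9 * t^2 + 9 * t + 3/4)) + - 39/2 * t^3"
    and "c4 = - 2 * x * (3 * t^3 + 9 * t^2 + 3 * t) + 15 * t^4"
    and "c5 = - 2 * x * (- (3 * t^3 + 3 * t^2)) + - 6 * t^5" and "c6 = - 2 * x * t^3 + t^6"
  note cs = c0_def c1_def c2_def c3_def c4_def c5_def c6_def
  note 1 = integral_inverse_poly[OF order_refl, of "x^2 * (9/16)" "x^2 * (-9/2)" "x^2 * (27/2)" "x^2 * (-39/2)" "x^2 * 15" "x^2 * (-6)" "x^2"]
  note 2 = integral_inverse_poly[OF t, of c0 c1 c2 c3 c4 c5 c6, folded x_def]
  have sq: "(?A w)^2 = 9/16 + (-9/2) * w + 27/2 * w^2 + (-39/2) * w^3 + 15 * w^4 + (-6) * w^5 + w^6" for w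
    by (simp add: algebra_simps eval_nat_numeral)
  have pr: "?A w * ?A (t * w) = 9/16 + (- 9/4 * (t + 1)) * w + (9/4 * t^2 + 9 * t + 9/4) * w^2
      + (- (3/4 * t^3 + 9 * t^2 + 9 * t + 3/4)) * w^3 + (3 * t^3 + 9 * t^2 + 3 * t) * w^4
      + (- (3 * t^3 + 3 * t^2)) * w^5 + t^3 * w^6" for w
    by (simp add: algebra_simps eval_nat_numeral)
  have p1: "(x * ?A w)^2 = x^2 * (9/16) + x^2 * (-9/2) * w + x^2 * (27/2) * w^2 + x^2 * (-39/2) * w^3
      + x^2 * 15 * w^4 + x^2 * (-6) * w^5 + x^2 * w^6" for w
    unfolding power_mult_distrib sq by (simp add: distrib_left right_diff_distrib)
  have p2: "- 2 * x * (?A w * ?A (t * w)) + (?A (t * w))^2 = c0 + c1 * w + c2 * w^2 + c3 * w^3 + c4 * w^4 + c5 * w^5 + c6 * w^6" for w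
    unfolding pr sq[of "t * w"] cs by (simp add: power_mult_distrib algebra_simps)
  have "indicator {1..} s * ((xi4 s t)\<^sup>2 / s\<^sup>2) = indicator {1..} s * ((x * ?A (1/s))^2 / s\<^sup>2)
     + indicator {t..} s * ((- 2 * x * (?A (1/s) * ?A (t * (1/s))) + (?A (t * (1/s)))^2) / s\<^sup>2)" for s
  proof -
    have X: "xi4 s t = x * ?A (1/s) - of_bool (t \<le> s) * ?A (t * (1/s))"
      unfolding xi4_def cube_minus_quarter x_def[symmetric] by simp
    have "(x * A - B)^2 = (x * A)^2 + (- 2 * x * (A * B) + B^2)" for A B :: real by (simp add: power2_diff)
    note e = this[of "?A (1/s)" "?A (t * (1/s))"]
    show ?thesis
    proof (cases "t \<le> s")
      case True
      then have "(xi4 s t)\<^sup>2 = (x * ?A (1/s))^2 + (- 2 * x * (?A (1/s) * ?A (t * (1/s))) + (?A (t * (1/s)))^2)"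
        unfolding X e[symmetric] by simp
      then show ?thesis using True t by (simp only: add_divide_distrib indicator_def) simp
    next
      case False
      then show ?thesis unfolding X by simp
    qed
  qed
  then have I: "has_bochner_integral lborel (\<lambda>s. indicator {1..} s * ((xi4 s t)\<^sup>2 / s\<^sup>2))
    ((x^2 * (9/16) * (1/1) + x^2 * (-9/2) * ((1/1)^2 / 2) + x^2 * (27/2) * ((1/1)^3 / 3) + x^2 * (-39/2) * ((1/1)^4 / 4)
      + x^2 * 15 * ((1/1)^5 / 5) + x^2 * (-6) * ((1/1)^6 / 6) + x^2 * ((1/1)^7 / 7))
    + (c0 * x + c1 * (x^2 / 2) + c2 * (x^3 / 3) + c3 * (x^4 / 4) + c4 * (x^5 / 5) + c5 * (x^6 / 6) + c6 * (x^7 / 7)))"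
    using has_bochner_integral_add[OF 1 2] unfolding p1[symmetric] p2[symmetric] by simp
  have e0: "c0 * x = - 9/8 * x^2 + 9/16 * x" by (simp add: c0_def algebra_simps power2_eq_square)
  have e1: "c1 * (x^2 / 2) = 9/4 * (x * x + x * x^2) - 9/4 * x"
  proof -
    have "c1 * (x^2 / 2) = 9/4 * (x * (t^1 * x^(1+1)) + x * x^2) - 9/4 * (t^1 * x^(1+1))"
      by (simp add: c1_def field_simps eval_nat_numeral)
    then show ?thesis unfolding tpow by simp
  qed
  have e2: "c2 * (x^3 / 3) = - 2/3 * (9/4 * (x * x) + 9 * (x * x^2) + 9/4 * (x * x^3)) + 9/2 * x"
  proof -
    have "c2 * (x^3 / 3) = - 2/3 * (9/4 * (x * (t^2 * x^(2+1))) + 9 * (x * (t^1 * x^(1+2))) + 9/4 * (x * x^3)) + 9/2 * (t^2 * x^(2+1))"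
      by (simp add: c2_def algebra_simps eval_nat_numeral)
    then show ?thesis unfolding tpow by simp
  qed
  have e3: "c3 * (x^4 / 4) = 1/2 * (3/4 * (x * x) + 9 * (x * x^2) + 9 * (x * x^3) + 3/4 * (x * x^4)) - 39/8 * x"
  proof -
    have "c3 * (x^4 / 4) = 1/2 * (3/4 * (x * (t^3 * x^(3+1))) + 9 * (x * (t^2 * x^(2+2))) + 9 * (x * (t^1 * x^(1+3))) + 3/4 * (x * x^4)) - 39/8 * (t^3 * x^(3+1))"
      by (simp add: c3_def algebra_simps eval_nat_numeral)
    then show ?thesis unfolding tpow by simp
  qed
  have e4: "c4 * (x^5 / 5) = - 2/5 * (3 * (x * x^2) + 9 * (x * x^3) + 3 * (x * x^4)) + 3 * x"
  proof -
    have "c4 * (x^5 / 5) = - 2/5 * (3 * (x * (t^3 * x^(3+2))) + 9 * (x * (t^2 * x^(2+3))) + 3 * (x * (t^1 * x^(1+4)))) + 3 * (t^4 * x^(4+1))"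
      by (simp add: c4_def algebra_simps eval_nat_numeral)
    then show ?thesis unfolding tpow by simp
  qed
  have e5: "c5 * (x^6 / 6) = (x * x^3 + x * x^4) - x"
  proof -
    have "c5 * (x^6 / 6) = (x * (t^3 * x^(3+3)) + x * (t^2 * x^(2+4))) - (t^5 * x^(5+1))"
      by (simp add: c5_def algebra_simps eval_nat_numeral)
    then show ?thesis unfolding tpow by simp
  qed
  have e6: "c6 * (x^7 / 7) = - 2/7 * (x * x^4) + 1/7 * x"
  proof -
    have "c6 * (x^7 / 7) = - 2/7 * (x * (t^3 * x^(3+4))) + 1/7 * (t^6 * x^(6+1))"
      by (simp add: c6_def algebra_simps eval_nat_numeral)
    then show ?thesis unfolding tpow by simp
  qed
  have xx: "x * x = x^2" "x * x^2 = x^3" "x * x^3 = x^4" "x * x^4 = x^5" by (simp_all add: eval_nat_numeral)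
  have "((x^2 * (9/16) * (1/1) + x^2 * (-9/2) * ((1/1)^2 / 2) + x^2 * (27/2) * ((1/1)^3 / 3) + x^2 * (-39/2) * ((1/1)^4 / 4)
      + x^2 * 15 * ((1/1)^5 / 5) + x^2 * (-6) * ((1/1)^6 / 6) + x^2 * ((1/1)^7 / 7))
    + (c0 * x + c1 * (x^2 / 2) + c2 * (x^3 / 3) + c3 * (x^4 / 4) + c4 * (x^5 / 5) + c5 * (x^6 / 6) + c6 * (x^7 / 7)))
    = (45 * x + 45 * x^2 - 252 * x^3 + 224 * x^4 - 62 * x^5) / 560"
    unfolding e0 e1 e2 e3 e4 e5 e6 xx by (simp add: field_simps)
  from I[unfolded this] show ?thesis unfolding x_def[symmetric] .
qed

lemma inverse_poly_eq:
  fixes t :: real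
  assumes t: "1 \<le> t"
  shows "1 / (560 * t ^ 5) * (45 * t ^ 4 + 45 * t ^ 3 - 252 * t\<^sup>2 + 224 * t - 62)
    = (45 * (1/t) + 45 * (1/t)^2 - 252 * (1/t)^3 + 224 * (1/t)^4 - 62 * (1/t)^5) / 560"
proof -
  define x where "x = 1 / t"
  have tx: "t * x = 1" using t by (simp add: x_def)
  have tpow: "t^i * x^(i + j) = x^j" for i j
    by (simp add: power_add flip: mult.assoc power_mult_distrib) (simp add: tx)
  have "1 / (560 * t ^ 5) = x^5 / 560" by (simp add: x_def power_divide)
  then have X: "1 / (560 * t ^ 5) = x^5 / 560" .
  have "1 / (560 * t ^ 5) * (45 * t ^ 4 + 45 * t ^ 3 - 252 * t\<^sup>2 + 224 * t - 62)
     = (45 * (t^4 * x^(4+1)) + 45 * (t^3 * x^(3+2)) - 252 * (t^2 * x^(2+3)) + 224 * (t^1 * x^(1+4)) - 62 * x^5) / 560"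
    unfolding X by (simp add: algebra_simps)
  then show ?thesis unfolding tpow x_def[symmetric] by simp
qed

lemma delta4_sq_at_eq:
  assumes "1 \<le> t"
  shows "delta4_sq_at t = 1 / (560 * t ^ 5) * (45 * t ^ 4 + 45 * t ^ 3 - 252 * t\<^sup>2 + 224 * t - 62)"
proof -
  have "delta4_sq_at t = (\<integral>s. indicator {1..} s * ((xi4 s t)\<^sup>2 / s\<^sup>2) \<partial>lborel)"
    by (simp add: delta4_sq_at_def set_lebesgue_integral_def)
  also have "\<dots> = (45 * (1/t) + 45 * (1/t)^2 - 252 * (1/t)^3 + 224 * (1/t)^4 - 62 * (1/t)^5) / 560"
    by (rule has_bochner_integral_integral_eq[OF xi4_square_integral[OF assms]])
  finally show ?thesis unfolding inverse_poly_eq[OF assms] .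
qed

lemma delta4_sq_at_poly:
  assumes "1 \<le> t"
  shows "delta4_sq_at t = (45 * (1/t) + 45 * (1/t)^2 - 252 * (1/t)^3 + 224 * (1/t)^4 - 62 * (1/t)^5) / 560"
  unfolding delta4_sq_at_eq[OF assms] by (rule inverse_poly_eq[OF assms])

text \<open>The polynomial in \<open>1 / t\<close> has its maximum near \<open>917 / 2000\<close>; subtracting it from the bound
  leaves a double root there up to a small positive affine remainder.\<close>

lemma delta4_sq_at_le:
  assumes t: "1 \<le> t" shows "delta4_sq_at t \<le> 25815 / 1000000"
proof -
  define x where "x = 1 / t"
  have x: "0 \<le> x" "x \<le> 1" using t by (auto simp: x_def)
  define k where "k = 68718599603/1000000000 + 171386677/2000000 * x - 83573/500 * x^2 + 62 * x^3"
  have "0 \<le> (x - 1)^2 * (x + 1/2)" using x by simp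
  then have "3/2 * x^2 - 1/2 \<le> x^3" by (simp add: field_simps power3_eq_cube power2_eq_square)
  moreover have "x^2 \<le> x" using x by (simp add: power2_eq_square mult_left_le)
  moreover have "0 \<le> x^2" by simp
  ultimately have "0 \<le> k" unfolding k_def by linarith
  then have "0 \<le> (x - 917/2000)^2 * k" by simp
  moreover have "560 * (25815 / 1000000) - (45 * x + 45 * x^2 - 252 * x^3 + 224 * x^4 - 62 * x^5)
     = (x - 917/2000)^2 * k + 495050351/1600000000000 * x + 163541993731732/16000000000000000"
    unfolding k_def by (simp add: field_simps eval_nat_numeral)
  ultimately have "45 * x + 45 * x^2 - 252 * x^3 + 224 * x^4 - 62 * x^5 \<le> 560 * (25815 / 1000000)"
    using x by linarith
  then show ?thesis unfolding delta4_sq_at_poly[OF t] x_def[symmetric] by simp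
qed

lemma delta4_sq_bdd: "bdd_above (delta4_sq_at ` {1..})"
  by (rule bdd_aboveI[of _ "25815 / 1000000"]) (use delta4_sq_at_le in auto)

lemma delta4_sq_upper: "1 \<le> t \<Longrightarrow> delta4_sq_at t \<le> delta4_sq"
  unfolding delta4_sq_def by (rule cSUP_upper[OF _ delta4_sq_bdd]) simp

lemma delta4_sq_bounds: "25795 / 1000000 \<le> delta4_sq" "delta4_sq \<le> 25815 / 1000000"
proof -
  have "25795 / 1000000 \<le> delta4_sq_at (24/11)" by (subst delta4_sq_at_poly) (simp_all add: eval_nat_numeral)
  also have "\<dots> \<le> delta4_sq" by (rule delta4_sq_upper) simp
  finally show "25795 / 1000000 \<le> delta4_sq" .
  show "delta4_sq \<le> 25815 / 1000000" unfolding delta4_sq_def by (rule cSUP_least) (use delta4_sq_at_le in auto)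
qed

lemma delta4_sq_numeric: "\<bar>inverse (32 * delta4_sq) - 1.211\<bar> \<le> 0.0005"
proof -
  have "inverse (32 * delta4_sq) \<le> inverse (32 * (25795 / 1000000))"
    using delta4_sq_bounds by (intro le_imp_inverse_le) auto
  also have "\<dots> \<le> 1.2115" by simp
  finally have 1: "inverse (32 * delta4_sq) \<le> 1.2115" .
  have "1.2105 \<le> inverse (32 * (25815 / 1000000 :: real))" by simp
  also have "\<dots> \<le> inverse (32 * delta4_sq)"
    using delta4_sq_bounds by (intro le_imp_inverse_le) auto
  finally have 2: "1.2105 \<le> inverse (32 * delta4_sq)" .
  have "\<bar>y - 1.211\<bar> \<le> 0.0005" if "y \<le> 1.2115" "1.2105 \<le> y" for y :: real
    by (rule abs_leI) (use that in simp_all)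
  from this[OF 1 2] show ?thesis .
qed

text \<open>The standard Pareto law as a measure.\<close>

lemma pareto_measure_props:
  shows "prob_space pareto_measure" "sets pareto_measure = sets borel"
    "1 \<le> x \<Longrightarrow> cdf pareto_measure x = 1 - x powr (- 1)"
proof -
  have em: "(\<integral>\<^sup>+s. ennreal (indicator {a..} s / s\<^sup>2) \<partial>lborel) = ennreal (1 / a)" if "1 \<le> a" for a :: real
  proof -
    have I: "has_bochner_integral lborel (\<lambda>s. indicator {a..} s * (1 / s\<^sup>2)) (1 / a - 0)"
      by (rule integral_inverse_square[OF that, where P="\<lambda>w. w" and p="\<lambda>_. 1"]) (auto intro!: derivative_eq_intros)
    have "(\<integral>\<^sup>+s. ennreal (indicator {a..} s * (1 / s\<^sup>2)) \<partial>lborel) = ennreal (\<integral>s. indicator {a..} s * (1 / s\<^sup>2) \<partial>lborel)"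
      by (rule nn_integral_eq_integral[OF integrable.intros[OF I]]) (auto simp: indicator_def)
    then show ?thesis using has_bochner_integral_integral_eq[OF I] by simp
  qed
  have meas: "(\<lambda>s. ennreal (indicator {1..} s / s\<^sup>2)) \<in> borel_measurable lborel" by measurable
  show s: "sets pareto_measure = sets borel" by (simp add: pareto_measure_def)
  have sp: "space pareto_measure = UNIV" by (simp add: pareto_measure_def)
  have "emeasure pareto_measure (space pareto_measure) = 1"
    unfolding sp unfolding pareto_measure_def by (subst emeasure_density[OF meas]) (simp_all add: em)
  then show ps: "prob_space pareto_measure" by (rule prob_spaceI)
  interpret prob_space pareto_measure by (rule ps)
  assume x: "1 \<le> x"
  have "emeasure pareto_measure {x..} = ennreal (1 / x)"
  proof -
    have "emeasure pareto_measure {x..} = (\<integral>\<^sup>+s. ennreal (indicator {1..} s / s\<^sup>2) * indicator {x..} s \<partial>lborel)"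
      unfolding pareto_measure_def by (rule emeasure_density[OF meas]) simp
    also have "\<dots> = (\<integral>\<^sup>+s. ennreal (indicator {x..} s / s\<^sup>2) \<partial>lborel)"
      by (intro nn_integral_cong) (use x in \<open>auto simp: indicator_def\<close>)
    finally show ?thesis using em[OF x] by simp
  qed
  then have m: "measure pareto_measure {x..} = 1 / x" using x by (simp add: measure_def)
  have "emeasure pareto_measure {x} = (\<integral>\<^sup>+s. ennreal (indicator {1..} s / s\<^sup>2) * indicator {x} s \<partial>lborel)"
    unfolding pareto_measure_def by (rule emeasure_density[OF meas]) simp
  also have "\<dots> = 0" by (rule nn_integral_null_set) (simp add: null_sets_def)
  finally have m0: "measure pareto_measure {x} = 0" by (simp add: measure_def)
  have "{..x} = (space pareto_measure - {x..}) \<union> {x}" using sp by auto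
  then have "measure pareto_measure {..x} = measure pareto_measure (space pareto_measure - {x..}) + measure pareto_measure {x}"
    using s by (simp only:) (rule finite_measure_Union, auto)
  also have "measure pareto_measure (space pareto_measure - {x..}) = 1 - 1 / x"
    using prob_compl[of "{x..}"] s m by simp
  finally show "cdf pareto_measure x = 1 - x powr (- 1)" using m0 x by (simp add: cdf_def powr_minus_divide)
qed

lemma integral_pareto_measure:
  assumes f: "f \<in> borel_measurable borel" and I: "has_bochner_integral lborel (\<lambda>s. indicator {1..} s * (f s / s\<^sup>2)) c"
  shows "has_bochner_integral pareto_measure f c"
proof -
  have "has_bochner_integral lborel (\<lambda>s. (indicator {1..} s / s\<^sup>2) *\<^sub>R f s) c" using I by (simp add: mult.commute)
  then show ?thesis unfolding pareto_measure_def
    by (intro has_bochner_integral_density) (use f in \<open>auto intro: divide_nonneg_nonneg\<close>)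
qed

lemma xi4_measurable: "(\<lambda>s. xi4 s t) \<in> borel_measurable borel"
proof -
  have "(\<lambda>s. xi4 s t) = (\<lambda>s. 1 / t * ((1 - 1 / s) ^ 3 - 1 / 4) - (if t \<le> s then 1 else 0) * ((1 - t / s) ^ 3 - 1 / 4))"
    by (auto simp: xi4_def)
  then show ?thesis by simp
qed

lemma xi4_pareto_moments:
  assumes t: "1 \<le> t"
  shows "has_bochner_integral pareto_measure (\<lambda>s. xi4 s t) 0"
    and "has_bochner_integral pareto_measure (\<lambda>s. (xi4 s t)\<^sup>2) (delta4_sq_at t)"
proof -
  show "has_bochner_integral pareto_measure (\<lambda>s. xi4 s t) 0"
    by (rule integral_pareto_measure[OF xi4_measurable xi4_mean[OF t]])
  show "has_bochner_integral pareto_measure (\<lambda>s. (xi4 s t)\<^sup>2) (delta4_sq_at t)"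
    unfolding delta4_sq_at_poly[OF t]
    by (rule integral_pareto_measure[OF _ xi4_square_integral[OF t]]) (intro borel_measurable_power xi4_measurable)
qed

section \<open>Linearization of the gap probability\<close>

definition dcoef :: "nat \<Rightarrow> nat \<Rightarrow> (nat \<Rightarrow> real) \<Rightarrow> nat \<Rightarrow> real" where
  "dcoef J k q x = 4 * cum q (Suc x - k) ^ 3
     + 12 * (\<Sum>y\<le>J. if x + k \<le> y then q y * cum q (Suc y - k) ^ 2 else 0)"

lemma dkap_eq_sum_dcoef:
  assumes u: "\<And>j. J < j \<Longrightarrow> u j = 0"
  shows "dkap J k q u = (\<Sum>x\<le>J. u x * dcoef J k q x)"
proof -
  have cumu: "cum u i = (\<Sum>x\<le>J. if x < i then u x else 0)" for i
  proof -
    have "(\<Sum>x\<le>J. if x < i then u x else 0) = sum u {x\<in>{..J}. x < i}"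
      by (simp only: sum.inter_filter[OF finite_atMost])
    also have "\<dots> = sum u {..<i}"
      by (rule sum.mono_neutral_left) (use u not_le_imp_less in auto)
    finally show ?thesis by (simp add: cum_def)
  qed
  have "(\<Sum>y\<le>J. q y * cum q (Suc y - k) ^ 2 * cum u (Suc y - k))
     = (\<Sum>y\<le>J. \<Sum>x\<le>J. (if x < Suc y - k then u x * (q y * cum q (Suc y - k) ^ 2) else 0))"
    unfolding cumu sum_distrib_left by (intro sum.cong) auto
  also have "\<dots> = (\<Sum>x\<le>J. \<Sum>y\<le>J. (if x < Suc y - k then u x * (q y * cum q (Suc y - k) ^ 2) else 0))"
    by (rule sum.swap)
  also have "\<dots> = (\<Sum>x\<le>J. u x * (\<Sum>y\<le>J. (if x + k \<le> y then q y * cum q (Suc y - k) ^ 2 else 0)))"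
    unfolding sum_distrib_left by (intro sum.cong) auto
  finally have swap: "(\<Sum>y\<le>J. q y * cum q (Suc y - k) ^ 2 * cum u (Suc y - k))
     = (\<Sum>x\<le>J. u x * (\<Sum>y\<le>J. (if x + k \<le> y then q y * cum q (Suc y - k) ^ 2 else 0)))" .
  show ?thesis unfolding dkap_def swap dcoef_def
    by (simp only: distrib_left sum.distrib sum_distrib_left mult.left_commute)
qed

text \<open>Exact expansion of a quartic form: the remainder collects the terms with at least two
  factors \<open>q - p\<close>.\<close>

lemma kap_Taylor:
  assumes p: "pvec J p" and q: "pvec J q"
  shows "\<bar>kap J k q - kap J k p - dkap J k p (\<lambda>j. q j - p j)\<bar> \<le> 28 * (\<Sum>j\<le>J. \<bar>q j - p j\<bar>)^2"
proof -
  define N where "N = (\<Sum>j\<le>J. \<bar>q j - p j\<bar>)"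
  have N0: "0 \<le> N" unfolding N_def by (intro sum_nonneg) auto
  let ?G = "\<lambda>y. cum p (Suc y - k)" and ?D = "\<lambda>y. cum (\<lambda>j. q j - p j) (Suc y - k)"
  have cd: "cum (\<lambda>j. q j - p j) i = cum q i - cum p i" for i by (simp add: cum_def sum_subtractf)
  have DN: "\<bar>?D y\<bar> \<le> N" for y
  proof -
    have "\<bar>?D y\<bar> \<le> (\<Sum>j<Suc y - k. \<bar>q j - p j\<bar>)" unfolding cum_def by (rule sum_abs)
    also have "\<dots> \<le> (\<Sum>j\<in>{..<Suc y - k} \<union> {..J}. \<bar>q j - p j\<bar>)" by (rule sum_mono2) auto
    also have "\<dots> = N" unfolding N_def
      by (rule sum.mono_neutral_right) (use p q in \<open>auto simp: pvec_def not_le\<close>)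
    finally show ?thesis .
  qed
  have t: "\<bar>q y * cum q (Suc y - k)^3 - p y * ?G y^3 - ((q y - p y) * ?G y^3 + 3 * (p y * ?G y^2 * ?D y))\<bar>
     \<le> 3 * N * \<bar>q y - p y\<bar> + 4 * N^2 * q y" for y
  proof -
    have G: "0 \<le> ?G y" "?G y \<le> 1" using pvec_cum(1,2)[OF p] by auto
    have D1: "\<bar>?D y\<bar> \<le> 1" using pvec_cum(1,2)[OF p, of "Suc y - k"] pvec_cum(1,2)[OF q, of "Suc y - k"] unfolding cd by linarith
    have e: "cum q (Suc y - k) = ?G y + ?D y" by (simp add: cd)
    have id: "q y * (?G y + ?D y)^3 - p y * ?G y^3 - ((q y - p y) * ?G y^3 + 3 * (p y * ?G y^2 * ?D y))
      = 3 * ((q y - p y) * (?G y^2 * ?D y)) + q y * (3 * ?G y * ?D y^2 + ?D y^3)"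
      by (simp add: algebra_simps power3_eq_cube power2_eq_square)
    have "\<bar>(q y - p y) * (?G y^2 * ?D y)\<bar> \<le> \<bar>q y - p y\<bar> * N"
    proof -
      have "\<bar>?G y^2 * ?D y\<bar> \<le> 1 * N" unfolding abs_mult using G DN by (intro mult_mono) (auto simp: power_le_one)
      then show ?thesis unfolding abs_mult[of "q y - p y"] by (intro mult_left_mono) auto
    qed
    moreover have "\<bar>q y * (3 * ?G y * ?D y^2 + ?D y^3)\<bar> \<le> q y * (4 * N^2)"
    proof -
      have D2: "?D y^2 \<le> N^2" using DN N0 by (metis abs_le_square_iff abs_of_nonneg)
      have "\<bar>?G y * ?D y^2\<bar> \<le> 1 * N^2" unfolding abs_mult using G D2 by (intro mult_mono) auto
      moreover have "\<bar>?D y^3\<bar> \<le> 1 * N^2"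
      proof -
        have "?D y^3 = ?D y * ?D y^2" by (simp add: power3_eq_cube power2_eq_square)
        then show ?thesis using D1 D2 by (simp only: abs_mult) (intro mult_mono, auto)
      qed
      ultimately have "\<bar>3 * ?G y * ?D y^2 + ?D y^3\<bar> \<le> 4 * N^2" by (simp add: mult.assoc abs_le_iff)
      then show ?thesis using pvec_nonneg[OF q, of y] by (simp add: abs_mult mult_left_mono)
    qed
    moreover have "3 * N * \<bar>q y - p y\<bar> = 3 * (\<bar>q y - p y\<bar> * N)" "4 * N^2 * q y = q y * (4 * N^2)" by simp_all
    ultimately show ?thesis unfolding e id by linarith
  qed
  have "kap J k q - kap J k p - dkap J k p (\<lambda>j. q j - p j) = 4 * (\<Sum>y\<le>J. q y * cum q (Suc y - k)^3 - p y * ?G y^3 - ((q y - p y) * ?G y^3 + 3 * (p y * ?G y^2 * ?D y)))"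
    unfolding kap_def dkap_def by (simp add: sum_subtractf sum.distrib flip: sum_distrib_left)
  then have "\<bar>kap J k q - kap J k p - dkap J k p (\<lambda>j. q j - p j)\<bar>
     = 4 * \<bar>\<Sum>y\<le>J. q y * cum q (Suc y - k)^3 - p y * ?G y^3 - ((q y - p y) * ?G y^3 + 3 * (p y * ?G y^2 * ?D y))\<bar>"
    by (simp only: abs_mult)
  also have "\<dots> \<le> 4 * (\<Sum>y\<le>J. 3 * N * \<bar>q y - p y\<bar> + 4 * N^2 * q y)"
    by (intro mult_left_mono order_trans[OF sum_abs] sum_mono t) auto
  also have "(\<Sum>y\<le>J. 3 * N * \<bar>q y - p y\<bar> + 4 * N^2 * q y) = 3 * N * N + 4 * N^2"
    using pvec_sum[OF q] by (simp add: sum.distrib N_def flip: sum_distrib_left)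
  finally show ?thesis by (simp add: N_def power2_eq_square)
qed

text \<open>The derivative of the gap probability at the reference distribution is, up to an affine
  change and discretization, the projection \<open>xi4\<close>.\<close>

definition xig :: "nat \<Rightarrow> nat \<Rightarrow> nat \<Rightarrow> real" where
  "xig m k x = xi4 (exp (real x / real m)) (exp (real k / real m))"

lemma xig_eq:
  assumes m: "0 < m" and x: "x \<le> m * m"
  shows "xig m k x = exp (- (real k / real m)) * (cum (gp m) x ^ 3 - 1/4)
     - of_bool (k \<le> x) * (cum (gp m) (x - k) ^ 3 - 1/4)"
proof -
  have "k \<le> x \<Longrightarrow> exp (real k / real m) / exp (real x / real m) = exp (- (real (x - k) / real m))"
    by (simp add: of_nat_diff diff_divide_distrib flip: exp_diff)
  moreover have "exp (real k / real m) \<le> exp (real x / real m) \<longleftrightarrow> k \<le> x" using m by (simp add: divide_le_cancel)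
  moreover have "1 / exp (real x / real m) = exp (- (real x / real m))" "1 / exp (real k / real m) = exp (- (real k / real m))"
    by (simp_all add: exp_minus inverse_eq_divide)
  ultimately show ?thesis
    unfolding xig_def xi4_def cum_gp[OF m x] cum_gp[OF m le_trans[OF diff_le_self x]] by auto
qed

lemma cube_diff_le:
  fixes a b d :: real
  assumes "0 \<le> a" "a \<le> 1" "0 \<le> b" "b \<le> 1" "\<bar>a - b\<bar> \<le> d"
  shows "\<bar>a^3 - b^3\<bar> \<le> 3 * d"
proof -
  have "a^3 - b^3 = (a - b) * (a * a + a * b + b * b)" by (simp add: algebra_simps power3_eq_cube)
  then have "\<bar>a^3 - b^3\<bar> = \<bar>a - b\<bar> * \<bar>a * a + a * b + b * b\<bar>" by (simp only: abs_mult)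
  also have "\<dots> \<le> d * 3"
  proof (rule mult_mono)
    have "a * a \<le> 1" "a * b \<le> 1" "b * b \<le> 1" "0 \<le> a * a" "0 \<le> a * b" "0 \<le> b * b"
      using assms by (auto intro!: mult_le_one)
    then show "\<bar>a * a + a * b + b * b\<bar> \<le> 3" by linarith
  qed (use assms in auto)
  finally show ?thesis by simp
qed

lemma dcoef_gp:
  assumes m: "0 < m" and k: "1 \<le> k" "k \<le> m * m" and k': "k' = k \<or> k' = k + 1" and x: "x \<le> m * m"
  shows "\<bar>dcoef (m*m) k' (gp m) x + of_bool (x < k) - (1 + 3 * exp (- (real k / real m)) - 4 * xig m k x)\<bar> \<le> 52 / m"
proof -
  let ?J = "m * m" and ?c = "cum (gp m)" and ?p = "gp m"
  define d where "d = 1 / real m"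
  have d: "0 < d" using m by (simp add: d_def)
  have p: "pvec ?J ?p" using ref_pvec_gp[OF m] by (simp add: ref_pvec_def)
  have pd: "0 \<le> ?p j" "?p j \<le> d" for j using pvec_nonneg[OF p] gp_le[OF m] by (auto simp: d_def)
  have c01: "0 \<le> ?c j" "?c j \<le> 1" for j by (rule pvec_cum[OF p])+
  define \<tau> where "\<tau> = exp (- (real k / real m))"
  define \<tau>' where "\<tau>' = exp (- (real k' / real m))"
  have \<tau>: "0 < \<tau>" "\<tau> \<le> 1" by (auto simp: \<tau>_def)
  have \<tau>': "0 < \<tau>'" "\<tau>' \<le> 1" by (auto simp: \<tau>'_def)
  have \<tau>d: "\<bar>\<tau>' - \<tau>\<bar> \<le> d"
  proof (cases "k' = k")
    case True then show ?thesis using d by (simp add: \<tau>_def \<tau>'_def)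
  next
    case False
    then have "k' = k + 1" using k' by simp
    then have "\<tau>' = \<tau> * exp (- (1 / real m))" unfolding \<tau>_def \<tau>'_def exp_add[symmetric] by (simp add: add_divide_distrib)
    then have "\<tau> - \<tau>' = \<tau> * (1 - exp (- (1 / real m)))" by (simp add: algebra_simps)
    also have "\<dots> \<le> 1 * d" unfolding d_def using \<tau> exp_ge_add_one_self[of "- (1 / real m)"] by (intro mult_mono) auto
    finally have "\<tau> - \<tau>' \<le> d" by simp
    moreover have "0 \<le> \<tau> - \<tau>'" using \<open>\<tau> - \<tau>' = \<tau> * (1 - exp (- (1 / real m)))\<close> \<tau> by simp
    ultimately show ?thesis by linarith
  qed
  have em: "exp (- real m) \<le> d" using gp_le[OF m, of ?J] by (simp add: gp_def d_def)
  define R where "R = 3 * (\<Sum>y\<le>?J. if x + k' \<le> y then ?p y * ?c (Suc y - k') ^ 2 else 0)"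
  have R: "\<bar>R - \<tau> * (1 - ?c x ^ 3)\<bar> \<le> 10 * d"
  proof (cases "x + k' \<le> ?J")
    case False
    then have "R = 0" by (auto simp: R_def intro!: sum.neutral)
    have cx: "1 - ?c x ^ 3 \<le> 3 * (1 - ?c x)" using power3_ge_linear[of "1 - ?c x"] c01[of x] by simp
    have "\<tau> * (1 - ?c x ^ 3) \<le> \<tau> * (3 * (1 - ?c x))" using cx \<tau> by (intro mult_left_mono) auto
    also have "\<dots> = 3 * exp (- (real (k + x) / real m))"
      unfolding cum_gp[OF m x] \<tau>_def by (simp add: add_divide_distrib flip: exp_add)
    also have "\<dots> \<le> 3 * exp (- real m)"
    proof -
      have "?J \<le> k + x" using False k' by auto
      then have "real m * real m \<le> real (k + x)" by (metis of_nat_le_iff of_nat_mult)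
      then have "real m \<le> real (k + x) / real m" using m by (simp add: pos_le_divide_eq)
      then show ?thesis by simp
    qed
    finally have "\<tau> * (1 - ?c x ^ 3) \<le> 3 * d" using em by linarith
    moreover have "0 \<le> \<tau> * (1 - ?c x ^ 3)" using \<tau> c01 by (simp add: power_le_one)
    ultimately show ?thesis using \<open>R = 0\<close> d by linarith
  next
    case True
    define L where "L = ?J - k'"
    have L: "x \<le> L" "L + k' = ?J" using True by (auto simp: L_def)
    define T where "T = (\<Sum>z=x..<L. 3 * (?p z * ?c (Suc z) ^ 2))"
    have "(\<Sum>y\<le>?J. if x + k' \<le> y then ?p y * ?c (Suc y - k') ^ 2 else 0) = (\<Sum>y\<in>{y\<in>{..?J}. x + k' \<le> y}. ?p y * ?c (Suc y - k') ^ 2)"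
      by (simp only: sum.inter_filter[OF finite_atMost])
    also have "{y\<in>{..?J}. x + k' \<le> y} = insert ?J {x+k'..<L+k'}" using L by auto
    also have "(\<Sum>y\<in>insert ?J {x+k'..<L+k'}. ?p y * ?c (Suc y - k') ^ 2)
        = ?p ?J * ?c (Suc ?J - k') ^ 2 + (\<Sum>y\<in>{x+k'..<L+k'}. ?p y * ?c (Suc y - k') ^ 2)"
      by (rule sum.insert) (use L in auto)
    also have "(\<Sum>y\<in>{x+k'..<L+k'}. ?p y * ?c (Suc y - k') ^ 2) = (\<Sum>z\<in>{x..<L}. ?p (z+k') * ?c (Suc (z+k') - k') ^ 2)"
      by (rule sum.shift_bounds_nat_ivl)
    also have "\<dots> = (\<Sum>z\<in>{x..<L}. \<tau>' * (?p z * ?c (Suc z) ^ 2))"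
    proof (rule sum.cong[OF refl])
      fix z assume z: "z \<in> {x..<L}"
      have "z + k' < ?J" using z L by (metis add_less_cancel_right atLeastLessThan_iff)
      moreover have "exp (- (real (a + k') / real m)) = \<tau>' * exp (- (real a / real m))" for a
        unfolding \<tau>'_def exp_add[symmetric] by (simp add: add_divide_distrib)
      from this[of z] this[of "Suc z"] have "?p (z + k') = \<tau>' * ?p z"
        using calculation by (simp add: gp_def right_diff_distrib)
      then show "?p (z+k') * ?c (Suc (z+k') - k') ^ 2 = \<tau>' * (?p z * ?c (Suc z) ^ 2)" by simp
    qed
    finally have RT: "R = 3 * (?p ?J * ?c (Suc ?J - k') ^ 2) + \<tau>' * T"
      by (simp add: R_def T_def sum_distrib_left algebra_simps)
    have top: "0 \<le> ?p ?J * ?c (Suc ?J - k') ^ 2" "?p ?J * ?c (Suc ?J - k') ^ 2 \<le> d"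
    proof -
      show "0 \<le> ?p ?J * ?c (Suc ?J - k') ^ 2" using pd by simp
      have "?p ?J * ?c (Suc ?J - k') ^ 2 \<le> ?p ?J" using pd c01 by (simp add: mult_left_le power_le_one)
      then show "?p ?J * ?c (Suc ?J - k') ^ 2 \<le> d" using pd(2)[of ?J] by linarith
    qed
    have tel: "(\<Sum>z=x..<L. ?c (Suc z) ^ 3 - ?c z ^ 3) = ?c L ^ 3 - ?c x ^ 3"
      using L(1) by (rule sum_Suc_diff'[where f="\<lambda>z. ?c z ^ 3"])
    have tm: "0 \<le> 3 * (?p z * ?c (Suc z) ^ 2) - (?c (Suc z) ^ 3 - ?c z ^ 3)"
      "3 * (?p z * ?c (Suc z) ^ 2) - (?c (Suc z) ^ 3 - ?c z ^ 3) \<le> 3 * d * ?p z" for z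
    proof -
      have e: "3 * (?p z * ?c (Suc z) ^ 2) - (?c (Suc z) ^ 3 - ?c z ^ 3) = ?p z * (?p z * (2 * ?c (Suc z) + ?c z))"
        unfolding cum_Suc by (simp add: algebra_simps power3_eq_cube power2_eq_square)
      show "0 \<le> 3 * (?p z * ?c (Suc z) ^ 2) - (?c (Suc z) ^ 3 - ?c z ^ 3)"
        unfolding e using pd(1)[of z] c01(1)[of z] c01(1)[of "Suc z"] by simp
      have "?p z * (2 * ?c (Suc z) + ?c z) \<le> d * 3" using pd[of z] c01[of z] c01[of "Suc z"] d by (intro mult_mono) auto
      then have "?p z * (?p z * (2 * ?c (Suc z) + ?c z)) \<le> ?p z * (d * 3)" using pd by (intro mult_left_mono) auto
      then show "3 * (?p z * ?c (Suc z) ^ 2) - (?c (Suc z) ^ 3 - ?c z ^ 3) \<le> 3 * d * ?p z" unfolding e by (simp add: mult_ac)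
    qed
    have "T - (?c L ^ 3 - ?c x ^ 3) = (\<Sum>z=x..<L. 3 * (?p z * ?c (Suc z) ^ 2) - (?c (Suc z) ^ 3 - ?c z ^ 3))"
      unfolding T_def tel[symmetric] by (simp add: sum_subtractf)
    moreover have "0 \<le> (\<Sum>z=x..<L. 3 * (?p z * ?c (Suc z) ^ 2) - (?c (Suc z) ^ 3 - ?c z ^ 3))" by (intro sum_nonneg tm)
    moreover have "(\<Sum>z=x..<L. 3 * (?p z * ?c (Suc z) ^ 2) - (?c (Suc z) ^ 3 - ?c z ^ 3)) \<le> (\<Sum>z=x..<L. 3 * d * ?p z)" by (intro sum_mono tm)
    moreover have "(\<Sum>z=x..<L. 3 * d * ?p z) \<le> 3 * d * 1"
      unfolding sum_distrib_left[symmetric] using d pvec_sum_le_1[OF p, of "{x..<L}"] by (intro mult_left_mono) auto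
    ultimately have T: "0 \<le> T - (?c L ^ 3 - ?c x ^ 3)" "T - (?c L ^ 3 - ?c x ^ 3) \<le> 3 * d" by linarith+
    have TT: "0 \<le> \<tau>' * (T - (?c L ^ 3 - ?c x ^ 3))" "\<tau>' * (T - (?c L ^ 3 - ?c x ^ 3)) \<le> 3 * d"
    proof -
      show "0 \<le> \<tau>' * (T - (?c L ^ 3 - ?c x ^ 3))" using \<tau>' T by simp
      have "\<tau>' * (T - (?c L ^ 3 - ?c x ^ 3)) \<le> 1 * (3 * d)" using \<tau>' T d by (intro mult_mono) auto
      then show "\<tau>' * (T - (?c L ^ 3 - ?c x ^ 3)) \<le> 3 * d" by simp
    qed
    have cL: "0 \<le> \<tau>' * (1 - ?c L ^ 3)" "\<tau>' * (1 - ?c L ^ 3) \<le> 3 * d"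
    proof -
      show "0 \<le> \<tau>' * (1 - ?c L ^ 3)" using \<tau>' c01[of L] by (simp add: power_le_one)
      have "1 - ?c L ^ 3 \<le> 3 * (1 - ?c L)" using power3_ge_linear[of "1 - ?c L"] c01[of L] by simp
      then have "\<tau>' * (1 - ?c L ^ 3) \<le> \<tau>' * (3 * (1 - ?c L))" using \<tau>' by (intro mult_left_mono) auto
      also have "\<dots> = 3 * exp (- (real (L + k') / real m))"
      proof -
        have "L \<le> ?J" using L by simp
        then show ?thesis unfolding cum_gp[OF m \<open>L \<le> ?J\<close>] \<tau>'_def by (simp add: add_divide_distrib flip: exp_add)
      qed
      also have "real (L + k') / real m = real m" unfolding L using m by simp
      finally show "\<tau>' * (1 - ?c L ^ 3) \<le> 3 * d" using em by linarith
    qed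
    have x3: "0 \<le> 1 - ?c x ^ 3" "1 - ?c x ^ 3 \<le> 1" using c01[of x] by (simp_all add: power_le_one)
    have "\<bar>(\<tau>' - \<tau>) * (1 - ?c x ^ 3)\<bar> \<le> d * 1" unfolding abs_mult using \<tau>d x3 d by (intro mult_mono) auto
    moreover have "\<tau>' * T - \<tau> * (1 - ?c x ^ 3) = \<tau>' * (T - (?c L ^ 3 - ?c x ^ 3)) - \<tau>' * (1 - ?c L ^ 3) + (\<tau>' - \<tau>) * (1 - ?c x ^ 3)"
      by (simp add: algebra_simps)
    ultimately show ?thesis using RT top TT cL by linarith
  qed
  have A: "\<bar>?c (Suc x - k') ^ 3 - ?c (x - k) ^ 3\<bar> \<le> 3 * d"
  proof (rule cube_diff_le)
    show "\<bar>?c (Suc x - k') - ?c (x - k)\<bar> \<le> d"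
    proof (cases "k' = k \<and> k \<le> x")
      case True
      then have "Suc x - k' = Suc (x - k)" by auto
      then show ?thesis using pd[of "x - k"] by (simp add: cum_Suc)
    next
      case False
      then have "Suc x - k' = x - k" using k' k by auto
      then show ?thesis using d by simp
    qed
  qed (use c01 in auto)
  have xi: "1 + 3 * \<tau> - 4 * xig m k x = of_bool (x < k) + 4 * (\<tau> * (1 - ?c x ^ 3)) + 4 * ?c (x - k) ^ 3"
    unfolding xig_eq[OF m x] \<tau>_def[symmetric] using k by (cases "k \<le> x") (simp_all add: algebra_simps)
  have "dcoef ?J k' ?p x = 4 * ?c (Suc x - k') ^ 3 + 4 * R" by (simp add: dcoef_def R_def)
  then have "\<bar>dcoef ?J k' ?p x + of_bool (x < k) - (1 + 3 * \<tau> - 4 * xig m k x)\<bar> \<le> 52 * d"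
    unfolding xi using A R by linarith
  then show ?thesis by (simp add: \<tau>_def d_def)
qed

section \<open>Lower bound for the rate at small levels\<close>

lemma xi4_abs_le_1:
  assumes s: "1 \<le> s" and t: "1 \<le> t" shows "\<bar>xi4 s t\<bar> \<le> 1"
proof -
  have u: "0 \<le> (1 - 1/s)^3" "(1 - 1/s)^3 \<le> 1" using s by (simp_all add: power_le_one)
  define A where "A = (1 - 1/s)^3 - 1/4"
  have A: "-1/4 \<le> A" "A \<le> 3/4" using u by (simp_all add: A_def)
  have it: "0 \<le> 1/t" "1/t \<le> 1" using t by simp_all
  have "1/t * A \<le> 1/t * (3/4)" by (intro mult_left_mono) (use A it in auto)
  also have "1/t * (3/4) \<le> 1 * (3/4)" by (rule mult_right_mono[OF it(2)]) simp
  finally have tA1: "1/t * A \<le> 3/4" by simp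
  have "1 * (-1/4) \<le> 1/t * (-1/4)" by (rule mult_right_mono_neg[OF it(2)]) simp
  also have "1/t * (-1/4) \<le> 1/t * A" by (intro mult_left_mono) (use A it in auto)
  finally have tA2: "-1/4 \<le> 1/t * A" by simp
  show ?thesis
  proof (cases "t \<le> s")
    case True
    then have "0 \<le> (1 - t/s)^3" "(1 - t/s)^3 \<le> 1" using s t by (simp_all add: power_le_one)
    moreover have "xi4 s t = 1/t * A - ((1 - t/s)^3 - 1/4)" using True by (simp add: xi4_def A_def)
    ultimately show ?thesis using tA1 tA2 by linarith
  next
    case False
    then have "xi4 s t = 1/t * A" by (simp add: xi4_def A_def)
    then show ?thesis using tA1 tA2 by linarith
  qed
qed

lemma xig_abs_le_1: "\<bar>xig m k x\<bar> \<le> 1"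
  unfolding xig_def by (rule xi4_abs_le_1) simp_all

text \<open>Binning changes the projection by at most \<open>O(1 / m)\<close>, except in the unbounded last cell.\<close>

lemma xig_approx:
  assumes m: "0 < m" and k: "k \<le> m * m" and s: "1 \<le> s"
  shows "\<bar>xig m k (cell m (1 * ln s)) - xi4 s (exp (real k / real m))\<bar>
     \<le> 6 / m + 2 * of_bool (cell m (1 * ln s) = m * m)"
proof -
  define x where "x = cell m (1 * ln s)"
  define t where "t = exp (real k / real m)"
  have t1: "1 \<le> t" by (simp add: t_def)
  have xJ: "x \<le> m * m" unfolding x_def by (rule cell_le)
  have ls: "0 \<le> 1 * ln s" using s by simp
  have p: "pvec (m*m) (gp m)" using ref_pvec_gp[OF m] by (simp add: ref_pvec_def)
  have c01: "0 \<le> cum (gp m) j" "cum (gp m) j \<le> 1" for j by (rule pvec_cum[OF p])+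
  have "\<bar>xig m k x - xi4 s t\<bar> \<le> 6 / m + 2 * of_bool (x = m * m)"
  proof (cases "x = m * m")
    case True
    have "\<bar>xig m k x - xi4 s t\<bar> \<le> 2" using xig_abs_le_1[of m k x] xi4_abs_le_1[OF s t1] by linarith
    moreover have "0 \<le> 6 / real m" by simp
    ultimately have "\<bar>xig m k x - xi4 s t\<bar> \<le> 6 / m + 2 * 1" by linarith
    then show ?thesis by (simp add: True)
  next
    case False
    then have xlt: "x < m * m" using xJ by simp
    have between: "real x / real m \<le> ln s" "ln s < real (Suc x) / real m"
    proof -
      have "\<not> cell m (1 * ln s) < x" by (simp add: x_def)
      then show "real x / real m \<le> ln s" using cell_less_iff[OF m ls xJ] by simp
      have "cell m (1 * ln s) < Suc x" by (simp add: x_def)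
      then show "ln s < real (Suc x) / real m" using cell_less_iff[OF m ls, of "Suc x"] xlt by simp
    qed
    have inv: "1 / s = exp (- ln s)" using s by (simp add: exp_minus inverse_eq_divide)
    have kx: "k \<le> x \<longleftrightarrow> t \<le> s"
    proof -
      have "cell m (1 * ln s) < k \<longleftrightarrow> ln s < real k / real m" using cell_less_iff[OF m ls k] by simp
      also have "\<dots> \<longleftrightarrow> exp (ln s) < t" unfolding t_def by (rule exp_less_cancel_iff[symmetric])
      also have "exp (ln s) = s" using s by simp
      finally show ?thesis unfolding x_def by linarith
    qed
    have A: "\<bar>cum (gp m) x ^ 3 - (1 - 1/s) ^ 3\<bar> \<le> 3 * (1/m)"
    proof (rule cube_diff_le[OF c01])
      have lo: "cum (gp m) x \<le> 1 - 1/s" unfolding cum_gp[OF m xJ] inv using between by simp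
      have "1 - 1/s \<le> cum (gp m) (Suc x)"
        using between xlt unfolding inv by (subst cum_gp[OF m]) auto
      then have "1 - 1/s \<le> cum (gp m) x + 1/m" using gp_le[OF m, of x] by (simp add: cum_Suc)
      then show "\<bar>cum (gp m) x - (1 - 1/s)\<bar> \<le> 1/m" using lo by linarith
    qed (use s in auto)
    have B: "\<bar>cum (gp m) (x - k) ^ 3 - (1 - t/s) ^ 3\<bar> \<le> 3 * (1/m)" if "k \<le> x"
    proof (rule cube_diff_le[OF c01])
      have ts: "t / s = exp (real k / real m - ln s)" using s by (simp add: t_def exp_diff)
      have lo: "cum (gp m) (x - k) \<le> 1 - t/s"
        unfolding ts using between that xJ by (subst cum_gp[OF m]) (auto simp: of_nat_diff diff_divide_distrib)
      have "1 - t/s \<le> cum (gp m) (Suc (x - k))"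
        unfolding ts using between that xlt by (subst cum_gp[OF m]) (auto simp: of_nat_diff diff_divide_distrib add_divide_distrib)
      then have "1 - t/s \<le> cum (gp m) (x - k) + 1/m" using gp_le[OF m, of "x - k"] by (simp add: cum_Suc)
      then show "\<bar>cum (gp m) (x - k) - (1 - t/s)\<bar> \<le> 1/m" using lo by linarith
      show "0 \<le> 1 - t/s" "1 - t/s \<le> 1" using that kx s t1 by auto
    qed
    have e: "xig m k x - xi4 s t = 1/t * (cum (gp m) x ^ 3 - (1 - 1/s)^3)
        - of_bool (k \<le> x) * (cum (gp m) (x - k) ^ 3 - (1 - t/s)^3)"
    proof -
      have "exp (- (real k / real m)) = 1/t" by (simp add: t_def exp_minus inverse_eq_divide)
      then show ?thesis unfolding xig_eq[OF m xJ] xi4_def kx by (simp add: algebra_simps)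
    qed
    have "\<bar>1/t * (cum (gp m) x ^ 3 - (1 - 1/s)^3)\<bar> \<le> 1 * (3 * (1/m))"
      unfolding abs_mult using A t1 by (intro mult_mono) auto
    moreover have "\<bar>of_bool (k \<le> x) * (cum (gp m) (x - k) ^ 3 - (1 - t/s)^3)\<bar> \<le> 3 * (1/m)"
      using B by (cases "k \<le> x") auto
    ultimately have "\<bar>xig m k x - xi4 s t\<bar> \<le> 3 * (1/m) + 3 * (1/m)" unfolding e by linarith
    then show ?thesis using False by simp
  qed
  then show ?thesis by (simp only: x_def t_def)
qed

lemma xig_moments:
  assumes m: "0 < m" and k: "k \<le> m * m"
  shows "\<bar>\<Sum>x\<le>m*m. gp m x * xig m k x\<bar> \<le> 8 / m"
    and "\<bar>(\<Sum>x\<le>m*m. gp m x * (xig m k x)\<^sup>2) - delta4_sq_at (exp (real k / real m))\<bar> \<le> 16 / m"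
proof -
  let ?N = pareto_measure and ?J = "m * m"
  define t where "t = exp (real k / real m)"
  have t1: "1 \<le> t" by (simp add: t_def)
  have cdf: "\<forall>x\<ge>1. cdf ?N x = 1 - x powr (- 1)" using pareto_measure_props(3) by blast
  note E = pareto_cell_expectation[OF pareto_measure_props(1,2) zero_less_one cdf m]
  have ae: "AE s in ?N. 1 \<le> s" by (rule pareto_AE_ge_1[OF pareto_measure_props(1,2) zero_less_one cdf])
  let ?e = "\<lambda>x. 6 / real m + 2 * of_bool (x = ?J)"
  have eE: "(\<Sum>x\<le>?J. gp m x * ?e x) \<le> 8 / m"
  proof -
    have p: "pvec ?J (gp m)" using ref_pvec_gp[OF m] by (simp add: ref_pvec_def)
    have "(\<Sum>x\<le>?J. gp m x * ?e x) = (\<Sum>x\<le>?J. gp m x) * (6 / m) + 2 * (\<Sum>x\<le>?J. if x = ?J then gp m x else 0)"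
      unfolding sum_distrib_right sum_distrib_left sum.distrib[symmetric] by (intro sum.cong) (auto simp: distrib_left)
    also have "\<dots> = 6 / m + 2 * gp m ?J" using pvec_sum[OF p] by simp
    finally show ?thesis using gp_le[OF m, of ?J] by linarith
  qed
  have I1: "integrable ?N (\<lambda>s. xi4 s t)" "(\<integral>s. xi4 s t \<partial>?N) = 0"
    using xi4_pareto_moments(1)[OF t1] by (auto simp: has_bochner_integral_iff)
  have I2: "integrable ?N (\<lambda>s. (xi4 s t)\<^sup>2)" "(\<integral>s. (xi4 s t)\<^sup>2 \<partial>?N) = delta4_sq_at t"
    using xi4_pareto_moments(2)[OF t1] by (auto simp: has_bochner_integral_iff)
  have bound: "\<bar>(\<Sum>x\<le>?J. gp m x * \<phi> x) - (\<integral>s. g s \<partial>?N)\<bar> \<le> c * (8 / m)"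
    if ig: "integrable ?N g" and d: "\<And>s. 1 \<le> s \<Longrightarrow> \<bar>\<phi> (cell m (1 * ln s)) - g s\<bar> \<le> c * ?e (cell m (1 * ln s))" and c: "0 \<le> c"
    for \<phi> :: "nat \<Rightarrow> real" and g c
  proof -
    have int: "integrable ?N (\<lambda>s. \<phi> (cell m (1 * ln s)) - g s)" by (intro Bochner_Integration.integrable_diff E(1) ig)
    have "(\<Sum>x\<le>?J. gp m x * \<phi> x) - (\<integral>s. g s \<partial>?N) = (\<integral>s. \<phi> (cell m (1 * ln s)) - g s \<partial>?N)"
      unfolding E(2)[symmetric] by (rule Bochner_Integration.integral_diff[OF E(1) ig, symmetric])
    then have "\<bar>(\<Sum>x\<le>?J. gp m x * \<phi> x) - (\<integral>s. g s \<partial>?N)\<bar> \<le> (\<integral>s. \<bar>\<phi> (cell m (1 * ln s)) - g s\<bar> \<partial>?N)"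
      by (simp only: integral_abs_bound)
    also have "\<dots> \<le> (\<integral>s. c * ?e (cell m (1 * ln s)) \<partial>?N)"
    proof (rule integral_mono_AE)
      show "integrable ?N (\<lambda>s. \<bar>\<phi> (cell m (1 * ln s)) - g s\<bar>)" by (rule integrable_abs[OF int])
      show "integrable ?N (\<lambda>s. c * ?e (cell m (1 * ln s)))" by (rule E(1)[of "\<lambda>x. c * ?e x"])
      show "AE s in ?N. \<bar>\<phi> (cell m (1 * ln s)) - g s\<bar> \<le> c * ?e (cell m (1 * ln s))"
        using ae by eventually_elim (rule d)
    qed
    also have "\<dots> = (\<Sum>x\<le>?J. gp m x * (c * ?e x))" by (rule E(2)[of "\<lambda>x. c * ?e x"])
    also have "\<dots> = c * (\<Sum>x\<le>?J. gp m x * ?e x)" unfolding sum_distrib_left by (intro sum.cong refl) (simp only: mult.left_commute)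
    also have "\<dots> \<le> c * (8 / m)" using eE c by (rule mult_left_mono)
    finally show ?thesis .
  qed
  have d: "\<bar>xig m k (cell m (1 * ln s)) - xi4 s t\<bar> \<le> ?e (cell m (1 * ln s))" if "1 \<le> s" for s
    unfolding t_def by (rule xig_approx[OF m k that])
  show "\<bar>\<Sum>x\<le>?J. gp m x * xig m k x\<bar> \<le> 8 / m"
    using bound[OF I1(1), of "xig m k" 1] d I1(2) by simp
  have "\<bar>(\<Sum>x\<le>?J. gp m x * (xig m k x)\<^sup>2) - (\<integral>s. (xi4 s t)\<^sup>2 \<partial>?N)\<bar> \<le> 2 * (8 / m)"
  proof (rule bound[OF I2(1)])
    fix s :: real assume s: "1 \<le> s"
    let ?a = "xig m k (cell m (1 * ln s))" and ?b = "xi4 s t"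
    have "\<bar>?a^2 - ?b^2\<bar> = \<bar>?a + ?b\<bar> * \<bar>?a - ?b\<bar>" by (simp add: power2_eq_square square_diff_square_factored flip: abs_mult)
    also have "\<dots> \<le> 2 * ?e (cell m (1 * ln s))"
    proof (rule mult_mono[OF _ d[OF s]])
      show "\<bar>?a + ?b\<bar> \<le> 2" using xig_abs_le_1[of m k "cell m (1 * ln s)"] xi4_abs_le_1[OF s t1] by linarith
    qed auto
    finally show "\<bar>?a^2 - ?b^2\<bar> \<le> 2 * ?e (cell m (1 * ln s))" .
  qed simp
  then show "\<bar>(\<Sum>x\<le>?J. gp m x * (xig m k x)\<^sup>2) - delta4_sq_at (exp (real k / real m))\<bar> \<le> 16 / m"
    unfolding I2(2) t_def[symmetric] by simp
qed

text \<open>Linearization of the two excesses at the reference distribution.\<close>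

lemma excess_linearization:
  assumes m: "0 < m" and k: "1 \<le> k" "k \<le> m * m" and k': "k' = k \<or> k' = k + 1" and q: "pvec (m*m) q"
  shows "\<bar>kap (m*m) k' q + cum q k - 1 + 4 * (\<Sum>x\<le>m*m. q x * xig m k x)\<bar>
     \<le> 28 * (\<Sum>j\<le>m*m. \<bar>q j - gp m j\<bar>)^2 + 160 / m"
proof -
  let ?J = "m * m" and ?p = "gp m"
  define N where "N = (\<Sum>j\<le>?J. \<bar>q j - ?p j\<bar>)"
  define \<tau> where "\<tau> = exp (- (real k / real m))"
  define \<mu> where "\<mu> = (\<Sum>x\<le>?J. ?p x * xig m k x)"
  define S where "S = (\<Sum>x\<le>?J. q x * xig m k x)"
  define er where "er = (\<lambda>x. dcoef ?J k' ?p x + of_bool (x < k) - (1 + 3 * \<tau> - 4 * xig m k x))"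
  have p: "pvec ?J ?p" using ref_pvec_gp[OF m] by (simp add: ref_pvec_def)
  have er: "\<bar>er x\<bar> \<le> 52 / m" if "x \<le> ?J" for x unfolding er_def \<tau>_def by (rule dcoef_gp[OF m k k' that])
  have lin: "dkap ?J k' ?p u + cum u k = (1 + 3 * \<tau>) * (\<Sum>x\<le>?J. u x) - 4 * (\<Sum>x\<le>?J. u x * xig m k x) + (\<Sum>x\<le>?J. u x * er x)"
    if u: "\<And>j. ?J < j \<Longrightarrow> u j = 0" for u
  proof -
    have "cum u k = (\<Sum>x\<le>?J. u x * of_bool (x < k))"
    proof -
      have "(\<Sum>x\<le>?J. u x * of_bool (x < k)) = (\<Sum>x<k. u x)"
        by (rule sum.mono_neutral_cong_right) (use k in auto)
      then show ?thesis by (simp add: cum_def)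
    qed
    then have "dkap ?J k' ?p u + cum u k = (\<Sum>x\<le>?J. u x * dcoef ?J k' ?p x) + (\<Sum>x\<le>?J. u x * of_bool (x < k))"
      by (simp only: dkap_eq_sum_dcoef[OF u])
    also have "\<dots> = (\<Sum>x\<le>?J. u x * (dcoef ?J k' ?p x + of_bool (x < k)))"
      by (simp only: distrib_left sum.distrib)
    also have "\<dots> = (\<Sum>x\<le>?J. (1 + 3 * \<tau>) * u x - 4 * (u x * xig m k x) + u x * er x)"
      by (intro sum.cong refl) (simp add: er_def algebra_simps)
    finally show ?thesis by (simp only: sum.distrib sum_subtractf sum_distrib_left)
  qed
  have sum_er: "\<bar>\<Sum>x\<le>?J. u x * er x\<bar> \<le> (\<Sum>x\<le>?J. \<bar>u x\<bar>) * (52 / m)" for u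
    unfolding sum_distrib_right
  proof (intro order_trans[OF sum_abs] sum_mono)
    fix x assume "x \<in> {..?J}"
    then have "\<bar>er x\<bar> \<le> 52 / m" by (intro er) simp
    then show "\<bar>u x * er x\<bar> \<le> \<bar>u x\<bar> * (52 / m)" unfolding abs_mult by (rule mult_left_mono) simp
  qed
  have "dkap ?J k' ?p ?p + cum ?p k = (1 + 3 * \<tau>) - 4 * \<mu> + (\<Sum>x\<le>?J. ?p x * er x)"
    using lin[of ?p] p pvec_sum[OF p] by (simp add: pvec_def \<mu>_def)
  moreover have "\<bar>\<Sum>x\<le>?J. ?p x * er x\<bar> \<le> 52 / m"
    using sum_er[of ?p] p by (simp add: pvec_def)
  moreover have "\<bar>\<mu>\<bar> \<le> 8 / m" unfolding \<mu>_def by (rule xig_moments(1)[OF m k(2)])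
  moreover have "cum ?p k = 1 - \<tau>" unfolding \<tau>_def by (rule cum_gp[OF m k(2)])
  ultimately have base: "\<bar>kap ?J k' ?p + cum ?p k - 1\<bar> \<le> 21 * (1 / m)" "\<bar>\<mu>\<bar> \<le> 8 * (1 / m)"
    unfolding dkap_self by (simp_all add: abs_le_iff)
  let ?u = "\<lambda>j. q j - ?p j"
  have "dkap ?J k' ?p ?u + cum ?u k = (1 + 3 * \<tau>) * (\<Sum>x\<le>?J. ?u x) - 4 * (\<Sum>x\<le>?J. ?u x * xig m k x) + (\<Sum>x\<le>?J. ?u x * er x)"
    by (rule lin) (use p q in \<open>auto simp: pvec_def\<close>)
  moreover have "(\<Sum>x\<le>?J. ?u x) = 0" using pvec_sum[OF p] pvec_sum[OF q] by (simp add: sum_subtractf)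
  moreover have "(\<Sum>x\<le>?J. ?u x * xig m k x) = S - \<mu>" by (simp add: S_def \<mu>_def left_diff_distrib sum_subtractf)
  moreover have "cum ?u k = cum q k - cum ?p k" by (simp add: cum_def sum_subtractf)
  ultimately have L: "dkap ?J k' ?p ?u + (cum q k - cum ?p k) = 4 * \<mu> - 4 * S + (\<Sum>x\<le>?J. ?u x * er x)" by simp
  have "N \<le> (\<Sum>j\<le>?J. q j + ?p j)" unfolding N_def
    by (intro sum_mono) (use pvec_nonneg[OF p] pvec_nonneg[OF q] in \<open>simp add: abs_le_iff add_increasing add_increasing2\<close>)
  then have N2: "N \<le> 2" using pvec_sum[OF p] pvec_sum[OF q] by (simp add: sum.distrib)
  have "\<bar>\<Sum>x\<le>?J. ?u x * er x\<bar> \<le> N * (52 / m)" unfolding N_def by (rule sum_er)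
  also have "\<dots> \<le> 2 * (52 / m)" using N2 by (intro mult_right_mono) auto
  finally have E: "\<bar>\<Sum>x\<le>?J. ?u x * er x\<bar> \<le> 104 * (1 / m)" by simp
  have T: "\<bar>kap ?J k' q - kap ?J k' ?p - dkap ?J k' ?p ?u\<bar> \<le> 28 * N^2" unfolding N_def by (rule kap_Taylor[OF p q])
  have "0 \<le> 1 / real m" by simp
  then have "\<bar>kap ?J k' q + cum q k - 1 + 4 * S\<bar> \<le> 28 * N^2 + 160 * (1 / m)"
    using base L E T by linarith
  then show ?thesis by (simp add: N_def S_def)
qed

lemma exp_le_cubic:
  fixes y :: real assumes "\<bar>y\<bar> \<le> 1" shows "exp y \<le> 1 + y + y^2 / 2 + \<bar>y\<bar>^3"
proof -
  obtain t where t: "\<bar>t\<bar> \<le> \<bar>y\<bar>" "exp y = (\<Sum>j<3. y ^ j / fact j) + exp t / fact 3 * y ^ 3"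
    using Maclaurin_exp_le[of y 3] by blast
  have "exp t \<le> exp 1" using t(1) assms by simp
  also have "exp 1 \<le> (6::real)" using exp_le by simp
  finally have "\<bar>exp t / fact 3\<bar> \<le> 1" by (simp add: fact_numeral)
  then have "\<bar>exp t / fact 3 * y ^ 3\<bar> \<le> 1 * \<bar>y\<bar>^3" unfolding abs_mult power_abs by (intro mult_right_mono) auto
  moreover have "(\<Sum>j<3. y ^ j / fact j) = 1 + y + y^2 / 2" by (simp add: eval_nat_numeral)
  ultimately show ?thesis using t(2) by linarith
qed

text \<open>Pinsker with a worse constant, by the Gibbs inequality with a sign function.\<close>

lemma total_variation_le:
  assumes p: "ref_pvec J p" and q: "pvec J q" and a: "0 < a" "a \<le> 1" and kl: "KL J p q \<le> 2 * a^2"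
  shows "(\<Sum>j\<le>J. \<bar>q j - p j\<bar>) \<le> 3 * a"
proof -
  let ?g = "\<lambda>j. sgn (q j - p j)"
  have "(\<Sum>j\<le>J. q j * (a * ?g j)) \<le> KL J p q - 1 + (\<Sum>j\<le>J. p j * exp (a * ?g j))" by (rule Gibbs_inequality[OF p q])
  also have "(\<Sum>j\<le>J. p j * exp (a * ?g j)) \<le> (\<Sum>j\<le>J. p j * (1 + a * ?g j + a^2))"
  proof (intro sum_mono mult_left_mono)
    fix j
    have "a * ?g j \<le> 1" using a by (auto simp: sgn_if)
    then have "exp (a * ?g j) \<le> 1 + a * ?g j + (a * ?g j)^2" by (rule exp_le_quadratic)
    also have "(a * ?g j)^2 \<le> a^2" by (auto simp: sgn_if power_mult_distrib)
    finally show "exp (a * ?g j) \<le> 1 + a * ?g j + a^2" by simp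
  qed (use p in \<open>auto simp: ref_pvec_def pvec_def\<close>)
  also have "\<dots> = (\<Sum>j\<le>J. p j) + (\<Sum>j\<le>J. p j * (a * ?g j)) + (\<Sum>j\<le>J. p j) * a^2"
    by (simp only: distrib_left sum.distrib sum_distrib_right mult_1_right)
  also have "(\<Sum>j\<le>J. p j) = 1" using p by (simp add: ref_pvec_def pvec_def)
  finally have "(\<Sum>j\<le>J. q j * (a * ?g j)) - (\<Sum>j\<le>J. p j * (a * ?g j)) \<le> 3 * a^2" using kl by simp
  moreover have "(\<Sum>j\<le>J. q j * (a * ?g j)) - (\<Sum>j\<le>J. p j * (a * ?g j)) = a * (\<Sum>j\<le>J. \<bar>q j - p j\<bar>)"
    unfolding sum_subtractf[symmetric] sum_distrib_left by (intro sum.cong refl) (auto simp: sgn_if algebra_simps)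
  ultimately have "a * (\<Sum>j\<le>J. \<bar>q j - p j\<bar>) \<le> a * (3 * a)" by (simp add: power2_eq_square)
  then show ?thesis using a by simp
qed

text \<open>Lower bound for the rate: testing the entropy against a multiple of \<open>xi4\<close> gives the
  Gaussian exponent.\<close>

lemma grate_lower:
  assumes a: "0 < a" "a \<le> 1/10"
  shows "inverse (32 * delta4_sq) * a^2 - 2000 * a^3 \<le> grate a"
proof -
  let ?D = delta4_sq
  have D: "25795 / 1000000 \<le> ?D" "?D \<le> 25815 / 1000000" by (rule delta4_sq_bounds)+
  define \<theta> where "\<theta> = a / (16 * ?D)"
  have \<theta>: "0 < \<theta>" "\<theta> \<le> 243/100 * a"
  proof -
    show "0 < \<theta>" using a D by (simp add: \<theta>_def)
    have "a \<le> 243/100 * a * (16 * ?D)"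
    proof -
      have "1 \<le> 243/100 * (16 * ?D)" using D by simp
      then have "a * 1 \<le> a * (243/100 * (16 * ?D))" using a by (intro mult_left_mono) auto
      also have "a * (243/100 * (16 * ?D)) = 243/100 * a * (16 * ?D)" by (simp only: ac_simps)
      finally show ?thesis by (simp only: mult_1_right)
    qed
    moreover have pos: "0 < 16 * ?D" using D by simp
    ultimately show "\<theta> \<le> 243/100 * a" unfolding \<theta>_def by (intro iffD2[OF pos_divide_le_eq[OF pos]])
  qed
  have \<theta>1: "4 * \<theta> \<le> 1" "\<theta> \<le> 1" using \<theta> a by simp_all
  have \<theta>D: "\<theta> * a - 8 * \<theta>^2 * ?D = inverse (32 * ?D) * a^2"
    using D by (simp add: \<theta>_def power2_eq_square field_simps)
  have \<theta>2: "\<theta> * a^2 \<le> 243/100 * a^3" using mult_right_mono[OF \<theta>(2), of "a^2"] by (simp add: eval_nat_numeral)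
  have \<theta>3: "\<theta>^3 \<le> (243/100 * a)^3" using \<theta> by (intro power_mono) auto
  have \<theta>2': "\<theta>^2 \<le> \<theta>" using \<theta> \<theta>1 by (simp add: power2_eq_square mult_left_le)
  define m0 where "m0 = nat \<lceil>320 / a^3\<rceil> + 1"
  show ?thesis
  proof (rule grate_ge[of a m0])
    show "a < 1" using a by simp
    fix m q assume mm: "m0 \<le> m" and f: "feas m a q"
    have m: "0 < m" "320 / a^3 \<le> real m" using mm unfolding m0_def by linarith+
    let ?J = "m * m"
    have p: "ref_pvec ?J (gp m)" by (rule ref_pvec_gp[OF m(1)])
    have pp: "pvec ?J (gp m)" using p by (simp add: ref_pvec_def)
    obtain k where q: "pvec ?J q" and k: "1 \<le> k" "k \<le> ?J"
      and ex: "a < up_excess ?J k q \<or> a < down_excess ?J k q" using f by (auto simp: feas_def)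
    define N where "N = (\<Sum>j\<le>?J. \<bar>q j - gp m j\<bar>)"
    define S where "S = (\<Sum>x\<le>?J. q x * xig m k x)"
    show "inverse (32 * ?D) * a^2 - 2000 * a^3 \<le> KL ?J (gp m) q"
    proof (cases "KL ?J (gp m) q \<le> 2 * a^2")
      case False
      have "inverse (32 * ?D) \<le> inverse (32 * (25795 / 1000000))" using D by (intro le_imp_inverse_le) auto
      then have "inverse (32 * ?D) * a^2 \<le> 2 * a^2" by (intro mult_right_mono) auto
      moreover have "0 \<le> a^3" using a by simp
      ultimately show ?thesis using False by linarith
    next
      case True
      have N: "N \<le> 3 * a" "0 \<le> N" unfolding N_def
        by (rule total_variation_le[OF p q a(1) _ True]) (use a in \<open>auto intro: sum_nonneg\<close>)
      then have "N^2 \<le> (3 * a)^2" by (intro power_mono) auto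
      then have N2: "28 * N^2 \<le> 252 * a^2" by (simp add: power_mult_distrib)
      obtain s :: real where s: "s = 1 \<or> s = -1" and sS: "a - 252 * a^2 - 160 / m \<le> 4 * (s * S)"
      proof (cases "a < up_excess ?J k q")
        case True
        have "\<bar>kap ?J k q + cum q k - 1 + 4 * S\<bar> \<le> 28 * N^2 + 160 / m"
          unfolding S_def N_def by (rule excess_linearization[OF m(1) k _ q]) simp
        moreover have "0 \<le> q ?J" by (rule pvec_nonneg[OF q])
        ultimately have "a - 252 * a^2 - 160 / m \<le> 4 * (1 * S)" using True N2 unfolding up_excess_def by linarith
        then show ?thesis by (rule that[rotated]) simp
      next
        case False
        have "\<bar>kap ?J (k+1) q + cum q k - 1 + 4 * S\<bar> \<le> 28 * N^2 + 160 / m"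
          unfolding S_def N_def by (rule excess_linearization[OF m(1) k _ q]) simp
        then have "a - 252 * a^2 - 160 / m \<le> 4 * (-1 * S)" using False ex N2 unfolding down_excess_def by linarith
        then show ?thesis by (rule that[rotated]) simp
      qed
      define \<mu> where "\<mu> = (\<Sum>x\<le>?J. gp m x * xig m k x)"
      define V where "V = (\<Sum>x\<le>?J. gp m x * (xig m k x)\<^sup>2)"
      have \<mu>: "\<bar>\<mu>\<bar> \<le> 8 / m" unfolding \<mu>_def by (rule xig_moments(1)[OF m(1) k(2)])
      have "\<bar>V - delta4_sq_at (exp (real k / real m))\<bar> \<le> 16 / m" unfolding V_def by (rule xig_moments(2)[OF m(1) k(2)])
      moreover have "delta4_sq_at (exp (real k / real m)) \<le> ?D" by (rule delta4_sq_upper) simp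
      ultimately have V: "V \<le> ?D + 16 / m" by linarith
      let ?y = "\<lambda>x. 4 * \<theta> * s * xig m k x"
      have "(\<Sum>x\<le>?J. q x * ?y x) \<le> KL ?J (gp m) q - 1 + (\<Sum>x\<le>?J. gp m x * exp (?y x))" by (rule Gibbs_inequality[OF p q])
      also have "(\<Sum>x\<le>?J. gp m x * exp (?y x)) \<le> (\<Sum>x\<le>?J. gp m x * (1 + ?y x + 8 * \<theta>^2 * (xig m k x)\<^sup>2 + 64 * \<theta>^3))"
      proof (intro sum_mono mult_left_mono)
        fix x
        have "\<bar>?y x\<bar> = 4 * \<theta> * \<bar>xig m k x\<bar>" using s \<theta> by (auto simp: abs_mult)
        also have "\<dots> \<le> 4 * \<theta> * 1" using \<theta> xig_abs_le_1 by (intro mult_left_mono) auto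
        finally have y: "\<bar>?y x\<bar> \<le> 4 * \<theta>" by simp
        then have "exp (?y x) \<le> 1 + ?y x + (?y x)^2 / 2 + \<bar>?y x\<bar>^3" using \<theta>1 by (intro exp_le_cubic) linarith
        also have "(?y x)^2 / 2 = 8 * \<theta>^2 * (xig m k x)\<^sup>2" using s by (auto simp: power_mult_distrib)
        also have "\<bar>?y x\<bar>^3 \<le> (4 * \<theta>)^3" using y by (intro power_mono) auto
        also have "(4 * \<theta>)^3 = 64 * \<theta>^3" by (simp add: power_mult_distrib)
        finally show "exp (?y x) \<le> 1 + ?y x + 8 * \<theta>^2 * (xig m k x)\<^sup>2 + 64 * \<theta>^3" by simp
      qed (use pvec_nonneg[OF pp] in auto)
      also have "\<dots> = (\<Sum>x\<le>?J. gp m x + 4 * \<theta> * s * (gp m x * xig m k x)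
          + 8 * \<theta>^2 * (gp m x * (xig m k x)\<^sup>2) + 64 * \<theta>^3 * gp m x)"
        by (intro sum.cong refl) (simp add: algebra_simps)
      also have "\<dots> = (\<Sum>x\<le>?J. gp m x) + 4 * \<theta> * s * \<mu> + 8 * \<theta>^2 * V + 64 * \<theta>^3 * (\<Sum>x\<le>?J. gp m x)"
        unfolding \<mu>_def V_def by (simp only: sum.distrib sum_distrib_left)
      also have "(\<Sum>x\<le>?J. gp m x) = 1" by (rule pvec_sum[OF pp])
      finally have G: "(\<Sum>x\<le>?J. q x * ?y x) \<le> KL ?J (gp m) q + 4 * \<theta> * s * \<mu> + 8 * \<theta>^2 * V + 64 * \<theta>^3" by simp
      have lin: "A - x' - y' - z \<le> L" if "T \<le> L + x + y + z" "A \<le> T" "x \<le> x'" "y \<le> y'"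
        for A T L x y z x' y' :: real using that by linarith
      have "(\<Sum>x\<le>?J. q x * ?y x) = (\<Sum>x\<le>?J. \<theta> * (4 * (s * (q x * xig m k x))))"
        by (intro sum.cong refl) (simp only: ac_simps)
      also have "\<dots> = \<theta> * (4 * (s * S))" unfolding S_def by (simp only: sum_distrib_left)
      finally have "(\<Sum>x\<le>?J. q x * ?y x) = \<theta> * (4 * (s * S))" .
      then have "\<theta> * (4 * (s * S)) \<le> KL ?J (gp m) q + 4 * \<theta> * s * \<mu> + 8 * \<theta>^2 * V + 64 * \<theta>^3" using G by simp
      moreover have "\<theta> * (a - 252 * a^2 - 160 / m) \<le> \<theta> * (4 * (s * S))" using sS \<theta> by (intro mult_left_mono) auto
      moreover have "4 * \<theta> * s * \<mu> \<le> 4 * \<theta> * (8 / m)"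
      proof -
        have "s * \<mu> \<le> 8 / m" using s \<mu> by auto
        then have "4 * \<theta> * (s * \<mu>) \<le> 4 * \<theta> * (8 / m)" using \<theta> by (intro mult_left_mono) auto
        then show ?thesis by (simp add: mult.assoc)
      qed
      moreover have "8 * \<theta>^2 * V \<le> 8 * \<theta>^2 * (?D + 16 / m)" using V by (intro mult_left_mono) auto
      ultimately have "\<theta> * (a - 252 * a^2 - 160 / m) - 4 * \<theta> * (8 / m) - 8 * \<theta>^2 * (?D + 16 / m) - 64 * \<theta>^3 \<le> KL ?J (gp m) q"
        by (rule lin)
      moreover have "\<theta> * (a - 252 * a^2 - 160 / m) - 4 * \<theta> * (8 / m) - 8 * \<theta>^2 * (?D + 16 / m) - 64 * \<theta>^3
         = (\<theta> * a - 8 * \<theta>^2 * ?D) - 252 * (\<theta> * a^2) - 64 * \<theta>^3 - (192 * \<theta> + 128 * \<theta>^2) / m"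
        by (simp add: algebra_simps add_divide_distrib)
      moreover have "(192 * \<theta> + 128 * \<theta>^2) / m \<le> a^3"
      proof -
        have "(192 * \<theta> + 128 * \<theta>^2) / m \<le> 320 / m" using \<theta>1 \<theta>2' by (intro divide_right_mono) linarith+
        also have "\<dots> \<le> a^3" using m a by (simp add: field_simps)
        finally show ?thesis .
      qed
      moreover have "(243/100 * a)^3 = 14348907/1000000 * a^3" by (simp add: power_mult_distrib power_divide)
      moreover have "0 \<le> a^3" using a by simp
      ultimately show ?thesis unfolding \<theta>D using \<theta>2 \<theta>3 by linarith
    qed
  qed
qed

section \<open>Upper bound for the rate at small levels\<close>

lemma ln_one_plus_le_cubic:
  fixes u :: real assumes "-1 < u" shows "ln (1 + u) \<le> u - u^2 / 2 + u^3 / 3"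
proof -
  define g where "g = (\<lambda>u::real. u - u^2 / 2 + u^3 / 3 - ln (1 + u))"
  have d: "(g has_real_derivative x^3 / (1 + x)) (at x)" if "-1 < x" for x
    unfolding g_def by (rule derivative_eq_intros refl | use that in force)+
      (use that in \<open>simp add: divide_simps, simp add: algebra_simps eval_nat_numeral\<close>)
  have "g 0 \<le> g u"
  proof (cases "0 \<le> u")
    case True
    show ?thesis
    proof (rule DERIV_nonneg_imp_nondecreasing[where f=g and a=0 and b=u, OF True])
      fix x :: real assume "0 \<le> x" "x \<le> u"
      then show "\<exists>y. (g has_real_derivative y) (at x) \<and> 0 \<le> y" by (intro exI[of _ "x^3 / (1 + x)"] conjI d) auto
    qed
  next
    case False
    then have "u \<le> 0" by simp
    then show ?thesis
    proof (rule DERIV_nonpos_imp_nonincreasing[where f=g and a=u and b=0])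
      fix x :: real assume x: "u \<le> x" "x \<le> 0"
      have "x^3 \<le> 0" using x by (simp add: eval_nat_numeral mult_nonpos_nonneg mult_nonneg_nonpos zero_le_mult_iff mult_le_0_iff)
      then show "\<exists>y. (g has_real_derivative y) (at x) \<and> y \<le> 0"
        using x assms by (intro exI[of _ "x^3 / (1 + x)"] conjI d) (auto simp: divide_nonpos_pos)
    qed
  qed
  then show ?thesis by (simp add: g_def)
qed

lemma entropy_density_le:
  fixes u :: real assumes u: "\<bar>u\<bar> \<le> 1/2" shows "(1 + u) * ln (1 + u) \<le> u + u^2 / 2 + \<bar>u\<bar>^3"
proof -
  have "(1 + u) * ln (1 + u) \<le> (1 + u) * (u - u^2 / 2 + u^3 / 3)"
    using u by (intro mult_left_mono ln_one_plus_le_cubic) (auto simp: abs_le_iff)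
  also have "\<dots> = u + u^2 / 2 + (- (u^3) / 6 + u^3 * u / 3)" 
    by (simp add: algebra_simps eval_nat_numeral) (linarith | simp add: field_simps)
  also have "- (u^3) / 6 + u^3 * u / 3 \<le> \<bar>u\<bar>^3"
  proof -
    have "\<bar>u\<bar>^3 * \<bar>u\<bar> \<le> \<bar>u\<bar>^3 * (1/2)" using u by (intro mult_left_mono) auto
    then have "u^3 * u \<le> \<bar>u\<bar>^3 / 2" by (simp flip: power_abs abs_mult)
    moreover have "- (u^3) \<le> \<bar>u\<bar>^3" by (simp flip: power_abs)
    moreover have "0 \<le> \<bar>u\<bar>^3" by simp
    ultimately show ?thesis by linarith
  qed
  finally show ?thesis by simp
qed

lemma grate_le:
  assumes a: "a < 1" and ex: "\<And>m0. \<exists>m\<ge>m0. \<exists>q. feas m a q \<and> KL (m*m) (gp m) q \<le> B"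
  shows "grate a \<le> B"
proof (rule ccontr)
  assume "\<not> ?thesis"
  then obtain m0 where m0: "\<forall>m\<ge>m0. \<forall>q. feas m a q \<longrightarrow> B < KL (m*m) (gp m) q"
    using less_grateD[OF a, of B] by auto
  obtain m q where "m0 \<le> m" "feas m a q" "KL (m*m) (gp m) q \<le> B" using ex[of m0] by blast
  then show False using m0 by (meson not_less)
qed

lemma delta4_sq_at_exp_continuous:
  assumes L: "0 \<le> L" and e: "0 < e"
  shows "\<exists>d>0. \<forall>z. L \<le> z \<longrightarrow> z < L + d \<longrightarrow> delta4_sq_at (exp L) - e < delta4_sq_at (exp z)"
proof -
  define h where "h = (\<lambda>z::real. (45 * exp (- z) + 45 * (exp (- z))^2 - 252 * (exp (- z))^3 + 224 * (exp (- z))^4 - 62 * (exp (- z))^5) / 560)"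
  have h: "delta4_sq_at (exp z) = h z" if "0 \<le> z" for z
  proof -
    have "1 \<le> exp z" using that by simp
    then have "delta4_sq_at (exp z) = (45 * (1/exp z) + 45 * (1/exp z)^2 - 252 * (1/exp z)^3 + 224 * (1/exp z)^4 - 62 * (1/exp z)^5) / 560"
      by (rule delta4_sq_at_poly)
    then show ?thesis unfolding h_def exp_minus inverse_eq_divide .
  qed
  have "isCont h L" unfolding h_def by (intro continuous_intros) simp
  then obtain d where d: "0 < d" "\<forall>z. dist z L < d \<longrightarrow> dist (h z) (h L) < e"
    using e unfolding continuous_at_eps_delta by blast
  have "delta4_sq_at (exp L) - e < delta4_sq_at (exp z)" if z: "L \<le> z" "z < L + d" for z
  proof -
    have "dist (h z) (h L) < e" using d(2) z by (simp add: dist_real_def)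
    then show ?thesis using h[of z] h[OF L] z L by (simp add: dist_real_def)
  qed
  then show ?thesis using d(1) by blast
qed

text \<open>The density \<open>1 + 4\<theta>(\<xi> - \<mu>)\<close>: its excess is \<open>16
  \<theta> V\<close> and its cost \<open>8 \<theta>\<^sup>2 V\<close> to leading order, where
  \<open>V\<close> is the variance of \<open>\<xi>\<close>.\<close>

lemma tilted_by_xig:
  assumes m: "0 < m" and k: "1 \<le> k" "k \<le> m * m" and \<theta>: "0 < \<theta>" "\<theta> \<le> 1/16"
  defines "V \<equiv> \<Sum>x\<le>m*m. gp m x * (xig m k x)\<^sup>2"
  shows "\<exists>q. pvec (m*m) q \<and> 16 * \<theta> * V - 1792 * \<theta>^2 - 330 / m \<le> up_excess (m*m) k q
     \<and> KL (m*m) (gp m) q \<le> 8 * \<theta>^2 * V + 512 * \<theta>^3"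
proof -
  let ?J = "m * m"
  define \<mu> where "\<mu> = (\<Sum>x\<le>?J. gp m x * xig m k x)"
  define u where "u = (\<lambda>x. 4 * \<theta> * (xig m k x - \<mu>))"
  define q where "q = (\<lambda>x. gp m x * (1 + u x))"
  have pp: "pvec ?J (gp m)" using ref_pvec_gp[OF m] by (simp add: ref_pvec_def)
  have pn: "0 \<le> gp m x" for x by (rule pvec_nonneg[OF pp])
  have p1: "(\<Sum>x\<le>?J. gp m x) = 1" by (rule pvec_sum[OF pp])
  have "\<bar>\<mu>\<bar> \<le> (\<Sum>x\<le>?J. gp m x * 1)" unfolding \<mu>_def
  proof (intro order_trans[OF sum_abs] sum_mono)
    fix x
    have "\<bar>gp m x * xig m k x\<bar> = gp m x * \<bar>xig m k x\<bar>" using pn[of x] by (simp add: abs_mult)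
    also have "\<dots> \<le> gp m x * 1" by (intro mult_left_mono xig_abs_le_1 pn)
    finally show "\<bar>gp m x * xig m k x\<bar> \<le> gp m x * 1" .
  qed
  then have \<mu>1: "\<bar>\<mu>\<bar> \<le> 1" using p1 by simp
  have \<mu>m: "\<bar>\<mu>\<bar> \<le> 8 / m" unfolding \<mu>_def by (rule xig_moments(1)[OF m k(2)])
  have u8: "\<bar>u x\<bar> \<le> 8 * \<theta>" for x
  proof -
    have "\<bar>xig m k x - \<mu>\<bar> \<le> 2" using xig_abs_le_1[of m k x] \<mu>1 by linarith
    then have "4 * \<theta> * \<bar>xig m k x - \<mu>\<bar> \<le> 4 * \<theta> * 2" using \<theta> by (intro mult_left_mono) auto
    then show ?thesis using \<theta> by (simp add: u_def abs_mult)
  qed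
  have u12: "\<bar>u x\<bar> \<le> 1/2" for x using u8[of x] \<theta> by linarith
  have pu: "(\<Sum>x\<le>?J. gp m x * u x) = 0"
  proof -
    have "(\<Sum>x\<le>?J. gp m x * u x) = (\<Sum>x\<le>?J. 4 * \<theta> * (gp m x * xig m k x) - 4 * \<theta> * \<mu> * gp m x)"
      by (intro sum.cong refl) (simp add: u_def algebra_simps)
    also have "\<dots> = 4 * \<theta> * \<mu> - 4 * \<theta> * \<mu> * 1" unfolding sum_subtractf sum_distrib_left[symmetric] p1 \<mu>_def by simp
    finally show ?thesis by simp
  qed
  have q: "pvec ?J q"
    unfolding pvec_def
  proof (intro conjI allI impI)
    fix x
    have "0 \<le> 1 + u x" using u12[of x] by linarith
    then show "0 \<le> q x" using pn[of x] by (simp add: q_def)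
    show "q x = 0" if "?J < x" using pp that by (simp add: q_def pvec_def)
  next
    have "(\<Sum>x\<le>?J. q x) = (\<Sum>x\<le>?J. gp m x) + (\<Sum>x\<le>?J. gp m x * u x)"
      by (simp add: q_def distrib_left sum.distrib)
    then show "(\<Sum>x\<le>?J. q x) = 1" using p1 pu by simp
  qed
  have var: "(\<Sum>x\<le>?J. gp m x * (xig m k x - \<mu>)^2) = V - \<mu>^2"
  proof -
    have "(\<Sum>x\<le>?J. gp m x * (xig m k x - \<mu>)^2)
       = (\<Sum>x\<le>?J. gp m x * (xig m k x)\<^sup>2 - 2 * \<mu> * (gp m x * xig m k x) + \<mu>^2 * gp m x)"
      by (intro sum.cong refl) (simp add: power2_eq_square algebra_simps)
    also have "\<dots> = V - 2 * \<mu> * \<mu> + \<mu>^2 * 1"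
      unfolding sum_subtractf sum.distrib sum_distrib_left[symmetric] p1 V_def \<mu>_def by simp
    finally show ?thesis by (simp add: power2_eq_square)
  qed
  have S: "(\<Sum>x\<le>?J. q x * xig m k x) = \<mu> + 4 * \<theta> * (V - \<mu>^2)"
  proof -
    have "(\<Sum>x\<le>?J. q x * xig m k x)
       = (\<Sum>x\<le>?J. gp m x * xig m k x + 4 * \<theta> * (gp m x * (xig m k x - \<mu>)^2) + \<mu> * (gp m x * u x))"
      by (intro sum.cong refl) (simp add: q_def u_def power2_eq_square algebra_simps)
    also have "\<dots> = \<mu> + 4 * \<theta> * (V - \<mu>^2) + \<mu> * 0"
      unfolding sum.distrib sum_distrib_left[symmetric] var pu unfolding \<mu>_def by simp
    finally show ?thesis by simp
  qed
  define N where "N = (\<Sum>x\<le>?J. \<bar>q x - gp m x\<bar>)"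
  have "N \<le> (\<Sum>x\<le>?J. gp m x * (8 * \<theta>))" unfolding N_def
  proof (intro sum_mono)
    fix x
    have "\<bar>q x - gp m x\<bar> = gp m x * \<bar>u x\<bar>" using pn[of x] by (simp add: q_def distrib_left abs_mult)
    also have "\<dots> \<le> gp m x * (8 * \<theta>)" using u8 pn by (intro mult_left_mono)
    finally show "\<bar>q x - gp m x\<bar> \<le> gp m x * (8 * \<theta>)" .
  qed
  then have "N \<le> 8 * \<theta>" using p1 by (simp flip: sum_distrib_right)
  moreover have "0 \<le> N" unfolding N_def by (intro sum_nonneg) simp
  ultimately have "N^2 \<le> (8 * \<theta>)^2" by (intro power_mono)
  then have N2: "28 * N^2 \<le> 1792 * \<theta>^2" by (simp add: power_mult_distrib)
  have lin: "\<bar>kap ?J k q + cum q k - 1 + 4 * (\<mu> + 4 * \<theta> * (V - \<mu>^2))\<bar> \<le> 28 * N^2 + 160 / m"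
    unfolding N_def S[symmetric] by (rule excess_linearization[OF m k _ q]) simp
  have qJ: "q ?J \<le> 2 * (1 / m)"
  proof -
    have "gp m ?J * (1 + u ?J) \<le> 1 / m * 2" using u12[of ?J] gp_le[OF m, of ?J] by (intro mult_mono) auto
    then show ?thesis by (simp add: q_def)
  qed
  have \<mu>2: "\<mu>^2 \<le> 8 / m"
  proof -
    have "\<bar>\<mu>\<bar> * \<bar>\<mu>\<bar> \<le> 1 * (8 / m)" using \<mu>1 \<mu>m by (intro mult_mono) auto
    then show ?thesis by (simp add: power2_eq_square flip: abs_mult)
  qed
  have "16 * \<theta> * \<mu>^2 \<le> 1 * (8 / m)" using \<theta> \<mu>2 by (intro mult_mono) auto
  moreover have "4 * (\<mu> + 4 * \<theta> * (V - \<mu>^2)) = 4 * \<mu> + 16 * \<theta> * V - 16 * \<theta> * \<mu>^2" by (simp add: algebra_simps)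
  moreover have "0 \<le> 1 / real m" by simp
  ultimately have ex: "16 * \<theta> * V - 1792 * \<theta>^2 - 330 / m \<le> up_excess ?J k q"
    using lin N2 qJ \<mu>m unfolding up_excess_def by linarith
  have "KL ?J (gp m) q \<le> (\<Sum>x\<le>?J. gp m x * u x + 8 * \<theta>^2 * (gp m x * (xig m k x - \<mu>)^2) + 512 * \<theta>^3 * gp m x)"
    unfolding KL_def
  proof (intro sum_mono)
    fix x assume "x \<in> {..?J}"
    then have gpos: "0 < gp m x" by (intro gp_pos[OF m]) simp
    have "q x * ln (q x / gp m x) = gp m x * ((1 + u x) * ln (1 + u x))" using gpos by (simp add: q_def)
    also have "\<dots> \<le> gp m x * (u x + (u x)^2 / 2 + (8 * \<theta>)^3)"
    proof (rule mult_left_mono[OF _ pn])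
      have "(1 + u x) * ln (1 + u x) \<le> u x + (u x)^2 / 2 + \<bar>u x\<bar>^3" by (rule entropy_density_le[OF u12])
      also have "\<bar>u x\<bar>^3 \<le> (8 * \<theta>)^3" using u8 by (intro power_mono) auto
      finally show "(1 + u x) * ln (1 + u x) \<le> u x + (u x)^2 / 2 + (8 * \<theta>)^3" by simp
    qed
    also have "(u x)^2 = 16 * \<theta>^2 * (xig m k x - \<mu>)^2" unfolding u_def by (simp only: power_mult_distrib) simp
    also have "gp m x * (u x + 16 * \<theta>^2 * (xig m k x - \<mu>)^2 / 2 + (8 * \<theta>)^3)
        = gp m x * u x + 8 * \<theta>^2 * (gp m x * (xig m k x - \<mu>)^2) + 512 * \<theta>^3 * gp m x"
      by (simp add: power_mult_distrib distrib_left mult_ac)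
    finally show "q x * ln (q x / gp m x) \<le> \<dots>" .
  qed
  also have "\<dots> = 8 * \<theta>^2 * (V - \<mu>^2) + 512 * \<theta>^3"
    unfolding sum.distrib sum_distrib_left[symmetric] var pu p1 by simp
  also have "\<dots> \<le> 8 * \<theta>^2 * V + 512 * \<theta>^3" by (simp add: mult_left_mono)
  finally show ?thesis using q ex by blast
qed

text \<open>Grid points accumulate at every level, and the variance is continuous in it.\<close>

lemma exists_level_near_sup:
  assumes e: "0 < e"
  shows "\<exists>m0. \<forall>m\<ge>m0. \<exists>k. 1 \<le> k \<and> k \<le> m * m \<and> delta4_sq - e < delta4_sq_at (exp (real k / real m))"
proof -
  have "{1::real..} \<noteq> {}" by auto
  then obtain t where t: "1 \<le> t" "delta4_sq - e/2 < delta4_sq_at t"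
    using less_cSUP_iff[OF _ delta4_sq_bdd, of "delta4_sq - e/2"] e unfolding delta4_sq_def by auto
  define L where "L = ln t"
  have L: "0 \<le> L" "exp L = t" using t by (simp_all add: L_def)
  have e2: "0 < e/2" using e by simp
  obtain d where d: "0 < d" "\<forall>z. L \<le> z \<longrightarrow> z < L + d \<longrightarrow> delta4_sq_at (exp L) - e/2 < delta4_sq_at (exp z)"
    using delta4_sq_at_exp_continuous[OF L(1) e2] by blast
  define m0 where "m0 = nat \<lceil>L + 1\<rceil> + nat \<lceil>1 / d\<rceil> + 1"
  have "\<exists>k. 1 \<le> k \<and> k \<le> m * m \<and> delta4_sq - e < delta4_sq_at (exp (real k / real m))" if m: "m0 \<le> m" for m
  proof -
    have m1: "1 \<le> real m" "L + 1 \<le> real m" "1 / d < real m" using m L unfolding m0_def by linarith+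
    define k where "k = nat \<lfloor>real m * L\<rfloor> + 1"
    have mL: "0 \<le> real m * L" using L by simp
    have k: "real m * L < real k" "real k \<le> real m * L + 1" unfolding k_def using mL by linarith+
    have "real m * L \<le> real m * (real m - 1)" using m1 by (intro mult_left_mono) auto
    then have "real k \<le> real (m * m)" using k m1 by (simp add: right_diff_distrib)
    then have kJ: "k \<le> m * m" by (simp only: of_nat_le_iff)
    have "L \<le> real k / real m" using k m1 by (simp add: pos_le_divide_eq mult.commute)
    moreover have "real k / real m < L + d"
    proof -
      have "1 < d * real m" using m1 d by (simp add: pos_divide_less_eq mult.commute)
      moreover have "(L + d) * real m = real m * L + d * real m" by (simp add: algebra_simps)
      ultimately have "real k < (L + d) * real m" using k by linarith
      then show ?thesis using m1 by (simp add: pos_divide_less_eq)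
    qed
    ultimately have "delta4_sq_at (exp L) - e/2 < delta4_sq_at (exp (real k / real m))" using d(2) by blast
    then have "delta4_sq - e < delta4_sq_at (exp (real k / real m))" using t L by simp
    then show ?thesis using kJ by (intro exI[of _ k]) (simp add: k_def)
  qed
  then show ?thesis by blast
qed

text \<open>The parameter \<open>\<theta>\<close> overshoots the optimal value \<open>a / (16
  \<delta>\<^sup>2)\<close> by a relative amount of order \<open>a\<close>, which pays for the
  quadratic error of the linearization and for a level \<open>t\<close> that only nearly
  maximizes the variance.\<close>

lemma grate_upper:
  assumes a: "0 < a" "a \<le> 1/180000"
  shows "grate a \<le> inverse (32 * delta4_sq) * a^2 + 2000000 * a^3"
proof (rule grate_le)
  let ?D = delta4_sq
  have D: "25795 / 1000000 \<le> ?D" "?D \<le> 25815 / 1000000" by (rule delta4_sq_bounds)+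
  show "a < 1" using a by simp
  define v where "v = ?D * (1 - 2 * a)"
  define c where "c = 1 + 180000 * a"
  have c: "1 \<le> c" "c \<le> 2" using a by (simp_all add: c_def)
  have "1/80 \<le> 25795 / 1000000 * (1 - 2 * a)" using a by simp
  also have "\<dots> \<le> v" unfolding v_def using D a by (intro mult_right_mono) auto
  finally have v: "1/80 \<le> v" .
  define \<theta> where "\<theta> = a * c / (16 * v)"
  have \<theta>0: "0 < \<theta>" using a c v by (simp add: \<theta>_def)
  have "a * c \<le> a * (10 * (16 * v))" using a c v by (intro mult_left_mono) auto
  then have \<theta>a: "\<theta> \<le> 10 * a" using v by (simp add: \<theta>_def pos_divide_le_eq mult_ac)
  have \<theta>16: "\<theta> \<le> 1/16" using \<theta>a a by simp
  have "16 * \<theta> * v = a * c" using v by (simp add: \<theta>_def)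
  also have "\<dots> = a + 180000 * a^2" by (simp add: c_def algebra_simps power2_eq_square)
  finally have \<theta>v: "16 * \<theta> * v = a + 180000 * a^2" .
  have "\<theta>^2 \<le> (10 * a)^2" using \<theta>0 \<theta>a by (intro power_mono) auto
  then have \<theta>2: "\<theta>^2 \<le> 100 * a^2" by (simp add: power_mult_distrib)
  have "\<theta>^3 \<le> (10 * a)^3" using \<theta>0 \<theta>a by (intro power_mono) auto
  then have \<theta>3: "\<theta>^3 \<le> 1000 * a^3" by (simp add: power_mult_distrib)
  have main: "8 * \<theta>^2 * ?D \<le> inverse (32 * ?D) * a^2 + 1440100 * a^3"
  proof -
    define w where "w = c / (1 - 2 * a)"
    have a1: "0 < 1 - 2 * a" using a by simp
    have "180008 * a * a \<le> 3 * a" using a by (intro mult_right_mono) auto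
    then have "c \<le> (1 + 180008 * a) * (1 - 2 * a)" by (simp add: c_def algebra_simps)
    then have w: "w \<le> 1 + 180008 * a" using a1 by (simp add: w_def pos_divide_le_eq)
    have w0: "0 \<le> w" using c a1 by (simp add: w_def)
    have "w^2 \<le> (1 + 180008 * a)^2" using w w0 by (intro power_mono)
    also have "\<dots> = 1 + 360016 * a + (180008 * a) * (180008 * a)" by (simp add: power2_eq_square algebra_simps)
    also have "(180008 * a) * (180008 * a) \<le> 2 * (180008 * a)" using a by (intro mult_right_mono) auto
    finally have w2: "w^2 \<le> 1 + 720032 * a" by simp
    have D0: "0 < ?D" using D by simp
    have \<theta>w: "\<theta> = a * w / (16 * ?D)"
      unfolding \<theta>_def v_def w_def using D0 a1 by ((simp add: mult_ac; fail) | (simp add: field_simps; fail))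
    have "8 * \<theta>^2 * ?D = inverse (32 * ?D) * a^2 * w^2"
      unfolding \<theta>w using D0 by (simp add: power2_eq_square field_simps)
    also have "\<dots> \<le> inverse (32 * ?D) * a^2 * (1 + 720032 * a)" using w2 D0 by (intro mult_left_mono) auto
    also have "\<dots> = inverse (32 * ?D) * a^2 + inverse (32 * ?D) * (720032 * a^3)"
      by (simp add: algebra_simps eval_nat_numeral)
    also have "inverse (32 * ?D) * (720032 * a^3) \<le> 2 * (720032 * a^3)"
    proof (rule mult_right_mono)
      have "inverse (32 * ?D) \<le> inverse (32 * (25795 / 1000000))" using D by (intro le_imp_inverse_le) auto
      then show "inverse (32 * ?D) \<le> 2" by simp
    qed (use a in simp)
    finally have "8 * \<theta>^2 * ?D \<le> inverse (32 * ?D) * a^2 + 2 * (720032 * a^3)" by simp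
    moreover have "0 \<le> a^3" using a by simp
    ultimately show ?thesis by linarith
  qed
  have "0 < ?D * a" using D a by simp
  then obtain m1 where m1: "\<forall>m\<ge>m1. \<exists>k. 1 \<le> k \<and> k \<le> m * m \<and> ?D - ?D * a < delta4_sq_at (exp (real k / real m))"
    using exists_level_near_sup by blast
  fix m0
  define m where "m = max (max m0 m1) (nat \<lceil>1000 / a^2\<rceil> + 1)"
  have mm: "m0 \<le> m" "m1 \<le> m" by (simp_all add: m_def)
  have "1000 / a^2 \<le> real (nat \<lceil>1000 / a^2\<rceil> + 1)" by linarith
  also have "\<dots> \<le> real m" by (simp only: of_nat_le_iff m_def max.cobounded2)
  finally have "1000 / a^2 \<le> real m" .
  moreover have "0 < 1000 / a^2" using a by simp
  ultimately have mpos: "0 < real m" and im: "1000 / a^2 \<le> real m" by linarith+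
  have m: "0 < m" using mpos by simp
  have inv: "1 / m \<le> a^2 / 1000" using im mpos a by (simp add: field_simps)
  have a23: "a^2 \<le> 1/180000 * a" using a by (simp add: power2_eq_square mult_right_mono)
  obtain k where k: "1 \<le> k" "k \<le> m * m" "?D - ?D * a < delta4_sq_at (exp (real k / real m))" using m1 mm by blast
  define V where "V = (\<Sum>x\<le>m*m. gp m x * (xig m k x)\<^sup>2)"
  have Vd: "\<bar>V - delta4_sq_at (exp (real k / real m))\<bar> \<le> 16 * (1 / m)"
    using xig_moments(2)[OF m k(2)] by (simp add: V_def)
  have "25795 / 1000000 * a \<le> ?D * a" using D a by (intro mult_right_mono) auto
  then have "16 * (1 / m) \<le> ?D * a" using inv a23 a by linarith
  then have Vl: "v \<le> V" using Vd k(3) unfolding v_def by (simp add: algebra_simps)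
  have "delta4_sq_at (exp (real k / real m)) \<le> ?D" by (rule delta4_sq_upper) simp
  then have Vu: "V \<le> ?D + 16 * (1 / m)" using Vd by linarith
  obtain q where q: "pvec (m*m) q" "16 * \<theta> * V - 1792 * \<theta>^2 - 330 / m \<le> up_excess (m*m) k q"
    "KL (m*m) (gp m) q \<le> 8 * \<theta>^2 * V + 512 * \<theta>^3"
    using tilted_by_xig[OF m k(1,2) \<theta>0 \<theta>16] unfolding V_def by blast
  have "16 * \<theta> * v \<le> 16 * \<theta> * V" using Vl \<theta>0 by (intro mult_left_mono) auto
  moreover have "330 / m = 330 * (1 / m)" by simp
  moreover have "0 < a^2" using a by simp
  ultimately have "a < up_excess (m*m) k q" using q(2) \<theta>v \<theta>2 inv by linarith
  then have "feas m a q" using q(1) k by (auto simp: feas_def)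
  moreover have "KL (m*m) (gp m) q \<le> inverse (32 * ?D) * a^2 + 2000000 * a^3"
  proof -
    have "8 * \<theta>^2 * V \<le> 8 * \<theta>^2 * (?D + 16 * (1 / m))" using Vu by (intro mult_left_mono) auto
    also have "\<dots> = 8 * \<theta>^2 * ?D + 128 * (\<theta>^2 * (1 / m))" by (simp add: algebra_simps)
    finally have "8 * \<theta>^2 * V \<le> 8 * \<theta>^2 * ?D + 128 * (\<theta>^2 * (1 / m))" by simp
    moreover have "128 * (\<theta>^2 * (1 / m)) \<le> 13 * a^3"
    proof -
      have "\<theta>^2 * (1 / m) \<le> (100 * a^2) * (a^2 / 1000)" using \<theta>2 inv by (intro mult_mono) auto
      also have "\<dots> = a^3 * a / 10" by (simp add: eval_nat_numeral)
      also have "\<dots> \<le> a^3 * 1 / 10" using a by (intro divide_right_mono mult_left_mono) auto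
      finally have "\<theta>^2 * (1 / m) \<le> a^3 * 1 / 10" .
      moreover have "0 \<le> a^3" using a by simp
      ultimately show ?thesis by linarith
    qed
    moreover have "0 \<le> a^3" using a by simp
    ultimately show ?thesis using q(3) main \<theta>3 by linarith
  qed
  ultimately show "\<exists>m\<ge>m0. \<exists>q. feas m a q \<and> KL (m*m) (gp m) q \<le> inverse (32 * ?D) * a^2 + 2000000 * a^3"
    using mm(1) by blast
qed

section \<open>Asymptotics of the rate\<close>

lemma grate_asymptotics:
  assumes a: "0 < a" "a \<le> 1/180000"
  shows "\<bar>grate a - inverse (32 * delta4_sq) * a^2\<bar> \<le> 2000000 * a^3"
proof -
  have "inverse (32 * delta4_sq) * a^2 - 2000 * a^3 \<le> grate a" using a by (intro grate_lower) auto
  moreover have "grate a \<le> inverse (32 * delta4_sq) * a^2 + 2000000 * a^3" by (rule grate_upper[OF a])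
  moreover have "0 \<le> a^3" using a by simp
  ultimately show ?thesis by linarith
qed

lemma grate_quadratic:
  defines "r \<equiv> \<lambda>a. grate a / (inverse (32 * delta4_sq) * a^2) - 1"
  shows "r \<in> o[at_right 0](\<lambda>_. 1 :: real)"
    and "\<forall>\<^sub>F a in at_right 0. grate a = inverse (32 * delta4_sq) * a^2 * (1 + r a)"
proof -
  define c where "c = inverse (32 * delta4_sq)"
  have c: "0 < c" using delta4_sq_bounds(1) by (simp add: c_def)
  have small: "\<forall>\<^sub>F a :: real in at_right 0. a \<in> {0<..<1/180000}"
    by (rule eventually_at_right_real) simp
  have "\<forall>\<^sub>F a in at_right 0. norm (r a) \<le> 2000000 / c * a"
    using small
  proof eventually_elim
    case (elim a)
    then have a: "0 < a" "a \<le> 1/180000" by auto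
    have pos: "0 < c * a^2" using a c by simp
    have "r a = (grate a - c * a^2) / (c * a^2)"
      using a c unfolding r_def c_def[symmetric] by (simp add: diff_divide_distrib)
    then have "norm (r a) = \<bar>grate a - c * a^2\<bar> / (c * a^2)" using pos by (simp only: real_norm_def abs_divide abs_of_pos)
    also have "\<dots> \<le> 2000000 * a^3 / (c * a^2)"
      using grate_asymptotics[OF a] pos unfolding c_def[symmetric] by (intro divide_right_mono) auto
    also have "\<dots> = 2000000 / c * a" using a c by (simp add: field_simps eval_nat_numeral)
    finally show ?case .
  qed
  moreover have "((\<lambda>a. 2000000 / c * a) \<longlongrightarrow> 0) (at_right 0)" using c by (auto intro!: tendsto_eq_intros)
  ultimately have "(r \<longlongrightarrow> 0) (at_right 0)" by (rule Lim_null_comparison)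
  then show "r \<in> o[at_right 0](\<lambda>_. 1 :: real)" by (intro smalloI_tendsto) simp_all
  show "\<forall>\<^sub>F a in at_right 0. grate a = inverse (32 * delta4_sq) * a^2 * (1 + r a)"
    using small
  proof eventually_elim
    case (elim a)
    then have "c * a^2 \<noteq> 0" using c by simp
    then show ?case unfolding r_def c_def[symmetric] by simp
  qed
qed

theorem theorem7:
  "(\<exists>f :: real \<Rightarrow> ereal.
      (\<forall>(M :: 'a measure) X lam. lam > 0 \<longrightarrow> iid_pareto M X lam \<longrightarrow>
         (\<forall>a>0. (\<lambda>n. ereal (1 / real n) *
                      ln_prob (measure M {\<omega> \<in> space M. D_stat n (\<lambda>i. X i \<omega>) > a}))
                  \<longlonglongrightarrow> - f a)) \<and>
      (\<exists>a0>0. (\<forall>a\<in>{0<..<a0}. \<bar>f a\<bar> \<noteq> \<infinity>) \<and> continuous_on {0<..<a0} f) \<and>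
      (\<exists>r \<in> o[at_right 0](\<lambda>_. 1 :: real).
         \<forall>\<^sub>F a in at_right 0. f a = ereal (inverse (32 * delta4_sq) * a\<^sup>2 * (1 + r a)))) \<and>
   (\<forall>t\<ge>1. delta4_sq_at t =
      1 / (560 * t ^ 5) * (45 * t ^ 4 + 45 * t ^ 3 - 252 * t\<^sup>2 + 224 * t - 62)) \<and>
   \<bar>inverse (32 * delta4_sq) - 1.211\<bar> \<le> 0.0005"
proof (intro conjI)
  define f :: "real \<Rightarrow> ereal" where "f = (\<lambda>a. if a < 1 then ereal (grate a) else \<infinity>)"
  have lim: "\<forall>(M :: 'a measure) X lam. lam > 0 \<longrightarrow> iid_pareto M X lam \<longrightarrow>
         (\<forall>a>0. (\<lambda>n. ereal (1 / real n) *
                      ln_prob (measure M {\<omega> \<in> space M. D_stat n (\<lambda>i. X i \<omega>) > a})) \<longlonglongrightarrow> - f a)"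
    using large_deviation_limit by (simp only: f_def) blast
  have fin: "\<forall>a\<in>{0<..<1}. \<bar>f a\<bar> \<noteq> \<infinity>" by (simp add: f_def)
  have "continuous_on {0<..<1} (\<lambda>a. ereal (grate a))"
    by (intro continuous_on_ereal continuous_at_imp_continuous_on ballI isCont_grate) auto
  then have cont: "continuous_on {0<..<1} f"
    by (rule continuous_on_eq) (simp add: f_def)
  let ?r = "\<lambda>a. grate a / (inverse (32 * delta4_sq) * a^2) - 1"
  have "\<forall>\<^sub>F a :: real in at_right 0. a \<in> {0<..<1}" by (rule eventually_at_right_real) simp
  then have "\<forall>\<^sub>F a in at_right 0. f a = ereal (inverse (32 * delta4_sq) * a\<^sup>2 * (1 + ?r a))"
    using grate_quadratic(2) by eventually_elim (simp only: f_def greaterThanLessThan_iff if_True)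
  then have asym: "\<exists>r \<in> o[at_right 0](\<lambda>_. 1 :: real).
      \<forall>\<^sub>F a in at_right 0. f a = ereal (inverse (32 * delta4_sq) * a\<^sup>2 * (1 + r a))"
    by (rule bexI[where x="?r"]) (rule grate_quadratic(1))
  have "\<exists>a0>0. (\<forall>a\<in>{0<..<a0}. \<bar>f a\<bar> \<noteq> \<infinity>) \<and> continuous_on {0<..<a0} f"
    using fin cont zero_less_one by blast
  then show "\<exists>f :: real \<Rightarrow> ereal.
      (\<forall>(M :: 'a measure) X lam. lam > 0 \<longrightarrow> iid_pareto M X lam \<longrightarrow>
         (\<forall>a>0. (\<lambda>n. ereal (1 / real n) *
                      ln_prob (measure M {\<omega> \<in> space M. D_stat n (\<lambda>i. X i \<omega>) > a}))
                  \<longlonglongrightarrow> - f a)) \<and>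
      (\<exists>a0>0. (\<forall>a\<in>{0<..<a0}. \<bar>f a\<bar> \<noteq> \<infinity>) \<and> continuous_on {0<..<a0} f) \<and>
      (\<exists>r \<in> o[at_right 0](\<lambda>_. 1 :: real).
         \<forall>\<^sub>F a in at_right 0. f a = ereal (inverse (32 * delta4_sq) * a\<^sup>2 * (1 + r a)))"
    using lim asym by blast
  show "\<forall>t\<ge>1. delta4_sq_at t = 1 / (560 * t ^ 5) * (45 * t ^ 4 + 45 * t ^ 3 - 252 * t\<^sup>2 + 224 * t - 62)"
    using delta4_sq_at_eq by blast
  show "\<bar>inverse (32 * delta4_sq) - 1.211\<bar> \<le> 0.0005" by (rule delta4_sq_numeric)
qed

end
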